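(* Let $(\mathcal{M},g,\mu)$ be a complete, connected, non-compact, boundaryless weighted Riemannian manifold of dimension $d\ge 2$. Let $u\in C^3(\mathcal{M})$ be a non-negative solution of $$-\mathcal{L}u=u^p\quad\text{in }\mathcal{M}$$ for some $p>1$. If there is $o\in\mathcal{M}$ such that $\mu(\mathcal{B}_R(o))=o\!\left(R^{\frac{2p}{p-1}}\right)$ as $R\to+\infty$ (little-o notation on the right-hand side), then $u\equiv 0$.
   Context: A weighted Riemannian manifold $(\mathcal{M},g,\mu)$ is a Riemannian manifold $(\mathcal{M},g)$ of dimension $d$ with a measure $d\mu=e^{-f}\,d\nu$, where $f\in C^2(\mathcal{M})$ and $d\nu$ is the Riemannian volume element. The weighted Laplacian is $\mathcal{L}w=\Delta w-\nabla f\cdot\nabla w=e^{f}\mathrm{div}(e^{-f}\nabla w)$. $\mathcal{B}_R(o)$ is the geodesic ball of radius $R$ centered at $o$. *)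

theory Defs
  imports "HOL-Analysis.Analysis" "HOL-Library.Landau_Symbols"
begin

section \<open>Functions of class C^k on open sets of a normed space\<close>

text \<open>Only meant for open S, where it is the usual notion: all iterated directional
  derivatives up to order k exist (as total derivatives) and are continuous.\<close>

fun Ck_on :: "nat \<Rightarrow> 'a::real_normed_vector set \<Rightarrow> ('a \<Rightarrow> 'b::real_normed_vector) \<Rightarrow> bool" where
  "Ck_on 0 S F \<longleftrightarrow> continuous_on S F"
| "Ck_on (Suc k) S F \<longleftrightarrow>
     (\<forall>x\<in>S. F differentiable (at x)) \<and> (\<forall>v. Ck_on k S (\<lambda>x. frechet_derivative F (at x) v))"

definition smooth_on :: "'a::real_normed_vector set \<Rightarrow> ('a \<Rightarrow> 'b::real_normed_vector) \<Rightarrow> bool" where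
  "smooth_on S F \<longleftrightarrow> (\<forall>k. Ck_on k S F)"


section \<open>Smooth manifolds\<close>

text \<open>A manifold is the whole of a type 'm (Hausdorff and second countable, by its classes),
  with a smooth atlas modelled on real^'n; so its dimension is CARD('n).  A chart is a pair of
  its domain, a subset of 'm, and its coordinate map, which is only relevant on the domain.
  Charts have open images in real^'n: there is no boundary.\<close>

type_synonym ('m, 'n) chart = "'m set \<times> ('m \<Rightarrow> real^'n)"

abbreviation cdom :: "('m, 'n) chart \<Rightarrow> 'm set" where
  "cdom c \<equiv> fst c"

abbreviation coord :: "('m, 'n) chart \<Rightarrow> 'm \<Rightarrow> real^'n" where
  "coord c \<equiv> snd c"

definition cimage :: "('m, 'n) chart \<Rightarrow> (real^'n) set" where
  "cimage c = coord c ` cdom c"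

definition param :: "('m, 'n) chart \<Rightarrow> real^'n \<Rightarrow> 'm" where
  "param c = inv_into (cdom c) (coord c)"

definition transition :: "('m, 'n) chart \<Rightarrow> ('m, 'n) chart \<Rightarrow> real^'n \<Rightarrow> real^'n" where
  "transition c c' = coord c' \<circ> param c"

definition smooth_atlas ::
    "('m::{t2_space, second_countable_topology}, 'n::finite) chart set \<Rightarrow> bool" where
  "smooth_atlas A \<longleftrightarrow>
     (\<Union>c\<in>A. cdom c) = UNIV \<and>
     (\<forall>c\<in>A. open (cdom c) \<and> open (cimage c) \<and>
            homeomorphism (cdom c) (cimage c) (coord c) (param c)) \<and>
     (\<forall>c\<in>A. \<forall>c'\<in>A. smooth_on (coord c ` (cdom c \<inter> cdom c')) (transition c c'))"

definition Ck_fun :: "('m, 'n::finite) chart set \<Rightarrow> nat \<Rightarrow> ('m \<Rightarrow> real) \<Rightarrow> bool" where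
  "Ck_fun A k w \<longleftrightarrow> (\<forall>c\<in>A. Ck_on k (cimage c) (w \<circ> param c))"


section \<open>Riemannian metrics\<close>

text \<open>A metric is given by its components: G c x is the matrix of the g_ij of the chart c at
  the point with coordinates x.  The last clause is the transformation law of a covariant
  2-tensor.\<close>

type_synonym ('m, 'n) metric_components = "('m, 'n) chart \<Rightarrow> real^'n \<Rightarrow> real^'n^'n"

definition riemannian_metric ::
    "('m, 'n::finite) chart set \<Rightarrow> ('m, 'n) metric_components \<Rightarrow> bool" where
  "riemannian_metric A G \<longleftrightarrow>
     (\<forall>c\<in>A. smooth_on (cimage c) (G c) \<and>
        (\<forall>x\<in>cimage c. transpose (G c x) = G c x \<and> (\<forall>v. v \<noteq> 0 \<longrightarrow> v \<bullet> (G c x *v v) > 0))) \<and>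
     (\<forall>c\<in>A. \<forall>c'\<in>A. \<forall>x\<in>coord c ` (cdom c \<inter> cdom c').
        let J = matrix (frechet_derivative (transition c c') (at x))
        in G c x = transpose J ** G c' (transition c c' x) ** J)"


subsection \<open>Distance, geodesic balls and completeness\<close>

text \<open>As in the library's piecewise C^1 functions, finitely many parameters (which may include
  the end points) are exempt from differentiability.\<close>

definition piecewise_C1_path ::
    "('m::topological_space, 'n::finite) chart set \<Rightarrow> (real \<Rightarrow> 'm) \<Rightarrow> bool" where
  "piecewise_C1_path A \<gamma> \<longleftrightarrow> path \<gamma> \<and>
     (\<exists>S. finite S \<and>
       (\<forall>c\<in>A. (coord c \<circ> \<gamma>) C1_differentiable_on ({t\<in>{0..1}. \<gamma> t \<in> cdom c} - S)))"

definition chart_at :: "('m, 'n) chart set \<Rightarrow> 'm \<Rightarrow> ('m, 'n) chart" where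
  "chart_at A q = (SOME c. c \<in> A \<and> q \<in> cdom c)"

text \<open>The norm of the velocity does not depend on the chart in which it is computed, by the
  transformation law.\<close>

definition speed ::
    "('m, 'n::finite) chart set \<Rightarrow> ('m, 'n) metric_components \<Rightarrow> (real \<Rightarrow> 'm) \<Rightarrow> real \<Rightarrow> real" where
  "speed A G \<gamma> t =
     (let c = chart_at A (\<gamma> t); v = vector_derivative (coord c \<circ> \<gamma>) (at t)
      in sqrt (v \<bullet> (G c (coord c (\<gamma> t)) *v v)))"

definition curve_length ::
    "('m, 'n::finite) chart set \<Rightarrow> ('m, 'n) metric_components \<Rightarrow> (real \<Rightarrow> 'm) \<Rightarrow> ennreal" where
  "curve_length A G \<gamma> = (\<integral>\<^sup>+t\<in>{0..1}. ennreal (speed A G \<gamma> t) \<partial>lborel)"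

text \<open>The infimum is finite when the manifold is connected.\<close>

definition riem_dist ::
    "('m::topological_space, 'n::finite) chart set \<Rightarrow> ('m, 'n) metric_components \<Rightarrow> 'm \<Rightarrow> 'm \<Rightarrow> real" where
  "riem_dist A G a b =
     enn2real (INF \<gamma>\<in>{\<gamma>. piecewise_C1_path A \<gamma> \<and> pathstart \<gamma> = a \<and> pathfinish \<gamma> = b}.
                 curve_length A G \<gamma>)"

definition geodesic_ball ::
    "('m::topological_space, 'n::finite) chart set \<Rightarrow> ('m, 'n) metric_components \<Rightarrow> 'm \<Rightarrow> real \<Rightarrow> 'm set" where
  "geodesic_ball A G a R = {q. riem_dist A G a q < R}"

definition riem_complete ::
    "('m::topological_space, 'n::finite) chart set \<Rightarrow> ('m, 'n) metric_components \<Rightarrow> bool" where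
  "riem_complete A G \<longleftrightarrow> Metric_space.mcomplete UNIV (riem_dist A G)"


subsection \<open>Weighted manifolds\<close>

text \<open>The Riemannian volume element is the Borel measure given by sqrt (det g) dx in every
  chart; this determines it, since countably many charts cover the manifold.\<close>

definition riemannian_volume ::
    "('m::topological_space, 'n::finite) chart set \<Rightarrow> ('m, 'n) metric_components \<Rightarrow> 'm measure \<Rightarrow> bool" where
  "riemannian_volume A G \<nu> \<longleftrightarrow> sets \<nu> = sets borel \<and>
     (\<forall>c\<in>A. \<forall>B\<in>sets borel. B \<subseteq> cdom c \<longrightarrow>
        emeasure \<nu> B = (\<integral>\<^sup>+x\<in>coord c ` B. ennreal (sqrt (det (G c x))) \<partial>lborel))"

definition weighted_riemannian_manifold ::
    "('m::{t2_space, second_countable_topology}, 'n::finite) chart set \<Rightarrow>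
     ('m, 'n) metric_components \<Rightarrow> ('m \<Rightarrow> real) \<Rightarrow> 'm measure \<Rightarrow> bool" where
  "weighted_riemannian_manifold A G f \<mu> \<longleftrightarrow>
     smooth_atlas A \<and> riemannian_metric A G \<and> Ck_fun A 2 f \<and>
     (\<exists>\<nu>. riemannian_volume A G \<nu> \<and> \<mu> = density \<nu> (\<lambda>q. ennreal (exp (- f q))))"


subsection \<open>Gradient, divergence and weighted Laplacian in a chart\<close>

definition partial :: "'n::finite \<Rightarrow> (real^'n \<Rightarrow> real) \<Rightarrow> real^'n \<Rightarrow> real" where
  "partial i h x = frechet_derivative h (at x) (axis i 1)"

definition grad ::
    "('m, 'n::finite) metric_components \<Rightarrow> ('m, 'n) chart \<Rightarrow> ('m \<Rightarrow> real) \<Rightarrow> real^'n \<Rightarrow> real^'n" where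
  "grad G c w x = matrix_inv (G c x) *v (\<chi> j. partial j (w \<circ> param c) x)"

definition divergence ::
    "('m, 'n::finite) metric_components \<Rightarrow> ('m, 'n) chart \<Rightarrow> (real^'n \<Rightarrow> real^'n) \<Rightarrow> real^'n \<Rightarrow> real" where
  "divergence G c X x =
     (\<Sum>i\<in>UNIV. partial i (\<lambda>y. sqrt (det (G c y)) * X y $ i) x) / sqrt (det (G c x))"

definition laplacian ::
    "('m, 'n::finite) metric_components \<Rightarrow> ('m, 'n) chart \<Rightarrow> ('m \<Rightarrow> real) \<Rightarrow> real^'n \<Rightarrow> real" where
  "laplacian G c w = divergence G c (grad G c w)"

definition weighted_laplacian ::
    "('m, 'n::finite) metric_components \<Rightarrow> ('m \<Rightarrow> real) \<Rightarrow> ('m, 'n) chart \<Rightarrow> ('m \<Rightarrow> real) \<Rightarrow> 'm \<Rightarrow> real" where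
  "weighted_laplacian G f c w q =
     (let x = coord c q
      in laplacian G c w x - grad G c f x \<bullet> (G c x *v grad G c w x))"

text \<open>For C^2 functions the value of the weighted Laplacian at a point is the same in all charts
  around it, so it does not matter that the equation is required in each of them.\<close>

definition solves_lane_emden ::
    "('m, 'n::finite) chart set \<Rightarrow> ('m, 'n) metric_components \<Rightarrow> ('m \<Rightarrow> real) \<Rightarrow> real \<Rightarrow> ('m \<Rightarrow> real) \<Rightarrow> bool" where
  "solves_lane_emden A G f p u \<longleftrightarrow>
     (\<forall>c\<in>A. \<forall>q\<in>cdom c. - weighted_laplacian G f c u q = u q powr p)"

end

theory Submission
  imports Defs
begin

text \<open>Let \<open>h\<close> be positive and decreasing. Testing the equation with \<open>h(u) \<phi>\<^sup>n\<close>, where \<open>\<phi>\<close> is a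
  Lipschitz cutoff of the distance that is 1 on the ball of radius \<open>R\<close> and 0 off the ball of radius
  \<open>2R\<close>, the term \<open>h'(u) |grad u|\<^sup>2 \<phi>\<^sup>n\<close> absorbs the gradient by Young's inequality and leaves
  \<open>\<integral> u\<^sup>p h(u) \<phi>\<^sup>n \<le> (n/2R)\<^sup>2 \<integral> h(u)\<^sup>2/(-h'(u)) \<phi>\<^sup>n\<^sup>-\<^sup>2\<close>. Take \<open>h(s) = 1 + (1 + s/\<sigma>) powr -\<tau>\<close> with
  \<open>1 + \<tau> < p\<close> and the scale-invariant choice \<open>\<sigma> = R powr -2/(p - 1)\<close>. Then \<open>1 \<le> h \<le> 2\<close>, the right-hand
  integrand grows like \<open>u powr (1 + \<tau>)\<close> and is absorbed by \<open>u\<^sup>p\<close>, and what remains is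
  \<open>\<integral> u\<^sup>p \<phi>\<^sup>n \<le> C R powr (-2p/(p - 1)) \<mu>(B(2R))\<close>, which tends to 0.

  The distance is only Lipschitz. The inequality is therefore proved in charts, where \<open>\<phi>\<close> may be
  mollified, and a \<open>C\<^sup>1\<close> partition of unity glues the pieces: the terms containing the gradients
  of its members cancel. The cutoff has compact support by the Hopf--Rinow theorem, which for
  length spaces needs no geodesics.\<close>


section \<open>Functions of class C^1 and determinants\<close>

abbreviation C1_on :: "'a::real_normed_vector set \<Rightarrow> ('a \<Rightarrow> real) \<Rightarrow> bool" where
  "C1_on \<equiv> Ck_on 1"

lemma C1_on_iff:
  "C1_on S F \<longleftrightarrow> (\<forall>x\<in>S. F differentiable (at x)) \<and>
     (\<forall>v. continuous_on S (\<lambda>x. frechet_derivative F (at x) v))"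
  by simp

lemma C1_onI:
  assumes "\<And>x. x \<in> S \<Longrightarrow> (F has_derivative F' x) (at x)"
    and "\<And>v. continuous_on S (\<lambda>x. F' x v)"
  shows "C1_on S F"
proof -
  have "frechet_derivative F (at x) = F' x" if "x \<in> S" for x
    using frechet_derivative_at[OF assms(1)[OF that]] by simp
  then show ?thesis
    using assms by (auto simp: C1_on_iff differentiable_def cong: continuous_on_cong)
qed

lemma C1_on_has_derivative:
  "C1_on S F \<Longrightarrow> x \<in> S \<Longrightarrow> (F has_derivative frechet_derivative F (at x)) (at x)"
  by (simp add: frechet_derivative_works[symmetric])

lemma C1_on_continuous_derivative:
  "C1_on S F \<Longrightarrow> continuous_on S (\<lambda>x. frechet_derivative F (at x) v)"
  by simp

lemma Ck_on_Suc_imp_continuous_on: "Ck_on (Suc k) S F \<Longrightarrow> continuous_on S F"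
  by (auto intro!: continuous_at_imp_continuous_on differentiable_imp_continuous_within)

lemma Ck_on_Suc_imp: "Ck_on (Suc k) S F \<Longrightarrow> Ck_on k S F"
proof (induction k arbitrary: F)
  case 0
  from Ck_on_Suc_imp_continuous_on[OF 0] show ?case by simp
next
  case (Suc k)
  then show ?case by (metis Ck_on.simps(2))
qed

lemma Ck_on_mono: "Ck_on m S F \<Longrightarrow> k \<le> m \<Longrightarrow> Ck_on k S F"
  by (induction m) (auto simp: le_Suc_eq intro: Ck_on_Suc_imp simp del: Ck_on.simps)

lemma C1_on_imp_continuous_on: "C1_on S F \<Longrightarrow> continuous_on S F"
  unfolding One_nat_def by (rule Ck_on_Suc_imp_continuous_on)

lemma C1_on_bounded_linear:
  assumes L: "bounded_linear L" and F: "Ck_on 1 S F"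
  shows "C1_on S (\<lambda>x. L (F x))"
proof (rule C1_onI)
  show "((\<lambda>x. L (F x)) has_derivative (\<lambda>v. L (frechet_derivative F (at x) v))) (at x)" if "x \<in> S" for x
    using F that
    by (intro bounded_linear.has_derivative[OF L]) (simp add: frechet_derivative_works[symmetric])
  show "continuous_on S (\<lambda>x. L (frechet_derivative F (at x) v))" for v
    using F by (auto intro: bounded_linear.continuous_on[OF L])
qed

lemma C1_on_const: "C1_on S (\<lambda>x. c)"
  by (rule C1_onI[where F' = "\<lambda>_ _. 0"]) auto

lemma C1_on_add:
  assumes "C1_on S F" "C1_on S H" shows "C1_on S (\<lambda>x. F x + H x)"
  by (rule C1_onI[where F' = "\<lambda>x v. frechet_derivative F (at x) v + frechet_derivative H (at x) v"])
    (use assms in \<open>auto intro!: has_derivative_add C1_on_has_derivative continuous_intros\<close>)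

lemma C1_on_mult:
  assumes "C1_on S F" "C1_on S H" shows "C1_on S (\<lambda>x. F x * H x)"
  by (rule C1_onI[where F' = "\<lambda>x v. F x * frechet_derivative H (at x) v + frechet_derivative F (at x) v * H x"])
    (use assms C1_on_imp_continuous_on[OF assms(1)] C1_on_imp_continuous_on[OF assms(2)] in
      \<open>auto intro!: has_derivative_mult C1_on_has_derivative continuous_intros\<close>)

lemma C1_on_sum:
  assumes "finite I" "\<And>i. i \<in> I \<Longrightarrow> C1_on S (F i)" shows "C1_on S (\<lambda>x. \<Sum>i\<in>I. F i x)"
  using assms by (induction I rule: finite_induct) (simp_all add: C1_on_const C1_on_add del: One_nat_def Ck_on.simps)

lemma C1_on_prod:
  assumes "finite I" "\<And>i. i \<in> I \<Longrightarrow> C1_on S (F i)" shows "C1_on S (\<lambda>x. \<Prod>i\<in>I. F i x)"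
  using assms by (induction I rule: finite_induct) (simp_all add: C1_on_const C1_on_mult del: One_nat_def Ck_on.simps)

lemma C1_on_compose_real:
  assumes F: "C1_on S F" and g: "\<And>s. s \<in> F ` S \<Longrightarrow> (g has_real_derivative g' s) (at s)"
    and g': "continuous_on (F ` S) g'"
  shows "C1_on S (\<lambda>x. g (F x))"
proof (rule C1_onI)
  show "((\<lambda>x. g (F x)) has_derivative (\<lambda>v. g' (F x) * frechet_derivative F (at x) v)) (at x)" if "x \<in> S" for x
    using has_derivative_compose[OF C1_on_has_derivative[OF F that], of g "(*) (g' (F x))"] g that
    by (auto simp: has_field_derivative_def)
  show "continuous_on S (\<lambda>x. g' (F x) * frechet_derivative F (at x) v)" for v
    using C1_on_imp_continuous_on[OF F] F
    by (auto intro!: continuous_intros continuous_on_compose2[OF g'])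
qed

lemma C1_on_divide:
  assumes F: "C1_on S F" and H: "C1_on S H" and 0: "\<And>x. x \<in> S \<Longrightarrow> H x \<noteq> 0"
  shows "C1_on S (\<lambda>x. F x / H x)"
proof -
  have "C1_on S (\<lambda>x. inverse (H x))"
    by (rule C1_on_compose_real[OF H, where g' = "\<lambda>s. - (inverse s ^ Suc (Suc 0))"])
      (use 0 DERIV_inverse in \<open>auto intro!: continuous_intros\<close>)
  from C1_on_mult[OF F this] show ?thesis by (simp add: divide_inverse del: Ck_on.simps One_nat_def)
qed

lemma C1_on_cong:
  assumes S: "open S" and F: "C1_on S F" and eq: "\<And>x. x \<in> S \<Longrightarrow> F x = H x"
  shows "C1_on S H"
proof (rule C1_onI)
  show "(H has_derivative frechet_derivative F (at x)) (at x)" if "x \<in> S" for x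
    by (rule has_derivative_transform_within_open[OF C1_on_has_derivative[OF F that] S that eq])
  show "continuous_on S (\<lambda>x. frechet_derivative F (at x) v)" for v
    using F by simp
qed

lemma C1_on_det:
  fixes a :: "'n::finite \<Rightarrow> 'n \<Rightarrow> 'a::real_normed_vector \<Rightarrow> real"
  assumes "\<And>i j. C1_on S (a i j)"
  shows "C1_on S (\<lambda>x. det (\<chi> i j. a i j x))"
  unfolding det_def vec_lambda_beta
  by (intro C1_on_sum C1_on_mult C1_on_prod C1_on_const assms finite_permutations) auto

lemma C1_on_entry:
  fixes g :: "'a::real_normed_vector \<Rightarrow> real^'n::finite^'m::finite"
  assumes "Ck_on 1 S g" shows "C1_on S (\<lambda>x. g x $ i $ j)"
  using C1_on_bounded_linear[OF _ assms, of "\<lambda>A. A $ i $ j"]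
    bounded_linear_compose[OF bounded_linear_vec_nth bounded_linear_vec_nth] by blast

lemma C1_on_det_matrix:
  fixes g :: "'a::real_normed_vector \<Rightarrow> real^'n::finite^'n"
  assumes "Ck_on 1 S g" shows "C1_on S (\<lambda>x. det (g x))"
  using C1_on_det[of S "\<lambda>i j x. g x $ i $ j"] C1_on_entry[OF assms] by (simp del: Ck_on.simps One_nat_def)

lemma matrix_mult_matrix_inv:
  fixes M :: "real^'n^'n"
  assumes "invertible M" shows "M ** matrix_inv M = mat 1"
  using assms unfolding invertible_def matrix_inv_def by (rule someI_ex[THEN conjunct1])

lemma matrix_inv_mult_vec_cramer:
  fixes M :: "real^'n::finite^'n"
  assumes "invertible M"
  shows "(matrix_inv M *v b) $ k = det (\<chi> i j. if j = k then b $ i else M $ i $ j) / det M"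
proof -
  have d: "det M \<noteq> 0" using assms invertible_det_nz by blast
  have "M *v (matrix_inv M *v b) = b"
    using matrix_mult_matrix_inv[OF assms] by (simp add: matrix_vector_mul_assoc)
  then have "matrix_inv M *v b = (\<chi> k. det (\<chi> i j. if j = k then b $ i else M $ i $ j) / det M)"
    using cramer[OF d] by blast
  then show ?thesis by simp
qed

lemma C1_on_matrix_inv_mult_vec:
  fixes g :: "'a::real_normed_vector \<Rightarrow> real^'n::finite^'n"
  assumes S: "open S" and g: "Ck_on 1 S g" and b: "\<And>i. C1_on S (\<lambda>x. b x $ i)"
    and inv: "\<And>x. x \<in> S \<Longrightarrow> invertible (g x)"
  shows "C1_on S (\<lambda>x. (matrix_inv (g x) *v b x) $ k)"
proof (rule C1_on_cong[OF S])
  show "C1_on S (\<lambda>x. det (\<chi> i j. if j = k then b x $ i else g x $ i $ j) / det (g x))"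
  proof (rule C1_on_divide[OF C1_on_det C1_on_det_matrix[OF g]])
    show "C1_on S (\<lambda>x. if j = k then b x $ i else g x $ i $ j)" for i j
      using b C1_on_entry[OF g] by (cases "j = k") (simp_all del: Ck_on.simps One_nat_def)
    show "det (g x) \<noteq> 0" if "x \<in> S" for x using inv[OF that] invertible_det_nz by blast
  qed
  show "det (\<chi> i j. if j = k then b x $ i else g x $ i $ j) / det (g x) = (matrix_inv (g x) *v b x) $ k"
    if "x \<in> S" for x using matrix_inv_mult_vec_cramer[OF inv[OF that]] by simp
qed

lemma invertible_of_pos_def:
  fixes M :: "real^'n::finite^'n"
  assumes "\<And>v. v \<noteq> 0 \<Longrightarrow> v \<bullet> (M *v v) > 0"
  shows "invertible M"
proof -
  have "v = 0" if "M *v v = 0" for v using assms[of v] that by fastforce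
  then show ?thesis
    unfolding invertible_left_inverse matrix_left_invertible_ker by blast
qed

lemma det_pos_of_pos_def:
  fixes M :: "real^'n::finite^'n"
  assumes M: "\<And>v. v \<noteq> 0 \<Longrightarrow> v \<bullet> (M *v v) > 0"
  shows "det M > 0"
proof (rule ccontr)
  assume "\<not> det M > 0"
  define P where "P = (\<lambda>t::real. (1 - t) *\<^sub>R mat 1 + t *\<^sub>R M)"
  have pd: "v \<bullet> (P t *v v) > 0" if "v \<noteq> 0" "0 \<le> t" "t \<le> 1" for v t
  proof -
    have "v \<bullet> (P t *v v) = (1 - t) * (v \<bullet> v) + t * (v \<bullet> (M *v v))"
      by (simp add: P_def matrix_vector_mult_add_rdistrib scaleR_matrix_vector_assoc[symmetric] inner_add_right)
    moreover have "v \<bullet> v > 0" "v \<bullet> (M *v v) > 0" using that M by auto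
    ultimately show ?thesis using that(2,3)
      by (cases "t = 0") (auto intro!: add_nonneg_pos mult_nonneg_nonneg simp: less_imp_le)
  qed
  have "continuous_on {0..1} (\<lambda>t. det (P t))"
    unfolding det_def P_def by (intro continuous_intros)
  then have "\<exists>t. 0 \<le> t \<and> t \<le> 1 \<and> det (P t) = 0"
    using \<open>\<not> det M > 0\<close> by (intro IVT2') (auto simp: P_def det_I)
  then obtain t where t: "0 \<le> t" "t \<le> 1" "det (P t) = 0" by blast
  then have "invertible (P t)" using pd by (intro invertible_of_pos_def) auto
  then show False using t invertible_det_nz by blast
qed

section \<open>Integration by parts against non-smooth functions\<close>

lemma derivative_abs_le:
  fixes g :: "real \<Rightarrow> real"
  assumes g: "(g has_real_derivative l) (at 0)" and "d > 0"
    and le: "\<And>t. 0 < t \<Longrightarrow> t < d \<Longrightarrow> \<bar>g t - g 0\<bar> \<le> t * B"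
  shows "\<bar>l\<bar> \<le> B"
proof -
  have "((\<lambda>t. (g t - g 0) / t) \<longlongrightarrow> l) (at_right 0)"
    using g unfolding has_field_derivative_iff by (auto intro: tendsto_mono at_le)
  then have "((\<lambda>t. \<bar>(g t - g 0) / t\<bar>) \<longlongrightarrow> \<bar>l\<bar>) (at_right 0)"
    by (rule tendsto_rabs)
  moreover have "eventually (\<lambda>t. \<bar>(g t - g 0) / t\<bar> \<le> B) (at_right (0::real))"
    using \<open>d > 0\<close> by (auto simp: eventually_at_right_field abs_divide field_simps intro!: exI[of _ d] le)
  ultimately show ?thesis
    by (rule tendsto_upperbound) simp
qed

lemma has_real_derivative_max_0_square:
  "((\<lambda>s::real. (max 0 s)\<^sup>2) has_real_derivative 2 * max 0 s) (at s)"
proof -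
  consider "s < 0" | "s = 0" | "s > 0" by linarith
  then show ?thesis
  proof cases
    case 1
    have "((\<lambda>s::real. 0) has_real_derivative 0) (at s)" by simp
    then have "((\<lambda>s::real. (max 0 s)\<^sup>2) has_real_derivative 0) (at s)"
      by (rule has_field_derivative_transform_within_open[of _ _ _ "{..<0}"]) (use 1 in auto)
    then show ?thesis using 1 by simp
  next
    case 2
    have "((\<lambda>h::real. (max 0 h)\<^sup>2 / h) \<longlongrightarrow> 0) (at 0)"
    proof (rule tendsto_rabs_zero_cancel, rule tendsto_sandwich)
      show "\<forall>\<^sub>F h in at 0. (0::real) \<le> \<bar>(max 0 h)\<^sup>2 / h\<bar>" by simp
      show "\<forall>\<^sub>F h in at 0. \<bar>(max 0 h)\<^sup>2 / h\<bar> \<le> \<bar>h::real\<bar>"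
        by (auto simp: max_def power2_eq_square)
      show "((\<lambda>h::real. \<bar>h\<bar>) \<longlongrightarrow> 0) (at 0)" by (intro tendsto_eq_intros) auto
    qed simp
    then show ?thesis using 2 by (simp add: has_field_derivative_iff)
  next
    case 3
    have "((\<lambda>s::real. s\<^sup>2) has_real_derivative 2 * s) (at s)"
      by (auto intro!: derivative_eq_intros)
    then have "((\<lambda>s::real. (max 0 s)\<^sup>2) has_real_derivative 2 * s) (at s)"
      by (rule has_field_derivative_transform_within_open[of _ _ _ "{0<..}"]) (use 3 in auto)
    then show ?thesis using 3 by simp
  qed
qed

lemma lborel_integral_eq_cbox:
  fixes g :: "'a::euclidean_space \<Rightarrow> real"
  assumes "continuous_on UNIV g" "\<And>x. x \<notin> cbox a b \<Longrightarrow> g x = 0"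
  shows "integrable lborel g" "(\<integral>x. g x \<partial>lborel) = integral (cbox a b) g"
proof -
  have c: "continuous_on (cbox a b) g" by (rule continuous_on_subset[OF assms(1)]) simp
  have eq: "(\<lambda>x. indicator (cbox a b) x *\<^sub>R g x) = g"
  proof
    show "indicator (cbox a b) x *\<^sub>R g x = g x" for x
      using assms(2)[of x] by (cases "x \<in> cbox a b") auto
  qed
  have i: "set_integrable lborel (cbox a b) g"
    unfolding set_integrable_def by (rule borel_integrable_compact[OF compact_cbox c])
  then show "integrable lborel g" unfolding set_integrable_def eq .
  show "(\<integral>x. g x \<partial>lborel) = integral (cbox a b) g"
    using set_borel_integral_eq_integral(2)[OF i] unfolding set_lebesgue_integral_def eq .
qed

lemma lborel_integral_translate:
  fixes g :: "'a::euclidean_space \<Rightarrow> real"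
  assumes [measurable]: "g \<in> borel_measurable borel"
  shows "(\<integral>x. g (c + x) \<partial>lborel) = (\<integral>x. g x \<partial>lborel)"
proof -
  have "(\<integral>x. g (c + x) \<partial>lborel) = (\<integral>x. g x \<partial>distr lborel borel ((+) c))"
    by (rule integral_distr[symmetric]) auto
  then show ?thesis by (simp add: lborel_distr_plus)
qed

lemma bounded_norm_lessE:
  fixes K :: "'a::euclidean_space set"
  assumes "bounded K"
  obtains r where "r > 0" "\<And>x. x \<in> K \<Longrightarrow> norm x < r"
  using assms bounded_pos_less by (metis)

lemma mem_cbox_of_norm_le:
  fixes x :: "'a::euclidean_space"
  assumes "norm x \<le> r" shows "x \<in> cbox (- r *\<^sub>R One) (r *\<^sub>R One)"
  using assms Basis_le_norm[of _ x] by (fastforce simp: mem_box abs_le_iff)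

lemma integrable_continuous_vanishing:
  fixes g :: "'a::euclidean_space \<Rightarrow> real"
  assumes "continuous_on UNIV g" "\<And>x. norm x > r \<Longrightarrow> g x = 0"
  shows "integrable lborel g"
  using assms(1)
proof (rule lborel_integral_eq_cbox(1))
  show "g x = 0" if "x \<notin> cbox (- r *\<^sub>R One) (r *\<^sub>R One)" for x
    using that assms(2)[of x] mem_cbox_of_norm_le[of x r] by force
qed

lemma integral_directional_derivative_eq_0:
  fixes F :: "'a::euclidean_space \<Rightarrow> real"
  assumes F: "\<And>x. ((\<lambda>t. F (x + t *\<^sub>R v)) has_real_derivative F' x) (at 0)"
    and cF: "continuous_on UNIV F" and cF': "continuous_on UNIV F'"
    and K: "compact K" and 0: "\<And>x. x \<notin> K \<Longrightarrow> F x = 0" "\<And>x. x \<notin> K \<Longrightarrow> F' x = 0"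
  shows "(\<integral>x. F' x \<partial>lborel) = 0"
proof -
  obtain r where r: "r > 0" "\<And>x. x \<in> K \<Longrightarrow> norm x < r"
    using bounded_norm_lessE[OF compact_imp_bounded[OF K]] by blast
  define B where "B = cbox (- (r + norm v) *\<^sub>R One) ((r + norm v) *\<^sub>R (One::'a))"
  have out: "x + t *\<^sub>R v \<notin> K" if "x \<notin> B" "\<bar>t\<bar> \<le> 1" for x t
  proof
    assume "x + t *\<^sub>R v \<in> K"
    then have "norm (x + t *\<^sub>R v) < r" by (rule r)
    moreover have "norm x \<le> norm (x + t *\<^sub>R v) + norm (t *\<^sub>R v)"
      by (metis norm_triangle_sub add.commute add_diff_cancel_left' norm_minus_commute)
    moreover have "norm (t *\<^sub>R v) \<le> norm v" using that(2) by (simp add: mult_left_le_one_le)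
    ultimately have "norm x \<le> r + norm v" by linarith
    then show False using that(1) mem_cbox_of_norm_le unfolding B_def by blast
  qed
  have D: "((\<lambda>t. F (x + t *\<^sub>R v)) has_real_derivative F' (x + t *\<^sub>R v)) (at t)" for x t
  proof -
    have "((\<lambda>s. F ((x + t *\<^sub>R v) + s *\<^sub>R v)) has_real_derivative F' (x + t *\<^sub>R v)) (at 0)"
      by (rule F)
    then have "((\<lambda>s. F (x + (s + t) *\<^sub>R v)) has_real_derivative F' (x + t *\<^sub>R v)) (at 0)"
      by (simp add: algebra_simps)
    then show ?thesis
      using DERIV_shift[of "\<lambda>t. F (x + t *\<^sub>R v)" "F' (x + t *\<^sub>R v)" 0 t] by simp
  qed
  have ct: "continuous_on T (\<lambda>x. F (x + t *\<^sub>R v))" for T t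
    by (rule continuous_on_compose2[OF cF]) (auto intro!: continuous_intros)
  have *: "((\<lambda>t. integral B (\<lambda>x. F (x + t *\<^sub>R v))) has_real_derivative
      integral B (\<lambda>x. F' (x + 0 *\<^sub>R v))) (at 0 within {-1<..<1})"
    unfolding B_def
  proof (rule leibniz_rule_field_derivative)
    show "((\<lambda>t. F (x + t *\<^sub>R v)) has_real_derivative F' (x + t *\<^sub>R v)) (at t within {-1<..<1})"
      for t x by (rule has_field_derivative_at_within[OF D])
    show "(\<lambda>x. F (x + t *\<^sub>R v)) integrable_on cbox (- (r + norm v) *\<^sub>R One) ((r + norm v) *\<^sub>R One)" for t
      by (rule integrable_continuous[OF ct])
    show "continuous_on ({-1<..<1} \<times> cbox (- (r + norm v) *\<^sub>R One) ((r + norm v) *\<^sub>R One))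
        (\<lambda>(t, x). F' (x + t *\<^sub>R v))"
      by (auto simp: split_beta intro!: continuous_on_compose2[OF cF'] continuous_intros)
  qed auto
  have c: "integral B (\<lambda>x. F (x + t *\<^sub>R v)) = (\<integral>x. F x \<partial>lborel)" if "t \<in> {-1<..<1}" for t
  proof -
    have "integral B (\<lambda>x. F (x + t *\<^sub>R v)) = (\<integral>x. F (x + t *\<^sub>R v) \<partial>lborel)"
      unfolding B_def
    proof (rule lborel_integral_eq_cbox(2)[symmetric, OF ct])
      show "F (x + t *\<^sub>R v) = 0"
        if "x \<notin> cbox (- (r + norm v) *\<^sub>R One) ((r + norm v) *\<^sub>R One)" for x
        using that \<open>t \<in> _\<close> by (intro 0 out) (auto simp: B_def)
    qed
    also have "\<dots> = (\<integral>x. F (t *\<^sub>R v + x) \<partial>lborel)" by (simp add: add.commute)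
    also have "\<dots> = (\<integral>x. F x \<partial>lborel)"
      by (rule lborel_integral_translate) (use cF in \<open>simp add: borel_measurable_continuous_onI\<close>)
    finally show ?thesis .
  qed
  have "((\<lambda>t::real. (\<integral>x. F x \<partial>lborel)) has_real_derivative integral B (\<lambda>x. F' (x + 0 *\<^sub>R v))) (at 0)"
  proof (rule has_field_derivative_transform_within_open[of _ _ _ "{-1<..<1}"])
    show "((\<lambda>t. integral B (\<lambda>x. F (x + t *\<^sub>R v))) has_real_derivative
        integral B (\<lambda>x. F' (x + 0 *\<^sub>R v))) (at 0)"
      using * by (simp add: at_within_open[of 0 "{-1<..<1::real}"])
  qed (use c in auto)
  then have "integral B (\<lambda>x. F' x) = 0" using DERIV_unique[OF _ DERIV_const] by auto
  moreover have "(\<integral>x. F' x \<partial>lborel) = integral B F'"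
    unfolding B_def
    by (rule lborel_integral_eq_cbox(2)[OF cF']) (use out[of _ 0] in \<open>auto intro!: 0 simp: B_def\<close>)
  ultimately show ?thesis by simp
qed

lemma C1_mollifier_ex:
  fixes e :: real assumes "e > 0"
  obtains k :: "'a::euclidean_space \<Rightarrow> real" and k' where
    "\<And>z. (k has_derivative k' z) (at z)"
    "continuous_on UNIV (\<lambda>(z, w). k' z w)"
    "\<And>z. k z \<ge> 0" "\<And>z. norm z \<ge> e \<Longrightarrow> k z = 0" "(\<integral>z. k z \<partial>lborel) = 1"
proof -
  define B where "B = (\<lambda>z::'a. (max 0 (e\<^sup>2 - z \<bullet> z))\<^sup>2)"
  define B' where "B' = (\<lambda>z w::'a. (2 * max 0 (e\<^sup>2 - z \<bullet> z)) * (- (2 * (z \<bullet> w))))"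
  have B: "(B has_derivative B' z) (at z)" for z
  proof -
    have 1: "((\<lambda>z. e\<^sup>2 - z \<bullet> z) has_derivative (\<lambda>w. - (2 * (z \<bullet> w)))) (at z)"
      by (auto intro!: derivative_eq_intros simp: inner_commute)
    have 2: "((\<lambda>s::real. (max 0 s)\<^sup>2) has_derivative (\<lambda>x. (2 * max 0 (e\<^sup>2 - z \<bullet> z)) * x)) (at (e\<^sup>2 - z \<bullet> z))"
      using has_real_derivative_max_0_square unfolding has_field_derivative_def .
    show ?thesis
      unfolding B_def B'_def using has_derivative_compose[OF 1 2] by simp
  qed
  have cB: "continuous_on UNIV B" unfolding B_def by (intro continuous_intros)
  have zB: "B z = 0" if "norm z \<ge> e" for z
  proof -
    have "e\<^sup>2 \<le> (norm z)\<^sup>2" using that assms by (intro power_mono) auto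
    then show ?thesis by (simp add: B_def power2_norm_eq_inner)
  qed
  define I where "I = (\<integral>z. B z \<partial>lborel)"
  have iB: "integrable lborel B"
    by (rule integrable_continuous_vanishing[OF cB, of e]) (use zB in auto)
  have "I > 0"
  proof -
    let ?c = "(e\<^sup>2 - (e/2)\<^sup>2)\<^sup>2"
    have "0 < ?c * measure lborel (ball (0::'a) (e/2))"
    proof (intro mult_pos_pos)
      have "(e/2)\<^sup>2 < e\<^sup>2" using assms by (simp add: power2_eq_square)
      then show "0 < ?c" by simp
      show "0 < measure lborel (ball (0::'a) (e/2))" using content_ball_pos[of "e/2"] assms by simp
    qed
    also have "\<dots> = (\<integral>z. ?c * indicator (ball (0::'a) (e/2)) z \<partial>lborel)" by simp
    also have "\<dots> \<le> I" unfolding I_def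
    proof (rule integral_mono)
      show "integrable lborel (\<lambda>z. ?c * indicator (ball (0::'a) (e/2)) z)"
        by (intro integrable_mult_right integrable_real_indicator) (use emeasure_lborel_ball_finite[of 0 "e/2"] in auto)
      show "?c * indicator (ball (0::'a) (e/2)) z \<le> B z" for z
      proof (cases "norm z < e/2")
        case True
        then have "(norm z)\<^sup>2 \<le> (e/2)\<^sup>2" by (intro power_mono) auto
        moreover have "(e/2)\<^sup>2 < e\<^sup>2" using assms by (simp add: power2_eq_square)
        ultimately have "?c \<le> B z" unfolding B_def
          by (intro power_mono) (auto simp: power2_norm_eq_inner)
        then show ?thesis using True by simp
      qed (auto simp: B_def indicator_def)
    qed (rule iB)
    finally show ?thesis .
  qed
  show thesis
  proof (rule that[of "\<lambda>z. B z / I" "\<lambda>z w. B' z w / I"])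
    show "((\<lambda>z. B z / I) has_derivative (\<lambda>w. B' z w / I)) (at z)" for z
      using \<open>I > 0\<close> by (auto intro!: derivative_eq_intros B)
    show "continuous_on UNIV (\<lambda>(z, w). B' z w / I)"
      unfolding B'_def split_beta using \<open>I > 0\<close> by (intro continuous_intros) auto
    show "0 \<le> B z / I" for z using \<open>I > 0\<close> by (simp add: B_def)
    show "B z / I = 0" if "norm z \<ge> e" for z using zB[OF that] by simp
    show "(\<integral>z. B z / I \<partial>lborel) = 1" using \<open>I > 0\<close> by (simp add: I_def)
  qed
qed

lemma mollification_derivative:
  fixes g k :: "'a::euclidean_space \<Rightarrow> real"
  assumes g: "continuous_on UNIV g" and k: "\<And>z. (k has_derivative k' z) (at z)"
    and k': "continuous_on UNIV (\<lambda>(z, w). k' z w)"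
  shows "((\<lambda>t. integral (cbox a b) (\<lambda>y. g y * k (y - (x + t *\<^sub>R w)))) has_real_derivative
          integral (cbox a b) (\<lambda>y. g y * k' (y - x) (- w))) (at 0)" (is ?A)
    and "continuous_on UNIV (\<lambda>x. integral (cbox a b) (\<lambda>y. g y * k (y - x)))" (is ?B)
    and "continuous_on UNIV (\<lambda>x. integral (cbox a b) (\<lambda>y. g y * k' (y - x) w))" (is ?C)
proof -
  have ck: "continuous_on UNIV k"
    using k by (auto intro!: continuous_at_imp_continuous_on has_derivative_continuous)
  note ci = continuous_on_compose2[OF g] continuous_on_compose2[OF ck]
    continuous_on_compose2[OF k', unfolded split_beta, of _ "\<lambda>x. (u x, v x)" for u v, simplified]
  have D: "((\<lambda>t. g y * k (y - (x + t *\<^sub>R w))) has_real_derivative g y * k' (y - (x + t *\<^sub>R w)) (- w)) (at t)" for y t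
  proof -
    have lin: "linear (k' z)" for z using k has_derivative_linear by blast
    have "((\<lambda>t. y - (x + t *\<^sub>R w)) has_derivative (\<lambda>s. s *\<^sub>R (- w))) (at t)"
      by (auto intro!: derivative_eq_intros)
    from has_derivative_compose[OF this k]
    have "((\<lambda>t. k (y - (x + t *\<^sub>R w))) has_derivative (\<lambda>s. k' (y - (x + t *\<^sub>R w)) (s *\<^sub>R (- w)))) (at t)" .
    then have "((\<lambda>t. k (y - (x + t *\<^sub>R w))) has_real_derivative k' (y - (x + t *\<^sub>R w)) (- w)) (at t)"
      unfolding has_field_derivative_def
      by (rule has_derivative_eq_rhs)
        (auto simp: linear_scale[OF lin] fun_eq_iff simp del: scaleR_minus_right)
    then show ?thesis by (rule DERIV_cmult)
  qed
  have "((\<lambda>t. integral (cbox a b) (\<lambda>y. g y * k (y - (x + t *\<^sub>R w)))) has_real_derivative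
      integral (cbox a b) (\<lambda>y. g y * k' (y - (x + 0 *\<^sub>R w)) (- w))) (at 0 within UNIV)"
  proof (rule leibniz_rule_field_derivative)
    show "((\<lambda>t. g y * k (y - (x + t *\<^sub>R w))) has_real_derivative g y * k' (y - (x + t *\<^sub>R w)) (- w)) (at t)" for t y
      by (rule D)
    show "(\<lambda>y. g y * k (y - (x + t *\<^sub>R w))) integrable_on cbox a b" for t
      by (intro integrable_continuous continuous_intros ci) auto
    show "continuous_on (UNIV \<times> cbox a b) (\<lambda>(t, y). g y * k' (y - (x + t *\<^sub>R w)) (- w))"
      unfolding split_beta by (intro continuous_intros ci) auto
  qed auto
  then show ?A by simp
  show ?B
    by (rule integral_continuous_on_param) (unfold split_beta, intro continuous_intros ci, auto)
  show ?C
    by (rule integral_continuous_on_param) (unfold split_beta, intro continuous_intros ci, auto)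
qed

lemma integrable_indicator_mult_continuous:
  fixes g h :: "'a::euclidean_space \<Rightarrow> real"
  assumes "compact K" "continuous_on K g"
  shows "integrable lborel (\<lambda>x. indicator K x * g x)"
  using borel_integrable_compact[OF assms] by (simp add: set_integrable_def)

lemma compact_neighbourhood:
  fixes K U :: "'a::euclidean_space set"
  assumes K: "compact K" "open U" "K \<subseteq> U"
  obtains \<epsilon> K' where "\<epsilon> > 0" "compact K'" "K' \<subseteq> U" "\<And>x y. x \<in> K \<Longrightarrow> dist x y \<le> \<epsilon> \<Longrightarrow> y \<in> K'"
proof -
  obtain \<epsilon> where \<epsilon>: "\<epsilon> > 0" "(\<Union>x\<in>K. cball x \<epsilon>) \<subseteq> U"
    using compact_subset_open_imp_cball_epsilon_subset[OF K] by blast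
  define K' where "K' = {x + y |x y. x \<in> K \<and> y \<in> cball 0 \<epsilon>}"
  show thesis
  proof (rule that[OF \<epsilon>(1)])
    show "compact K'" unfolding K'_def by (rule compact_sums[OF K(1) compact_cball])
    show "y \<in> K'" if "x \<in> K" "dist x y \<le> \<epsilon>" for x y
      unfolding K'_def using that
      by (intro CollectI exI[of _ x] exI[of _ "y - x"]) (simp add: dist_norm norm_minus_commute)
    show "K' \<subseteq> U"
    proof
      fix z assume "z \<in> K'"
      then obtain x y where "z = x + y" "x \<in> K" "norm y \<le> \<epsilon>" by (auto simp: K'_def)
      then have "z \<in> cball x \<epsilon>" by (simp add: dist_norm)
      then show "z \<in> U" using \<epsilon>(2) \<open>x \<in> K\<close> by blast
    qed
  qed
qed

text \<open>The Lipschitz-type function \<open>\<psi>\<close> need not be differentiable: its difference quotients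
  along \<open>Y\<close> pass to a mollification, for which integration by parts is available.\<close>

lemma abs_integral_mult_divergence_le:
  fixes \<psi> b :: "'a::euclidean_space \<Rightarrow> real" and Y :: "'a \<Rightarrow> 'a"
  assumes K: "compact K" "open U" "K \<subseteq> U" and \<psi>: "continuous_on U \<psi>"
    and D: "\<And>i x. i \<in> Basis \<Longrightarrow> ((\<lambda>t. Y (x + t *\<^sub>R i) \<bullet> i) has_real_derivative D i x) (at 0)"
    and cD: "\<And>i. i \<in> Basis \<Longrightarrow> continuous_on UNIV (D i)"
    and cY: "continuous_on UNIV Y" and Y0: "\<And>x. x \<notin> K \<Longrightarrow> Y x = 0"
    and b: "continuous_on K b"
    and lip: "\<And>e. e > 0 \<Longrightarrow> \<exists>d>0. \<forall>x\<in>K. \<forall>y\<in>ball x d. \<forall>t\<in>{0<..<d}. \<bar>\<psi> (y + t *\<^sub>R Y x) - \<psi> y\<bar> \<le> t * (b x + e)"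
  shows "\<bar>\<integral>x. indicator K x * (\<psi> x * (\<Sum>i\<in>Basis. D i x)) \<partial>lborel\<bar> \<le> (\<integral>x. indicator K x * b x \<partial>lborel)"
proof -
  obtain r where r: "r > 0" "\<And>x. x \<in> K \<Longrightarrow> norm x < r"
    using bounded_norm_lessE[OF compact_imp_bounded[OF K(1)]] by blast
  define B where "B = cbox (- (r + 3) *\<^sub>R One) ((r + 3) *\<^sub>R (One::'a))"
  obtain d0 K' where d0: "d0 > 0" and K': "compact K'" and K'U: "K' \<subseteq> U"
    and K'I: "\<And>x y. x \<in> K \<Longrightarrow> dist x y \<le> d0 \<Longrightarrow> y \<in> K'"
    by (rule compact_neighbourhood[OF K]) (rule that)
  have c\<psi>: "continuous_on K' \<psi>" using \<psi> K'U continuous_on_subset by blast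
  obtain g where g: "continuous_on UNIV g" "\<And>x. x \<in> K' \<Longrightarrow> g x = \<psi> x"
    using Tietze_unbounded[OF c\<psi>, of UNIV] compact_imp_closed[OF K'] by auto
  define S where "S = (\<lambda>x. \<Sum>i\<in>Basis. D i x)"
  have cS: "continuous_on T S" for T
    unfolding S_def by (rule continuous_on_subset[OF continuous_on_sum]) (use cD in auto)
  have cYK: "compact (Y ` K)" by (rule compact_continuous_image[OF continuous_on_subset[OF cY] K(1)]) auto
  obtain M where M: "M > 0" "\<And>x. x \<in> K \<Longrightarrow> norm (Y x) < M"
    using bounded_norm_lessE[OF compact_imp_bounded[OF cYK]] by (metis imageI)
  have D0: "D i x = 0" if "i \<in> Basis" "x \<notin> K" for i x
  proof -
    have o: "open ((\<lambda>t. x + t *\<^sub>R i) -` (- K))"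
      by (rule open_vimage) (use K(1) in \<open>auto intro!: continuous_intros compact_imp_closed\<close>)
    have "((\<lambda>t::real. 0::real) has_real_derivative D i x) (at 0)"
      by (rule has_field_derivative_transform_within_open[OF D[OF that(1)] o]) (use that Y0 in auto)
    then show ?thesis using DERIV_unique[OF _ DERIV_const[of 0 "at 0"]] by blast
  qed
  have main: "\<bar>\<integral>x. indicator K x * (\<psi> x * S x) \<partial>lborel\<bar> \<le> (\<integral>x. indicator K x * b x \<partial>lborel)
     + e * ((\<integral>x. indicator K x * \<bar>S x\<bar> \<partial>lborel) + (\<integral>x. indicator K x * 1 \<partial>lborel))" if "e > 0" for e
  proof -
    obtain d1 where d1: "d1 > 0"
      "\<And>x y t. x \<in> K \<Longrightarrow> y \<in> ball x d1 \<Longrightarrow> 0 < t \<Longrightarrow> t < d1 \<Longrightarrow> \<bar>\<psi> (y + t *\<^sub>R Y x) - \<psi> y\<bar> \<le> t * (b x + e)"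
      using lip[OF \<open>e > 0\<close>] by (metis greaterThanLessThan_iff)
    have "uniformly_continuous_on K' \<psi>" by (rule compact_uniformly_continuous[OF c\<psi> K'])
    then obtain d2 where d2: "d2 > 0"
      "\<And>x y. x \<in> K' \<Longrightarrow> y \<in> K' \<Longrightarrow> dist y x < d2 \<Longrightarrow> dist (\<psi> y) (\<psi> x) < e"
      unfolding uniformly_continuous_on_def using \<open>e > 0\<close> by metis
    define \<epsilon> where "\<epsilon> = Min {d0 / 2, d1 / 2, d2 / 2, 1}"
    have \<epsilon>: "\<epsilon> > 0" "\<epsilon> \<le> d0 / 2" "\<epsilon> \<le> d1 / 2" "\<epsilon> \<le> d2 / 2" "\<epsilon> \<le> 1"
      unfolding \<epsilon>_def using d0 d1 d2 by auto
    obtain k :: "'a \<Rightarrow> real" and k' where k: "\<And>z. (k has_derivative k' z) (at z)"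
      "continuous_on UNIV (\<lambda>(z, w). k' z w)"
      "\<And>z. k z \<ge> 0" "\<And>z. norm z \<ge> \<epsilon> \<Longrightarrow> k z = 0" "(\<integral>z. k z \<partial>lborel) = 1"
      using C1_mollifier_ex[OF \<epsilon>(1), where 'a='a] by metis
    have ck: "continuous_on UNIV k"
      using k by (auto intro!: continuous_at_imp_continuous_on has_derivative_continuous)
    have [measurable]: "k \<in> borel_measurable borel" "g \<in> borel_measurable borel"
      using ck g borel_measurable_continuous_onI by auto
    define m where "m = (\<lambda>x. integral B (\<lambda>y. g y * k (y - x)))"
    define m' where "m' = (\<lambda>x w. integral B (\<lambda>y. g y * k' (y - x) (- w)))"
    have m1: "((\<lambda>t. m (x + t *\<^sub>R w)) has_real_derivative m' x w) (at 0)" for x w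
      unfolding m_def m'_def B_def by (rule mollification_derivative(1)[OF g(1) k(1,2)])
    have m2: "continuous_on UNIV m"
      unfolding m_def B_def by (rule mollification_derivative(2)[OF g(1) k(1,2)])
    have m3: "continuous_on UNIV (\<lambda>x. m' x w)" for w
      unfolding m'_def B_def by (rule mollification_derivative(3)[OF g(1) k(1,2)])
    note ci = continuous_on_compose2[OF g(1)] continuous_on_compose2[OF ck]
    have int: "integrable lborel (\<lambda>z. g (x + z) * k z)" for x
    proof (rule integrable_continuous_vanishing)
      show "continuous_on UNIV (\<lambda>z. g (x + z) * k z)" by (intro continuous_intros ci) auto
      show "g (x + z) * k z = 0" if "\<epsilon> < norm z" for z using that k(4) by simp
    qed
    have intk: "integrable lborel k"
      by (rule integrable_continuous_vanishing[OF ck, of \<epsilon>]) (use k(4) in auto)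
    have m_eq: "m x = (\<integral>z. g (x + z) * k z \<partial>lborel)" if "norm x < r + 2" for x
    proof -
      have "(\<integral>z. g (x + z) * k z \<partial>lborel) = (\<integral>z. (\<lambda>y. g y * k (y - x)) (x + z) \<partial>lborel)" by simp
      also have "\<dots> = (\<integral>y. g y * k (y - x) \<partial>lborel)"
        by (rule lborel_integral_translate) measurable
      also have "\<dots> = m x" unfolding m_def B_def
      proof (rule lborel_integral_eq_cbox(2))
        show "continuous_on UNIV (\<lambda>y. g y * k (y - x))" by (intro continuous_intros ci) auto
        fix y assume "y \<notin> cbox (- (r + 3) *\<^sub>R One) ((r + 3) *\<^sub>R (One::'a))"
        then have "norm y > r + 3" using mem_cbox_of_norm_le[of y "r + 3"] by force
        moreover have "norm y \<le> norm (y - x) + norm x" by (metis norm_triangle_sub add.commute)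
        ultimately have "norm (y - x) \<ge> \<epsilon>" using that \<epsilon>(5) by linarith
        then show "g y * k (y - x) = 0" using k(4) by simp
      qed
      finally show ?thesis by simp
    qed
    have near: "\<bar>m x - \<psi> x\<bar> \<le> e" if x: "x \<in> K" for x
    proof -
      have xK': "x \<in> K'" using K'I[OF x, of x] d0 by simp
      have "m x - \<psi> x = (\<integral>z. (g (x + z) * k z - \<psi> x * k z) \<partial>lborel)"
        using m_eq[of x] r(2)[OF x] k(5)
        by (subst Bochner_Integration.integral_diff[OF int integrable_mult_right[OF intk]]) simp
      also have "\<bar>\<dots>\<bar> \<le> (\<integral>z. e * k z \<partial>lborel)"
        unfolding real_norm_def[symmetric]
      proof (rule Bochner_Integration.integral_norm_bound_integral)
        show "integrable lborel (\<lambda>z. g (x + z) * k z - \<psi> x * k z)" using int intk by auto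
        show "integrable lborel (\<lambda>z. e * k z)" using intk by auto
        show "norm (g (x + z) * k z - \<psi> x * k z) \<le> e * k z" for z
        proof (cases "norm z < \<epsilon>")
          case True
          have "x + z \<in> K'" using True \<epsilon> d0 by (intro K'I[OF x]) (simp add: dist_norm)
          then have "\<bar>g (x + z) - \<psi> x\<bar> < e"
            using d2(2)[OF xK', of "x + z"] g(2) True \<epsilon> d2(1) by (simp add: dist_norm)
          then have "\<bar>g (x + z) - \<psi> x\<bar> * k z \<le> e * k z" using k(3) by (intro mult_right_mono) auto
          then show ?thesis using k(3)[of z] by (simp add: abs_mult left_diff_distrib[symmetric])
        qed (use k(4) in auto)
      qed
      finally show ?thesis using k(5) by simp
    qed
    have bd: "\<bar>m' x (Y x)\<bar> \<le> b x + e" if x: "x \<in> K" for x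
    proof (rule derivative_abs_le[OF m1])
      let ?d = "Min {d1, 1 / M, d0 / (2 * M)}"
      show "?d > 0" using d1 M d0 by auto
      fix t assume t: "0 < t" "t < ?d"
      have tY: "norm (t *\<^sub>R Y x) \<le> 1" "norm (t *\<^sub>R Y x) \<le> d0 / 2"
      proof -
        have "norm (t *\<^sub>R Y x) \<le> t * M" using t M(2)[OF x] by (simp add: less_imp_le)
        moreover have "t * M \<le> 1" "t * M \<le> d0 / 2" using t M(1) by (auto simp: field_simps)
        ultimately show "norm (t *\<^sub>R Y x) \<le> 1" "norm (t *\<^sub>R Y x) \<le> d0 / 2" by linarith+
      qed
      have "norm (x + t *\<^sub>R Y x) < r + 2"
        using norm_triangle_ineq[of x "t *\<^sub>R Y x"] tY r(2)[OF x] by linarith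
      then have "m (x + t *\<^sub>R Y x) - m (x + 0 *\<^sub>R Y x) =
          (\<integral>z. (g (x + t *\<^sub>R Y x + z) * k z - g (x + z) * k z) \<partial>lborel)"
        using m_eq[of x] m_eq[of "x + t *\<^sub>R Y x"] r(2)[OF x]
        by (subst Bochner_Integration.integral_diff[OF int int]) simp
      also have "\<bar>\<dots>\<bar> \<le> (\<integral>z. t * (b x + e) * k z \<partial>lborel)"
        unfolding real_norm_def[symmetric]
      proof (rule Bochner_Integration.integral_norm_bound_integral)
        show "integrable lborel (\<lambda>z. g (x + t *\<^sub>R Y x + z) * k z - g (x + z) * k z)" using int by auto
        show "integrable lborel (\<lambda>z. t * (b x + e) * k z)" using intk by auto
        show "norm (g (x + t *\<^sub>R Y x + z) * k z - g (x + z) * k z) \<le> t * (b x + e) * k z" for z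
        proof (cases "norm z < \<epsilon>")
          case True
          have "x + z \<in> K'" using True \<epsilon> d0 by (intro K'I[OF x]) (simp add: dist_norm)
          moreover have "dist x (x + t *\<^sub>R Y x + z) \<le> norm (t *\<^sub>R Y x) + norm z"
            using norm_triangle_ineq[of "t *\<^sub>R Y x" z]
            by (subst dist_commute) (simp add: dist_norm add.assoc)
          then have "x + t *\<^sub>R Y x + z \<in> K'"
            using tY True \<epsilon> d0 by (intro K'I[OF x]) linarith
          moreover have "\<bar>\<psi> (x + z + t *\<^sub>R Y x) - \<psi> (x + z)\<bar> \<le> t * (b x + e)"
            by (rule d1(2)[OF x]) (use True \<epsilon> t d1 in \<open>auto simp: dist_norm\<close>)
          ultimately have "\<bar>g (x + t *\<^sub>R Y x + z) - g (x + z)\<bar> \<le> t * (b x + e)"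
            using g(2) by (simp add: add_ac)
          then have "\<bar>g (x + t *\<^sub>R Y x + z) - g (x + z)\<bar> * k z \<le> t * (b x + e) * k z"
            using k(3) by (intro mult_right_mono) auto
          then show ?thesis using k(3)[of z] by (simp add: abs_mult left_diff_distrib[symmetric])
        qed (use k(4) in auto)
      qed
      finally show "\<bar>m (x + t *\<^sub>R Y x) - m (x + 0 *\<^sub>R Y x)\<bar> \<le> t * (b x + e)" using k(5) by simp
    qed
    have m'_sum: "(\<Sum>i\<in>Basis. m' x i * (Y x \<bullet> i)) = m' x (Y x)" for x
    proof -
      have lin: "linear (k' z)" for z using k(1) has_derivative_linear by blast
      have ik: "(\<lambda>y. g y * k' (y - x) (- w)) integrable_on B" for w
      proof -
        have "continuous_on B (\<lambda>y. k' (y - x) (- w))"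
          using continuous_on_compose2[OF k(2), of B "\<lambda>y. (y - x, - w)"]
          by (simp add: continuous_intros)
        then show ?thesis unfolding B_def
          by (intro integrable_continuous continuous_intros ci) auto
      qed
      have "k' z (- Y x) = (\<Sum>i\<in>Basis. (Y x \<bullet> i) * k' z (- i))" for z
      proof -
        have "k' z (- Y x) = k' z (- (\<Sum>i\<in>Basis. (Y x \<bullet> i) *\<^sub>R i))" by (simp add: euclidean_representation)
        also have "\<dots> = (\<Sum>i\<in>Basis. (Y x \<bullet> i) * k' z (- i))"
          using lin[of z] by (simp add: linear_neg linear_sum linear_scale sum_negf)
        finally show ?thesis .
      qed
      then have "m' x (Y x) = integral B (\<lambda>y. \<Sum>i\<in>Basis. (g y * k' (y - x) (- i)) * (Y x \<bullet> i))"
        unfolding m'_def by (simp add: sum_distrib_left mult_ac)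
      also have "\<dots> = (\<Sum>i\<in>Basis. integral B (\<lambda>y. (g y * k' (y - x) (- i)) * (Y x \<bullet> i)))"
        by (intro integral_sum) (auto intro!: integrable_on_mult_left ik)
      also have "\<dots> = (\<Sum>i\<in>Basis. m' x i * (Y x \<bullet> i))" by (simp add: m'_def)
      finally show ?thesis by simp
    qed
    have parts: "(\<integral>x. (m x * D i x + m' x i * (Y x \<bullet> i)) \<partial>lborel) = 0" if "i \<in> Basis" for i
    proof (rule integral_directional_derivative_eq_0[where F = "\<lambda>x. m x * (Y x \<bullet> i)" and v = i, OF _ _ _ K(1)])
      show "((\<lambda>t. m (x + t *\<^sub>R i) * (Y (x + t *\<^sub>R i) \<bullet> i)) has_real_derivative m x * D i x + m' x i * (Y x \<bullet> i)) (at 0)" for x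
        using DERIV_mult[OF m1[of x i] D[OF that, of x]] by (simp add: algebra_simps)
      show "continuous_on UNIV (\<lambda>x. m x * (Y x \<bullet> i))" by (intro continuous_intros m2 cY)
      show "continuous_on UNIV (\<lambda>x. m x * D i x + m' x i * (Y x \<bullet> i))"
        by (intro continuous_intros m2 m3 cY cD that)
    qed (use Y0 D0 that in auto)
    have ip: "integrable lborel (\<lambda>x. m x * D i x + m' x i * (Y x \<bullet> i))" if "i \<in> Basis" for i
    proof (rule integrable_continuous_vanishing)
      show "continuous_on UNIV (\<lambda>x. m x * D i x + m' x i * (Y x \<bullet> i))"
        by (intro continuous_intros m2 m3 cY cD that)
      show "m x * D i x + m' x i * (Y x \<bullet> i) = 0" if "r < norm x" for x
      proof -
        have "x \<notin> K" using that r(2)[of x] by auto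
        then show ?thesis using Y0 D0[OF \<open>i \<in> Basis\<close>] by simp
      qed
    qed
    have "0 = (\<integral>x. (\<Sum>i\<in>Basis. m x * D i x + m' x i * (Y x \<bullet> i)) \<partial>lborel)"
      using parts ip by (subst Bochner_Integration.integral_sum) auto
    also have "\<dots> = (\<integral>x. indicator K x * (m x * S x) + indicator K x * m' x (Y x) \<partial>lborel)"
    proof (rule Bochner_Integration.integral_cong[OF refl])
      show "(\<Sum>i\<in>Basis. m x * D i x + m' x i * (Y x \<bullet> i)) = indicator K x * (m x * S x) + indicator K x * m' x (Y x)" for x
        using Y0[of x] D0[of _ x]
        by (cases "x \<in> K") (auto simp: sum.distrib m'_sum S_def sum_distrib_left)
    qed
    finally have z: "0 = (\<integral>x. indicator K x * (m x * S x) + indicator K x * m' x (Y x) \<partial>lborel)" .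
    have cm': "continuous_on UNIV (\<lambda>x. m' x (Y x))"
      unfolding m'_sum[symmetric] by (intro continuous_intros m3 cY)
    have i1: "integrable lborel (\<lambda>x. indicator K x * (m x * S x))"
      by (intro integrable_indicator_mult_continuous K continuous_intros cS continuous_on_subset[OF m2]) auto
    have i2: "integrable lborel (\<lambda>x. indicator K x * m' x (Y x))"
      by (intro integrable_indicator_mult_continuous K continuous_on_subset[OF cm']) auto
    have i3: "integrable lborel (\<lambda>x. indicator K x * (\<psi> x * S x))"
      by (intro integrable_indicator_mult_continuous K continuous_intros cS continuous_on_subset[OF \<psi>])
    have i4: "integrable lborel (\<lambda>x. indicator K x * b x)"
      by (intro integrable_indicator_mult_continuous K b)
    have i5: "integrable lborel (\<lambda>x. indicator K x * \<bar>S x\<bar>)"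
      by (intro integrable_indicator_mult_continuous K continuous_intros cS)
    have i6: "integrable lborel (\<lambda>x. indicator K x * (1::real))"
      by (intro integrable_indicator_mult_continuous K continuous_intros)
    have "(\<integral>x. indicator K x * (\<psi> x * S x) \<partial>lborel) =
        (\<integral>x. indicator K x * (\<psi> x * S x) \<partial>lborel) - (\<integral>x. indicator K x * (m x * S x) + indicator K x * m' x (Y x) \<partial>lborel)"
      using z by simp
    also have "\<dots> = (\<integral>x. indicator K x * (\<psi> x * S x) - (indicator K x * (m x * S x) + indicator K x * m' x (Y x)) \<partial>lborel)"
      using i1 i2 i3 by (simp add: Bochner_Integration.integral_diff)
    also have "\<bar>\<dots>\<bar> \<le> (\<integral>x. e * (indicator K x * \<bar>S x\<bar>) + (indicator K x * b x + e * (indicator K x * 1)) \<partial>lborel)"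
    proof (rule Bochner_Integration.integral_abs_bound_integral)
      show "\<bar>indicator K x * (\<psi> x * S x) - (indicator K x * (m x * S x) + indicator K x * m' x (Y x))\<bar>
        \<le> e * (indicator K x * \<bar>S x\<bar>) + (indicator K x * b x + e * (indicator K x * 1))" for x
      proof (cases "x \<in> K")
        case True
        have "\<bar>\<psi> x * S x - (m x * S x + m' x (Y x))\<bar> \<le> \<bar>(\<psi> x - m x) * S x\<bar> + \<bar>m' x (Y x)\<bar>"
          by (simp add: algebra_simps)
        also have "\<bar>(\<psi> x - m x) * S x\<bar> \<le> e * \<bar>S x\<bar>"
          using near[OF True] by (simp add: abs_mult abs_minus_commute mult_right_mono)
        finally show ?thesis using bd[OF True] True by simp
      qed simp
    qed (use i1 i2 i3 i4 i5 i6 in auto)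
    also have "\<dots> = (\<integral>x. indicator K x * b x \<partial>lborel)
     + e * ((\<integral>x. indicator K x * \<bar>S x\<bar> \<partial>lborel) + (\<integral>x. indicator K x * 1 \<partial>lborel))"
      using i4 i5 i6 by (simp add: algebra_simps)
    finally show ?thesis .
  qed
  let ?C = "(\<integral>x. indicator K x * \<bar>S x\<bar> \<partial>lborel) + (\<integral>x. indicator K x * 1 \<partial>(lborel :: 'a measure))"
  let ?L = "\<bar>\<integral>x. indicator K x * (\<psi> x * S x) \<partial>lborel\<bar>" and ?I = "\<integral>x. indicator K x * b x \<partial>lborel"
  have "?C \<ge> 0" by (auto intro!: add_nonneg_nonneg)
  have "?L \<le> ?I"
  proof (rule field_le_epsilon)
    fix \<delta> :: real assume "\<delta> > 0"
    then have "?L \<le> ?I + \<delta> / (?C + 1) * ?C"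
      by (intro main divide_pos_pos add_nonneg_pos \<open>?C \<ge> 0\<close>) auto
    also have "\<delta> / (C + 1) * C \<le> \<delta>" if "C \<ge> 0" for C :: real
      using that \<open>\<delta> > 0\<close> by (simp add: field_simps)
    from this[OF \<open>?C \<ge> 0\<close>] have "?I + \<delta> / (?C + 1) * ?C \<le> ?I + \<delta>" by simp
    finally show "?L \<le> ?I + \<delta>" by simp
  qed
  then show ?thesis unfolding S_def .
qed

section \<open>Piecewise C^1 curves\<close>

definition C1_at :: "(real \<Rightarrow> 'a::real_normed_vector) \<Rightarrow> real \<Rightarrow> bool" where
  "C1_at g t \<longleftrightarrow> (\<exists>D. (\<forall>\<^sub>F s in nhds t. (g has_vector_derivative D s) (at s)) \<and> isCont D t)"

lemma C1_at_cong:
  assumes g: "C1_at g t" and eq: "\<forall>\<^sub>F s in nhds t. g s = h s"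
  shows "C1_at h t"
proof -
  obtain D where D: "\<forall>\<^sub>F s in nhds t. (g has_vector_derivative D s) (at s)" "isCont D t"
    using g by (auto simp: C1_at_def)
  obtain T where T: "open T" "t \<in> T" "\<And>s. s \<in> T \<Longrightarrow> g s = h s"
    using eq by (auto simp: eventually_nhds)
  have "\<forall>\<^sub>F s in nhds t. s \<in> T" using T eventually_nhds by blast
  with D(1) have "\<forall>\<^sub>F s in nhds t. (h has_vector_derivative D s) (at s)"
    by eventually_elim (use T in \<open>auto intro: has_vector_derivative_transform_within_open\<close>)
  then show ?thesis using D(2) by (auto simp: C1_at_def)
qed

lemma C1_at_affine:
  assumes "C1_at g (a * t + u)" shows "C1_at (\<lambda>s. g (a * s + u)) t"
proof -
  obtain D where D: "\<forall>\<^sub>F s in nhds (a * t + u). (g has_vector_derivative D s) (at s)"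
    and c: "isCont D (a * t + u)"
    using assms by (auto simp: C1_at_def)
  have "filterlim (\<lambda>s. a * s + u) (nhds (a * t + u)) (nhds t)"
    by (rule tendsto_intros filterlim_ident)+
  then have "\<forall>\<^sub>F s in nhds t. (g has_vector_derivative D (a * s + u)) (at (a * s + u))"
    using D eventually_compose_filterlim by blast
  then have "\<forall>\<^sub>F s in nhds t. ((\<lambda>s. g (a * s + u)) has_vector_derivative a *\<^sub>R D (a * s + u)) (at s)"
  proof eventually_elim
    case (elim s)
    have "((\<lambda>s. a * s + u) has_vector_derivative a) (at s)"
      by (auto intro!: derivative_eq_intros simp: has_real_derivative_iff_has_vector_derivative[symmetric])
    from vector_diff_chain_at[OF this elim] show ?case by (simp add: o_def)
  qed
  moreover have "isCont (\<lambda>s. a *\<^sub>R D (a * s + u)) t"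
    by (intro continuous_intros isCont_o2[of _ "\<lambda>s. a * s + u" D]) (use c in auto)
  ultimately show ?thesis unfolding C1_at_def by (intro exI conjI)
qed

lemma C1_at_imp_has_vector_derivative:
  assumes "C1_at g t" obtains v where "(g has_vector_derivative v) (at t)"
  using assms unfolding C1_at_def by (metis eventually_nhds_x_imp_x)

definition subcurve :: "real \<Rightarrow> real \<Rightarrow> (real \<Rightarrow> 'a) \<Rightarrow> real \<Rightarrow> 'a" where
  "subcurve u v \<gamma> t = \<gamma> ((v - u) * t + u)"

lemma path_isCont: "path \<gamma> \<Longrightarrow> t \<in> {0<..<1} \<Longrightarrow> isCont \<gamma> t"
  unfolding path_def using continuous_on_interior[of "{0..1}" \<gamma> t] by simp

lemma nn_integral_interval_finite_cong:
  fixes f g :: "real \<Rightarrow> ennreal"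
  assumes "finite S" "\<And>t. t \<in> {u<..<v} - S \<Longrightarrow> f t = g t"
  shows "(\<integral>\<^sup>+t\<in>{u..v}. f t \<partial>lborel) = (\<integral>\<^sup>+t\<in>{u..v}. g t \<partial>lborel)"
proof (rule nn_integral_cong_AE)
  have "AE t in lborel. t \<notin> insert u (insert v S)"
    by (rule AE_not_in) (use assms(1) in \<open>auto intro: finite_imp_null_set_lborel\<close>)
  then show "AE t in lborel. f t * indicator {u..v} t = g t * indicator {u..v} t"
    by eventually_elim (use assms(2) in \<open>auto simp: indicator_def\<close>)
qed

lemma nn_integral_interval_finite_mono:
  fixes f g :: "real \<Rightarrow> ennreal"
  assumes "finite S" "\<And>t. t \<in> {u<..<v} - S \<Longrightarrow> f t \<le> g t"
  shows "(\<integral>\<^sup>+t\<in>{u..v}. f t \<partial>lborel) \<le> (\<integral>\<^sup>+t\<in>{u..v}. g t \<partial>lborel)"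
proof (rule nn_integral_mono_AE)
  have "AE t in lborel. t \<notin> insert u (insert v S)"
    by (rule AE_not_in) (use assms(1) in \<open>auto intro: finite_imp_null_set_lborel\<close>)
  then show "AE t in lborel. f t * indicator {u..v} t \<le> g t * indicator {u..v} t"
    by eventually_elim (use assms(2) in \<open>auto simp: indicator_def\<close>)
qed

locale connected_riemannian =
  fixes A :: "('m::{t2_space, second_countable_topology}, 'n::finite) chart set"
    and G :: "('m, 'n) metric_components"
  assumes atlas: "smooth_atlas A" and metric: "riemannian_metric A G"
    and connected_UNIV: "connected (UNIV :: 'm set)"
begin

lemma chart_at: "chart_at A q \<in> A" "q \<in> cdom (chart_at A q)"
proof -
  have "\<exists>c. c \<in> A \<and> q \<in> cdom c" using atlas unfolding smooth_atlas_def by blast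
  then have "chart_at A q \<in> A \<and> q \<in> cdom (chart_at A q)"
    unfolding chart_at_def by (rule someI_ex)
  then show "chart_at A q \<in> A" "q \<in> cdom (chart_at A q)" by auto
qed

context
  fixes c assumes c: "c \<in> A"
begin

lemma open_cdom: "open (cdom c)" and open_cimage: "open (cimage c)"
  and homeomorphism_chart: "homeomorphism (cdom c) (cimage c) (coord c) (param c)"
  using atlas c unfolding smooth_atlas_def by auto

lemma continuous_on_coord: "continuous_on (cdom c) (coord c)"
  and continuous_on_param: "continuous_on (cimage c) (param c)"
  and param_coord [simp]: "q \<in> cdom c \<Longrightarrow> param c (coord c q) = q"
  and coord_param [simp]: "x \<in> cimage c \<Longrightarrow> coord c (param c x) = x"
  and param_in_cdom [simp]: "x \<in> cimage c \<Longrightarrow> param c x \<in> cdom c"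
  and coord_in_cimage [simp]: "q \<in> cdom c \<Longrightarrow> coord c q \<in> cimage c"
  using homeomorphism_chart by (auto simp: homeomorphism_def)

lemma open_param_image:
  assumes "open U" "U \<subseteq> cimage c" shows "open (param c ` U)"
proof -
  have "param c ` U = cdom c \<inter> coord c -` U"
    using assms(2) by (force simp: image_iff subset_eq intro: bexI[where x = "coord c _"])
  then show ?thesis
    using continuous_open_preimage[OF continuous_on_coord open_cdom assms(1)] by simp
qed

lemma isCont_coord: "q \<in> cdom c \<Longrightarrow> isCont (coord c) q"
  using continuous_on_coord open_cdom continuous_on_eq_continuous_at by blast

lemma continuous_on_metric: "continuous_on (cimage c) (G c)"
  and Ck_on_metric: "Ck_on k (cimage c) (G c)"
  and metric_pos: "x \<in> cimage c \<Longrightarrow> v \<noteq> 0 \<Longrightarrow> v \<bullet> (G c x *v v) > 0"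
  and metric_transpose: "x \<in> cimage c \<Longrightarrow> transpose (G c x) = G c x"
proof -
  have *: "smooth_on (cimage c) (G c)" using metric c unfolding riemannian_metric_def by blast
  then show "Ck_on k (cimage c) (G c)" for k unfolding smooth_on_def by blast
  then show "continuous_on (cimage c) (G c)" by (metis Ck_on.simps(1))
  show "x \<in> cimage c \<Longrightarrow> v \<noteq> 0 \<Longrightarrow> v \<bullet> (G c x *v v) > 0"
    "x \<in> cimage c \<Longrightarrow> transpose (G c x) = G c x"
    using metric c unfolding riemannian_metric_def by blast+
qed

lemma metric_symmetric:
  assumes "x \<in> cimage c" shows "v \<bullet> (G c x *v w) = w \<bullet> (G c x *v v)"
  by (metis assms metric_transpose dot_lmul_matrix inner_commute transpose_matrix_vector)

lemma invertible_metric: "x \<in> cimage c \<Longrightarrow> invertible (G c x)"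
  using invertible_of_pos_def metric_pos by blast

lemma det_metric_pos: "x \<in> cimage c \<Longrightarrow> det (G c x) > 0"
  using det_pos_of_pos_def metric_pos by blast

end

definition gnorm :: "('m, 'n) chart \<Rightarrow> real^'n \<Rightarrow> real^'n \<Rightarrow> real" where
  "gnorm c x v = sqrt (v \<bullet> (G c x *v v))"

lemma gnorm_scale: "gnorm c x (a *\<^sub>R v) = \<bar>a\<bar> * gnorm c x v"
  by (simp add: gnorm_def matrix_vector_mult_scaleR real_sqrt_mult[symmetric] power2_eq_square[symmetric]
      real_sqrt_abs[symmetric] mult.assoc[symmetric] del: real_sqrt_abs)

lemma gnorm_nonneg: "c \<in> A \<Longrightarrow> x \<in> cimage c \<Longrightarrow> gnorm c x v \<ge> 0"
  unfolding gnorm_def using metric_pos[of c x v] by (cases "v = 0") (auto simp: less_imp_le)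

lemma gnorm_pos: "c \<in> A \<Longrightarrow> x \<in> cimage c \<Longrightarrow> v \<noteq> 0 \<Longrightarrow> gnorm c x v > 0"
  unfolding gnorm_def using metric_pos by simp

lemma continuous_on_gnorm:
  assumes c: "c \<in> A" and f: "continuous_on S f" "f ` S \<subseteq> cimage c" and v: "continuous_on S v"
  shows "continuous_on S (\<lambda>s. gnorm c (f s) (v s))"
  unfolding gnorm_def inner_vec_def matrix_vector_mult_def
  by (auto intro!: continuous_intros continuous_on_compose2[OF continuous_on_metric[OF c] f(1)] v f)

context
  fixes c c' assumes c: "c \<in> A" and c': "c' \<in> A"
begin

lemma overlap_eq: "coord c ` (cdom c \<inter> cdom c') = cimage c \<inter> param c -` cdom c'"
  using param_coord[OF c] coord_param[OF c] param_in_cdom[OF c] coord_in_cimage[OF c]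
  by (force simp: image_iff)

lemma open_overlap: "open (cimage c \<inter> param c -` cdom c')"
  using continuous_open_preimage[OF continuous_on_param[OF c] open_cimage[OF c] open_cdom[OF c']] .

lemma transition_C1:
  shows transition_has_derivative: "x \<in> cimage c \<Longrightarrow> param c x \<in> cdom c' \<Longrightarrow>
      (transition c c' has_derivative frechet_derivative (transition c c') (at x)) (at x)"
    and "continuous_on (cimage c \<inter> param c -` cdom c') (\<lambda>x. frechet_derivative (transition c c') (at x) v)"
proof -
  have "smooth_on (cimage c \<inter> param c -` cdom c') (transition c c')"
    using atlas c c' unfolding smooth_atlas_def overlap_eq[symmetric] by blast
  then have "Ck_on (Suc 0) (cimage c \<inter> param c -` cdom c') (transition c c')"
    unfolding smooth_on_def by blast
  then show "x \<in> cimage c \<Longrightarrow> param c x \<in> cdom c' \<Longrightarrow>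
      (transition c c' has_derivative frechet_derivative (transition c c') (at x)) (at x)"
    "continuous_on (cimage c \<inter> param c -` cdom c') (\<lambda>x. frechet_derivative (transition c c') (at x) v)"
    by (auto simp: frechet_derivative_works[symmetric])
qed

lemma metric_transform:
  assumes x: "x \<in> cimage c" "param c x \<in> cdom c'"
  defines "D \<equiv> frechet_derivative (transition c c') (at x)"
  shows "v \<bullet> (G c x *v w) = D v \<bullet> (G c' (transition c c' x) *v D w)"
proof -
  have lin: "linear D" unfolding D_def using transition_has_derivative[OF x] has_derivative_linear by blast
  let ?J = "matrix D"
  have "x \<in> coord c ` (cdom c \<inter> cdom c')" using x overlap_eq by auto
  then have "G c x = transpose ?J ** G c' (transition c c' x) ** ?J"
    using metric c c' unfolding riemannian_metric_def D_def Let_def by blast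
  then have "v \<bullet> (G c x *v w) = v \<bullet> (transpose ?J *v (G c' (transition c c' x) *v (?J *v w)))"
    by (simp add: matrix_vector_mul_assoc matrix_mul_assoc)
  also have "\<dots> = (?J *v v) \<bullet> (G c' (transition c c' x) *v (?J *v w))"
    by (metis dot_lmul_matrix inner_commute transpose_matrix_vector)
  finally show ?thesis using fun_cong[OF matrix_vector_mul(2)[OF lin]] by simp
qed

end

lemma speed_eq:
  assumes c: "c \<in> A" and g: "isCont \<gamma> t" "\<gamma> t \<in> cdom c"
    and v: "((coord c \<circ> \<gamma>) has_vector_derivative v) (at t)"
  shows "speed A G \<gamma> t = gnorm c (coord c (\<gamma> t)) v"
proof -
  define c' where "c' = chart_at A (\<gamma> t)"
  have c': "c' \<in> A" "\<gamma> t \<in> cdom c'" unfolding c'_def by (rule chart_at)+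
  define x where "x = coord c (\<gamma> t)"
  have x: "x \<in> cimage c" "param c x = \<gamma> t" unfolding x_def using c g by auto
  let ?D = "frechet_derivative (transition c c') (at x)"
  have D: "(transition c c' has_derivative ?D) (at x)"
    using transition_has_derivative[OF c c'(1) x(1)] x c' by simp
  have "((\<lambda>s. (coord c \<circ> \<gamma>) s) has_derivative (\<lambda>h. h *\<^sub>R v)) (at t)"
    using v unfolding has_vector_derivative_def .
  from has_derivative_compose[OF this, of "transition c c'" ?D]
  have "((\<lambda>s. transition c c' ((coord c \<circ> \<gamma>) s)) has_derivative (\<lambda>h. ?D (h *\<^sub>R v))) (at t)"
    using D by (simp add: x_def)
  then have V: "((\<lambda>s. transition c c' ((coord c \<circ> \<gamma>) s)) has_vector_derivative ?D v) (at t)"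
    unfolding has_vector_derivative_def
    by (rule has_derivative_eq_rhs) (simp add: linear_scale[OF has_derivative_linear[OF D]])
  obtain T where T: "open T" "t \<in> T" "\<And>s. s \<in> T \<Longrightarrow> \<gamma> s \<in> cdom c"
    using g(1)[unfolded continuous_at_open, rule_format, of "cdom c"] g(2) open_cdom[OF c] by blast
  have "((coord c' \<circ> \<gamma>) has_vector_derivative ?D v) (at t)"
    by (rule has_vector_derivative_transform_within_open[OF V T(1,2)])
      (use T(3) c in \<open>auto simp: transition_def\<close>)
  then have "vector_derivative (coord c' \<circ> \<gamma>) (at t) = ?D v" by (rule vector_derivative_at)
  moreover have "transition c c' x = coord c' (\<gamma> t)" using x by (simp add: transition_def)
  ultimately show ?thesis
    unfolding speed_def c'_def[symmetric] Let_def gnorm_def x_def[symmetric]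
    using metric_transform[OF c c'(1) x(1), of v v] x c' by simp
qed

lemma speed_nonneg: "speed A G \<gamma> t \<ge> 0"
  unfolding speed_def Let_def using gnorm_nonneg[OF chart_at(1), of "coord (chart_at A (\<gamma> t)) (\<gamma> t)" "\<gamma> t"]
  by (simp add: gnorm_def chart_at)

lemma piecewise_C1_path_iff:
  "piecewise_C1_path A \<gamma> \<longleftrightarrow> path \<gamma> \<and>
     (\<exists>S. finite S \<and> (\<forall>c\<in>A. \<forall>t\<in>{0<..<1} - S. \<gamma> t \<in> cdom c \<longrightarrow> C1_at (coord c \<circ> \<gamma>) t))"
proof safe
  assume "piecewise_C1_path A \<gamma>"
  then obtain S where p: "path \<gamma>" and S: "finite S"
    "\<And>c. c \<in> A \<Longrightarrow> (coord c \<circ> \<gamma>) C1_differentiable_on ({t\<in>{0..1}. \<gamma> t \<in> cdom c} - S)"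
    unfolding piecewise_C1_path_def by blast
  show "path \<gamma>" by (rule p)
  have "C1_at (coord c \<circ> \<gamma>) t" if c: "c \<in> A" and t: "t \<in> {0<..<1} - S" "\<gamma> t \<in> cdom c" for c t
  proof -
    define V where "V = ({0<..<1} \<inter> \<gamma> -` cdom c) - S"
    have "continuous_on {0<..<1} \<gamma>" using p unfolding path_def by (rule continuous_on_subset) auto
    then have V: "open V" unfolding V_def
      by (intro open_Diff continuous_open_preimage finite_imp_closed S(1) open_cdom[OF c]) auto
    obtain D where D: "\<And>s. s \<in> {t\<in>{0..1}. \<gamma> t \<in> cdom c} - S \<Longrightarrow> ((coord c \<circ> \<gamma>) has_vector_derivative D s) (at s)"
      "continuous_on ({t\<in>{0..1}. \<gamma> t \<in> cdom c} - S) D"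
      using S(2)[OF c] unfolding C1_differentiable_on_def by blast
    have sub: "V \<subseteq> {t\<in>{0..1}. \<gamma> t \<in> cdom c} - S" unfolding V_def by auto
    have "t \<in> V" using t unfolding V_def by auto
    moreover have "continuous_on V D" using D(2) sub continuous_on_subset by blast
    ultimately have "isCont D t" using V continuous_on_eq_continuous_at by blast
    moreover have "\<forall>\<^sub>F s in nhds t. ((coord c \<circ> \<gamma>) has_vector_derivative D s) (at s)"
      unfolding eventually_nhds using V \<open>t \<in> V\<close> D(1) sub by blast
    ultimately show ?thesis unfolding C1_at_def by blast
  qed
  then show "\<exists>S. finite S \<and> (\<forall>c\<in>A. \<forall>t\<in>{0<..<1} - S. \<gamma> t \<in> cdom c \<longrightarrow> C1_at (coord c \<circ> \<gamma>) t)"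
    using S(1) by blast
next
  fix S :: "real set"
  assume p: "path \<gamma>" and S: "finite S" and
    C1: "\<forall>c\<in>A. \<forall>t\<in>{0<..<1} - S. \<gamma> t \<in> cdom c \<longrightarrow> C1_at (coord c \<circ> \<gamma>) t"
  have "(coord c \<circ> \<gamma>) C1_differentiable_on ({t\<in>{0..1}. \<gamma> t \<in> cdom c} - ({0, 1} \<union> S))" if c: "c \<in> A" for c
    unfolding C1_differentiable_on_eq
  proof (intro conjI ballI continuous_at_imp_continuous_on)
    fix t assume "t \<in> {t\<in>{0..1}. \<gamma> t \<in> cdom c} - ({0, 1} \<union> S)"
    then have "t \<in> {0<..<1} - S" "\<gamma> t \<in> cdom c" by auto
    then obtain D where D: "\<forall>\<^sub>F s in nhds t. ((coord c \<circ> \<gamma>) has_vector_derivative D s) (at s)" "isCont D t"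
      using C1 c unfolding C1_at_def by blast
    show "coord c \<circ> \<gamma> differentiable at t"
      using eventually_nhds_x_imp_x[OF D(1)] by (rule differentiableI_vector)
    have "\<forall>\<^sub>F s in nhds t. vector_derivative (coord c \<circ> \<gamma>) (at s) = D s"
      using D(1) by eventually_elim (rule vector_derivative_at)
    then show "isCont (\<lambda>x. vector_derivative (coord c \<circ> \<gamma>) (at x)) t"
      using D(2) by (rule isCont_cong[THEN iffD2])
  qed
  then show "piecewise_C1_path A \<gamma>"
    unfolding piecewise_C1_path_def using p S by (intro conjI exI[of _ "{0, 1} \<union> S"]) auto
qed

lemma speed_isCont:
  assumes p: "path \<gamma>" and c: "c \<in> A" and t: "t \<in> {0<..<1}" "\<gamma> t \<in> cdom c"
    and C1: "C1_at (coord c \<circ> \<gamma>) t"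
  shows "isCont (speed A G \<gamma>) t"
proof -
  obtain D where D: "\<forall>\<^sub>F s in nhds t. ((coord c \<circ> \<gamma>) has_vector_derivative D s) (at s)" "isCont D t"
    using C1 unfolding C1_at_def by blast
  have g: "isCont \<gamma> t" using path_isCont p t by blast
  have 1: "\<forall>\<^sub>F s in nhds t. \<gamma> s \<in> cdom c"
    using g[unfolded continuous_at_open, rule_format, of "cdom c"] open_cdom[OF c] t(2)
    unfolding eventually_nhds by blast
  have 2: "\<forall>\<^sub>F s in nhds t. s \<in> {0<..<1}"
    using t(1) eventually_nhds open_greaterThanLessThan by blast
  have "\<forall>\<^sub>F s in nhds t. speed A G \<gamma> s = gnorm c (coord c (\<gamma> s)) (D s)"
    using D(1) 1 2 by eventually_elim (rule speed_eq[OF c path_isCont[OF p]])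
  moreover have "isCont (\<lambda>s. gnorm c (coord c (\<gamma> s)) (D s)) t"
  proof -
    have x: "isCont (\<lambda>s. coord c (\<gamma> s)) t"
      using isCont_o2[OF g isCont_coord[OF c t(2)]] .
    have "isCont (G c) (coord c (\<gamma> t))"
      using continuous_on_metric[OF c] open_cimage[OF c] continuous_on_eq_continuous_at
        coord_in_cimage[OF c t(2)] by blast
    from isCont_o2[OF x this] have "isCont (\<lambda>s. G c (coord c (\<gamma> s))) t" .
    then show ?thesis
      unfolding gnorm_def inner_vec_def matrix_vector_mult_def
      using D(2) by (auto intro!: continuous_intros)
  qed
  ultimately show ?thesis by (rule isCont_cong[THEN iffD2])
qed

lemma speed_measurable:
  assumes "path \<gamma>" "finite S"
    "\<And>c t. c \<in> A \<Longrightarrow> t \<in> {0<..<1} - S \<Longrightarrow> \<gamma> t \<in> cdom c \<Longrightarrow> C1_at (coord c \<circ> \<gamma>) t"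
  shows "(\<lambda>t. indicator ({0<..<1} - S) t * speed A G \<gamma> t) \<in> borel_measurable borel"
proof -
  have "continuous_on ({0<..<1} - S) (speed A G \<gamma>)"
    using assms chart_at speed_isCont by (intro continuous_at_imp_continuous_on) blast
  moreover have "{0<..<1} - S \<in> sets borel"
    using assms(2) by (intro borel_open open_Diff finite_imp_closed) auto
  ultimately have "(\<lambda>t. indicator ({0<..<1} - S) t *\<^sub>R speed A G \<gamma> t) \<in> borel_measurable borel"
    by (intro borel_measurable_continuous_on_indicator)
  then show ?thesis by simp
qed

lemma piecewise_C1_path_imp_path: "piecewise_C1_path A \<gamma> \<Longrightarrow> path \<gamma>"
  by (simp add: piecewise_C1_path_def)

lemma piecewise_C1_pathE:
  assumes "piecewise_C1_path A \<gamma>"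
  obtains S where "path \<gamma>" "finite S"
    "\<And>c t. c \<in> A \<Longrightarrow> t \<in> {0<..<1} - S \<Longrightarrow> \<gamma> t \<in> cdom c \<Longrightarrow> C1_at (coord c \<circ> \<gamma>) t"
  using assms unfolding piecewise_C1_path_iff by blast

lemma subcurve_length:
  assumes g: "piecewise_C1_path A \<gamma>" and uv: "u \<in> {0..1}" "v \<in> {0..1}" "u \<noteq> v"
  shows "piecewise_C1_path A (subcurve u v \<gamma>)"
    and "curve_length A G (subcurve u v \<gamma>) = (\<integral>\<^sup>+t\<in>{min u v..max u v}. ennreal (speed A G \<gamma> t) \<partial>lborel)"
proof -
  obtain S where p: "path \<gamma>" and S: "finite S"
    "\<And>c t. c \<in> A \<Longrightarrow> t \<in> {0<..<1} - S \<Longrightarrow> \<gamma> t \<in> cdom c \<Longrightarrow> C1_at (coord c \<circ> \<gamma>) t"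
    using piecewise_C1_pathE[OF g] by blast
  have p': "path (subcurve u v \<gamma>)" unfolding path_def subcurve_def
  proof (rule continuous_on_compose2[OF p[unfolded path_def]])
    show "(\<lambda>t. (v - u) * t + u) ` {0..1} \<subseteq> {0..1}"
    proof clarsimp
      fix t :: real assume t: "0 \<le> t" "t \<le> 1"
      have "(v - u) * t + u = (1 - t) * u + t * v" by (simp add: algebra_simps)
      moreover have "(1 - t) * u + t * v \<le> (1 - t) * 1 + t * 1" "(1 - t) * u + t * v \<ge> 0"
        using t uv by (intro add_mono mult_left_mono add_nonneg_nonneg mult_nonneg_nonneg; simp)+
      ultimately show "0 \<le> (v - u) * t + u \<and> (v - u) * t + u \<le> 1" by simp
    qed
  qed (intro continuous_intros)
  define a where "a = (\<lambda>t. (v - u) * t + u)"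
  define S' where "S' = a -` S"
  have "inj a" unfolding a_def inj_def using uv(3) by auto
  then have S': "finite S'" unfolding S'_def using S(1) by (intro finite_vimageI)
  have sub: "subcurve u v \<gamma> t = \<gamma> (a t)" for t by (simp add: subcurve_def a_def)
  have a01: "a t \<in> {0<..<1}" if "t \<in> {0<..<1}" for t
  proof (cases "u < v")
    case True
    then have "0 < (v - u) * t" "(v - u) * t < (v - u) * 1" using that by (auto intro: mult_strict_left_mono)
    then show ?thesis using uv by (auto simp: a_def)
  next
    case False
    then have "0 < (u - v) * t" "(u - v) * t < (u - v) * 1" using that uv(3) by (auto intro: mult_strict_left_mono)
    then show ?thesis using uv by (auto simp: a_def algebra_simps)
  qed
  have C1: "C1_at (coord c \<circ> subcurve u v \<gamma>) t"
    if "c \<in> A" "t \<in> {0<..<1} - S'" "subcurve u v \<gamma> t \<in> cdom c" for c t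
    using C1_at_affine[of "coord c \<circ> \<gamma>" "v - u" t u] S(2)[of c "a t"] that a01[of t]
    by (simp add: sub a_def S'_def o_def)
  then show "piecewise_C1_path A (subcurve u v \<gamma>)"
    unfolding piecewise_C1_path_iff using p' S' by blast
  define g where "g = (\<lambda>t. ennreal (indicator ({0<..<1} - S) t * speed A G \<gamma> t))"
  have g[measurable]: "g \<in> borel_measurable borel"
    unfolding g_def using speed_measurable[OF p S] by simp
  let ?I = "{min u v..max u v}"
  have aI: "a t \<in> ?I \<longleftrightarrow> t \<in> {0..1}" for t
  proof (cases "u < v")
    case True
    have "a t \<le> v \<longleftrightarrow> (v - u) * t \<le> (v - u) * 1" by (simp add: a_def algebra_simps)
    then show ?thesis using True by (auto simp: a_def zero_le_mult_iff)
  next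
    case False
    then have "u > v" using uv by simp
    moreover have "a t \<ge> v \<longleftrightarrow> (u - v) * t \<le> (u - v) * 1" by (simp add: a_def algebra_simps)
    moreover have "a t \<le> u \<longleftrightarrow> (u - v) * t \<ge> 0" by (simp add: a_def algebra_simps)
    ultimately show ?thesis by (auto simp: zero_le_mult_iff)
  qed
  have "(\<integral>\<^sup>+t\<in>?I. ennreal (speed A G \<gamma> t) \<partial>lborel) = (\<integral>\<^sup>+t\<in>?I. g t \<partial>lborel)"
    by (rule nn_integral_interval_finite_cong[OF S(1)]) (use uv in \<open>auto simp: g_def min_def max_def split: if_splits\<close>)
  also have "\<dots> = ennreal \<bar>v - u\<bar> * (\<integral>\<^sup>+t. g (u + (v - u) * t) * indicator ?I (u + (v - u) * t) \<partial>lborel)"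
    using uv(3) by (intro nn_integral_real_affine) auto
  also have "\<dots> = (\<integral>\<^sup>+t\<in>{0..1}. ennreal \<bar>v - u\<bar> * g (a t) \<partial>lborel)"
  proof -
    have 1: "u + (v - u) * t = a t" for t by (simp add: a_def)
    have 2: "indicator ?I (a t) = (indicator {0..1} t :: ennreal)" for t
      using aI by (simp add: indicator_def)
    have [measurable]: "a \<in> borel_measurable borel" unfolding a_def by measurable
    show ?thesis unfolding 1 2 mult.assoc by (rule nn_integral_cmult[symmetric]) measurable
  qed
  also have "\<dots> = curve_length A G (subcurve u v \<gamma>)"
    unfolding curve_length_def
  proof (rule nn_integral_interval_finite_cong[OF S'])
    fix t assume t: "t \<in> {0<..<1} - S'"
    then have at: "a t \<in> {0<..<1} - S" using a01 by (auto simp: S'_def)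
    let ?c = "chart_at A (\<gamma> (a t))"
    obtain w where w: "((coord ?c \<circ> \<gamma>) has_vector_derivative w) (at (a t))"
      using C1_at_imp_has_vector_derivative S(2)[OF chart_at(1) at chart_at(2)] by metis
    have "(a has_vector_derivative (v - u)) (at t)" unfolding a_def
      by (auto intro!: derivative_eq_intros simp: has_real_derivative_iff_has_vector_derivative[symmetric])
    from vector_diff_chain_at[OF this w]
    have "((coord ?c \<circ> subcurve u v \<gamma>) has_vector_derivative (v - u) *\<^sub>R w) (at t)"
      by (simp add: o_def sub)
    then have "speed A G (subcurve u v \<gamma>) t = gnorm ?c (coord ?c (\<gamma> (a t))) ((v - u) *\<^sub>R w)"
      using speed_eq[OF chart_at(1) path_isCont[OF p']] t chart_at by (simp add: sub)
    also have "\<dots> = \<bar>v - u\<bar> * speed A G \<gamma> (a t)"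
      using speed_eq[OF chart_at(1) path_isCont[OF p] chart_at(2) w] at by (simp add: gnorm_scale)
    finally show "ennreal \<bar>v - u\<bar> * g (a t) = ennreal (speed A G (subcurve u v \<gamma>) t)"
      using at by (simp add: g_def ennreal_mult' speed_nonneg)
  qed
  finally show "curve_length A G (subcurve u v \<gamma>) = (\<integral>\<^sup>+t\<in>?I. ennreal (speed A G \<gamma> t) \<partial>lborel)" by simp
qed

lemma length_split:
  assumes g: "piecewise_C1_path A \<gamma>" and u: "u \<in> {0..1}"
  shows "curve_length A G \<gamma> = (\<integral>\<^sup>+t\<in>{0..u}. ennreal (speed A G \<gamma> t) \<partial>lborel)
    + (\<integral>\<^sup>+t\<in>{u..1}. ennreal (speed A G \<gamma> t) \<partial>lborel)"
proof -
  obtain S where p: "path \<gamma>" and S: "finite S"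
    "\<And>c t. c \<in> A \<Longrightarrow> t \<in> {0<..<1} - S \<Longrightarrow> \<gamma> t \<in> cdom c \<Longrightarrow> C1_at (coord c \<circ> \<gamma>) t"
    using piecewise_C1_pathE[OF g] by blast
  define g where "g = (\<lambda>t. ennreal (indicator ({0<..<1} - S) t * speed A G \<gamma> t))"
  have g[measurable]: "g \<in> borel_measurable borel"
    unfolding g_def using speed_measurable[OF p S] by simp
  have eq: "(\<integral>\<^sup>+t\<in>{a..b}. ennreal (speed A G \<gamma> t) \<partial>lborel) = (\<integral>\<^sup>+t\<in>{a..b}. g t \<partial>lborel)"
    if "0 \<le> a" "b \<le> 1" for a b
    by (rule nn_integral_interval_finite_cong[OF S(1)]) (use that in \<open>auto simp: g_def\<close>)
  have "(\<integral>\<^sup>+t\<in>{0..1}. g t \<partial>lborel) = (\<integral>\<^sup>+t. g t * indicator {0..u} t + g t * indicator {u..1} t \<partial>lborel)"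
  proof (rule nn_integral_cong_AE)
    have "AE t in lborel. t \<notin> {u}" by (rule AE_not_in) auto
    then show "AE t in lborel. g t * indicator {0..1} t = g t * indicator {0..u} t + g t * indicator {u..1} t"
      by eventually_elim (use u in \<open>auto simp: indicator_def\<close>)
  qed
  then show ?thesis unfolding curve_length_def using u
    by (simp add: eq nn_integral_add)
qed

lemma curve_length_cong:
  assumes "\<And>t. t \<in> {0..1} \<Longrightarrow> \<gamma> t = \<gamma>' t"
  shows "curve_length A G \<gamma> = curve_length A G \<gamma>'"
  unfolding curve_length_def
proof (rule nn_integral_interval_finite_cong[of "{}"])
  fix t :: real assume t: "t \<in> {0<..<1} - {}"
  then have "\<forall>\<^sub>F s in nhds t. s \<in> {0<..<1}"
    using eventually_nhds open_greaterThanLessThan by blast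
  then have "\<forall>\<^sub>F s in nhds t. (coord c \<circ> \<gamma>) s = (coord c \<circ> \<gamma>') s" for c :: "('m, 'n) chart"
    by eventually_elim (use assms in auto)
  then have "vector_derivative (coord c \<circ> \<gamma>) (at t) = vector_derivative (coord c \<circ> \<gamma>') (at t)" for c :: "('m, 'n) chart"
    by (intro vector_derivative_cong_eq) (auto elim: eventually_mono)
  then show "ennreal (speed A G \<gamma> t) = ennreal (speed A G \<gamma>' t)"
    using assms[of t] t by (simp add: speed_def)
qed simp

lemma join_length:
  assumes g1: "piecewise_C1_path A \<gamma>1" and g2: "piecewise_C1_path A \<gamma>2"
    and eq: "pathfinish \<gamma>1 = pathstart \<gamma>2"
  shows "piecewise_C1_path A (\<gamma>1 +++ \<gamma>2)"
    and "curve_length A G (\<gamma>1 +++ \<gamma>2) = curve_length A G \<gamma>1 + curve_length A G \<gamma>2"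
proof -
  let ?j = "\<gamma>1 +++ \<gamma>2"
  obtain S1 where p1: "path \<gamma>1" and S1: "finite S1"
    "\<And>c t. c \<in> A \<Longrightarrow> t \<in> {0<..<1} - S1 \<Longrightarrow> \<gamma>1 t \<in> cdom c \<Longrightarrow> C1_at (coord c \<circ> \<gamma>1) t"
    using piecewise_C1_pathE[OF g1] by blast
  obtain S2 where p2: "path \<gamma>2" and S2: "finite S2"
    "\<And>c t. c \<in> A \<Longrightarrow> t \<in> {0<..<1} - S2 \<Longrightarrow> \<gamma>2 t \<in> cdom c \<Longrightarrow> C1_at (coord c \<circ> \<gamma>2) t"
    using piecewise_C1_pathE[OF g2] by blast
  have pj: "path ?j" using p1 p2 eq by (rule path_join_imp)
  define S where "S = insert (1/2) ((\<lambda>t. 2 * t + 0) -` S1 \<union> (\<lambda>t. 2 * t + - 1) -` S2)"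
  have S: "finite S" unfolding S_def using S1(1) S2(1)
    by (auto intro!: finite_vimageI injI)
  have "C1_at (coord c \<circ> ?j) t" if c: "c \<in> A" and t: "t \<in> {0<..<1} - S" "?j t \<in> cdom c" for c t
  proof (cases "t < 1/2")
    case True
    have "C1_at (\<lambda>s. (\<lambda>r. coord c (\<gamma>1 r)) (2 * s + 0)) t"
      by (rule C1_at_affine) (use S1(2)[OF c, of "2 * t"] t True in \<open>auto simp: S_def joinpaths_def o_def\<close>)
    moreover have "\<forall>\<^sub>F s in nhds t. s \<in> {..<1/2}"
      using True eventually_nhds open_lessThan by blast
    then have "\<forall>\<^sub>F s in nhds t. (\<lambda>r. coord c (\<gamma>1 r)) (2 * s + 0) = (coord c \<circ> ?j) s"
      by eventually_elim (auto simp: joinpaths_def)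
    ultimately show ?thesis by (rule C1_at_cong)
  next
    case False
    then have gt: "t > 1/2" using t by (auto simp: S_def)
    have "C1_at (\<lambda>s. (\<lambda>r. coord c (\<gamma>2 r)) (2 * s + - 1)) t"
      by (rule C1_at_affine) (use S2(2)[OF c, of "2 * t - 1"] t gt in \<open>auto simp: S_def joinpaths_def o_def\<close>)
    moreover have "\<forall>\<^sub>F s in nhds t. s \<in> {1/2<..}"
      using gt eventually_nhds open_greaterThan by blast
    then have "\<forall>\<^sub>F s in nhds t. (\<lambda>r. coord c (\<gamma>2 r)) (2 * s + - 1) = (coord c \<circ> ?j) s"
      by eventually_elim (auto simp: joinpaths_def)
    ultimately show ?thesis by (rule C1_at_cong)
  qed
  then show j: "piecewise_C1_path A ?j"
    unfolding piecewise_C1_path_iff using pj S by blast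
  have eq': "\<gamma>1 1 = \<gamma>2 0" using eq by (simp add: pathfinish_def pathstart_def)
  have "curve_length A G \<gamma>1 = curve_length A G (subcurve 0 (1/2) ?j)"
    by (rule curve_length_cong) (auto simp: subcurve_def joinpaths_def)
  also have "\<dots> = (\<integral>\<^sup>+t\<in>{0..1/2}. ennreal (speed A G ?j t) \<partial>lborel)"
    using subcurve_length(2)[OF j, of 0 "1/2"] by simp
  finally have L1: "curve_length A G \<gamma>1 = \<dots>" .
  have "curve_length A G \<gamma>2 = curve_length A G (subcurve (1/2) 1 ?j)"
    by (rule curve_length_cong) (auto simp: subcurve_def joinpaths_def eq' field_simps)
  also have "\<dots> = (\<integral>\<^sup>+t\<in>{1/2..1}. ennreal (speed A G ?j t) \<partial>lborel)"
    using subcurve_length(2)[OF j, of "1/2" 1] by simp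
  finally have L2: "curve_length A G \<gamma>2 = \<dots>" .
  show "curve_length A G ?j = curve_length A G \<gamma>1 + curve_length A G \<gamma>2"
    unfolding L1 L2 using length_split[OF j, of "1/2"] by simp
qed


lemma segment_length:
  assumes c: "c \<in> A" and seg: "closed_segment x y \<subseteq> cimage c"
    and B: "\<And>z. z \<in> closed_segment x y \<Longrightarrow> gnorm c z (y - x) \<le> B"
  shows "piecewise_C1_path A (param c \<circ> linepath x y)"
    and "curve_length A G (param c \<circ> linepath x y) \<le> ennreal B"
proof -
  let ?l = "linepath x y" and ?\<gamma> = "param c \<circ> linepath x y"
  have in_seg: "?l t \<in> closed_segment x y" if "t \<in> {0..1}" for t
    using that by (metis image_eqI linepath_image_01)
  have in_im: "?l t \<in> cimage c" if "t \<in> {0..1}" for t using in_seg[OF that] seg by blast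
  have p: "path ?\<gamma>" unfolding path_def
    by (rule continuous_on_compose[OF continuous_on_linepath])
      (rule continuous_on_subset[OF continuous_on_param[OF c]], use in_im in auto)
  have ld: "(?l has_vector_derivative (y - x)) (at t)" for t
    by (rule has_vector_derivative_linepath_within)
  have C1: "C1_at (coord c' \<circ> ?\<gamma>) t" if c': "c' \<in> A" and t: "t \<in> {0<..<1}" "?\<gamma> t \<in> cdom c'" for c' t
  proof -
    let ?D = "\<lambda>x. frechet_derivative (transition c c') (at x)"
    let ?O = "cimage c \<inter> param c -` cdom c'"
    have o: "open ?O" by (rule open_overlap[OF c c'])
    have cl: "isCont ?l t" for t by (simp add: linepath_def)
    have lt: "?l t \<in> ?O" using t in_im[of t] by auto
    then have "\<forall>\<^sub>F s in nhds t. ?l s \<in> ?O"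
      using cl[of t, unfolded continuous_at_open, rule_format, of ?O] o unfolding eventually_nhds by blast
    then have "\<forall>\<^sub>F s in nhds t. ((coord c' \<circ> ?\<gamma>) has_vector_derivative ?D (?l s) (y - x)) (at s)"
    proof eventually_elim
      case (elim s)
      have D: "(transition c c' has_derivative ?D (?l s)) (at (?l s))"
        using transition_has_derivative[OF c c'] elim by simp
      have eq: "coord c' \<circ> ?\<gamma> = (\<lambda>s. transition c c' (?l s))" by (auto simp: transition_def)
      have "((\<lambda>s. transition c c' (?l s)) has_derivative (\<lambda>h. ?D (?l s) (h *\<^sub>R (y - x)))) (at s)"
        using has_derivative_compose[OF ld[unfolded has_vector_derivative_def] D] .
      then show ?case unfolding has_vector_derivative_def eq
        by (rule has_derivative_eq_rhs) (simp add: linear_scale[OF has_derivative_linear[OF D]])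
    qed
    moreover have "isCont (\<lambda>z. ?D z (y - x)) (?l t)"
      using transition_C1(2)[OF c c'] o lt continuous_on_eq_continuous_at by blast
    then have "isCont (\<lambda>s. ?D (?l s) (y - x)) t" by (rule isCont_o2[OF cl])
    ultimately show ?thesis unfolding C1_at_def by (intro exI conjI)
  qed
  then show "piecewise_C1_path A ?\<gamma>" unfolding piecewise_C1_path_iff using p by blast
  have "curve_length A G ?\<gamma> \<le> (\<integral>\<^sup>+t\<in>{0..1::real}. ennreal B \<partial>lborel)"
    unfolding curve_length_def
  proof (rule nn_integral_interval_finite_mono[of "{}"])
    fix t :: real assume "t \<in> {0<..<1} - {}"
    then have t: "t \<in> {0<..<1}" "t \<in> {0..1}" by auto
    have "\<forall>\<^sub>F s in nhds t. s \<in> {0<..<1}"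
      using eventually_nhds open_greaterThanLessThan t by blast
    then obtain T where T: "open T" "t \<in> T" "T \<subseteq> {0<..<1}"
      unfolding eventually_nhds by blast
    have "((coord c \<circ> ?\<gamma>) has_vector_derivative (y - x)) (at t)"
    proof (rule has_vector_derivative_transform_within_open[OF ld T(1,2)])
      fix s assume "s \<in> T" then have "?l s \<in> cimage c" using T(3) in_im[of s] by force
      then show "?l s = (coord c \<circ> ?\<gamma>) s" using c by simp
    qed
    then have "speed A G ?\<gamma> t = gnorm c (?l t) (y - x)"
      using speed_eq[OF c path_isCont[OF p t(1)]] in_im[OF t(2)] c by simp
    then show "ennreal (speed A G ?\<gamma> t) \<le> ennreal B" using B[OF in_seg[OF t(2)]] by (simp add: ennreal_leI)
  qed simp
  then show "curve_length A G ?\<gamma> \<le> ennreal B" by (simp add: nn_integral_cmult)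
qed

lemma coord_displacement_le_length:
  assumes c: "c \<in> A" and r: "cball x0 r \<subseteq> cimage c" and m: "m > 0"
    and lower: "\<And>x v. x \<in> cball x0 r \<Longrightarrow> m * norm v \<le> gnorm c x v"
    and g: "piecewise_C1_path A \<gamma>" "\<gamma> 0 = param c x0"
    and L: "curve_length A G \<gamma> = ennreal L" "L \<ge> 0"
    and \<tau>: "\<tau> \<in> {0..1}" and stay: "\<And>t. t \<in> {0..\<tau>} \<Longrightarrow> \<gamma> t \<in> param c ` ball x0 r"
  shows "m * norm (coord c (\<gamma> \<tau>) - x0) \<le> L"
proof -
  obtain S where p: "path \<gamma>" and S: "finite S"
    "\<And>c t. c \<in> A \<Longrightarrow> t \<in> {0<..<1} - S \<Longrightarrow> \<gamma> t \<in> cdom c \<Longrightarrow> C1_at (coord c \<circ> \<gamma>) t"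
    using piecewise_C1_pathE[OF g(1)] by blast
  define X where "X = coord c \<circ> \<gamma>"
  have dom: "\<gamma> t \<in> cdom c" "X t \<in> ball x0 r" if t: "t \<in> {0..\<tau>}" for t
    using stay[OF t] c r by (auto simp: X_def subset_eq)
  have x0: "x0 \<in> cball x0 r" using dom(2)[of 0] \<tau> by (auto intro: order_trans[OF zero_le_dist less_imp_le])
  have "\<gamma> 0 = param c x0" by (rule g)
  moreover have "x0 \<in> cimage c" using x0 r by blast
  ultimately have X0: "X 0 = x0" using c by (simp add: X_def)
  have cX: "continuous_on {0..\<tau>} X" unfolding X_def
    by (rule continuous_on_compose[OF continuous_on_subset[OF p[unfolded path_def]]
        continuous_on_subset[OF continuous_on_coord[OF c]]]) (use dom \<tau> in auto)
  define W where "W = {0<..<\<tau>} - S"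
  define D where "D = (\<lambda>t. vector_derivative X (at t))"
  have D: "(X has_vector_derivative D t) (at t)" and sp: "speed A G \<gamma> t = gnorm c (X t) (D t)" if t: "t \<in> W" for t
  proof -
    have t': "t \<in> {0<..<1}" "t \<in> {0<..<1} - S" "t \<in> {0..\<tau>}" using t \<tau> by (auto simp: W_def)
    obtain w where "(X has_vector_derivative w) (at t)"
      using C1_at_imp_has_vector_derivative S(2)[OF c t'(2) dom(1)[OF t'(3)]] unfolding X_def by metis
    then show *: "(X has_vector_derivative D t) (at t)"
      unfolding D_def by (metis vector_derivative_at)
    show "speed A G \<gamma> t = gnorm c (X t) (D t)"
      using speed_eq[OF c path_isCont[OF p t'(1)] dom(1)[OF t'(3)]] * unfolding X_def by simp
  qed
  have "(D has_integral (X \<tau> - X 0)) {0..\<tau>}"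
    by (rule fundamental_theorem_of_calculus_interior_strong[OF S(1)]) (use \<tau> cX D in \<open>auto simp: W_def\<close>)
  then have "((\<lambda>t. if t \<in> W then D t else 0) has_integral (X \<tau> - X 0)) {0..\<tau>}"
    by (rule has_integral_spike_finite[rotated 2, of _ _ _ "{0, \<tau>} \<union> S"]) (use S(1) in \<open>auto simp: W_def\<close>)
  then have "((\<lambda>t. if t \<in> {0..\<tau>} then if t \<in> W then D t else 0 else 0) has_integral (X \<tau> - X 0)) UNIV"
    by (simp only: has_integral_restrict_UNIV)
  moreover have "(\<lambda>t. if t \<in> {0..\<tau>} then if t \<in> W then D t else 0 else 0) = (\<lambda>t. if t \<in> W then D t else 0)"
    by (auto simp: W_def)
  ultimately have I1: "((\<lambda>t. if t \<in> W then D t else 0) has_integral (X \<tau> - X 0)) UNIV" by simp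
  define h where "h = (\<lambda>t. indicator W t * speed A G \<gamma> t)"
  have h_eq: "h = (\<lambda>t. indicator {0<..<\<tau>} t * (indicator ({0<..<1} - S) t * speed A G \<gamma> t))"
    using \<tau> by (auto simp: h_def W_def indicator_def fun_eq_iff)
  have hm: "h \<in> borel_measurable borel"
    unfolding h_eq by (rule borel_measurable_times[OF _ speed_measurable[OF p S]]) auto
  have "(\<integral>\<^sup>+t. ennreal (h t) \<partial>lborel) \<le> curve_length A G \<gamma>"
    unfolding curve_length_def using \<tau>
    by (intro nn_integral_mono) (auto simp: h_def W_def indicator_def)
  then have hL: "(\<integral>\<^sup>+t. ennreal (h t) \<partial>lborel) \<le> ennreal L" using L by simp
  then obtain L' where L': "(\<integral>\<^sup>+t. ennreal (h t) \<partial>lborel) = ennreal L'" "L' \<ge> 0"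
    by (cases "\<integral>\<^sup>+t. ennreal (h t) \<partial>lborel") (auto simp: top_unique)
  have I2: "(h has_integral L') UNIV"
    by (rule nn_integral_has_integral[OF hm _ L']) (simp add: h_def speed_nonneg)
  have "norm (integral UNIV (\<lambda>t. if t \<in> W then D t else 0)) \<le> integral UNIV (\<lambda>t. inverse m * h t)"
  proof (rule Henstock_Kurzweil_Integration.integral_norm_bound_integral)
    show "(\<lambda>t. if t \<in> W then D t else 0) integrable_on UNIV" using I1 by blast
    show "(\<lambda>t. inverse m * h t) integrable_on UNIV" using has_integral_mult_right[OF I2] by blast
    show "norm (if t \<in> W then D t else 0) \<le> inverse m * h t" for t
    proof (cases "t \<in> W")
      case True
      then have "m * norm (D t) \<le> h t" using sp lower[of "X t" "D t"] dom(2)[of t] by (auto simp: h_def W_def)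
      then show ?thesis using True m by (simp add: field_simps)
    qed (simp add: h_def)
  qed
  then have "norm (X \<tau> - X 0) \<le> inverse m * L'"
    unfolding integral_unique[OF I1] integral_unique[OF has_integral_mult_right[OF I2]] .
  then have "m * norm (X \<tau> - X 0) \<le> L'" using m by (simp add: field_simps)
  also have "L' \<le> L" using hL L' L(2) by simp
  finally show ?thesis using X0 by (simp add: X_def)
qed

lemma short_curve_stays:
  assumes c: "c \<in> A" and r: "r > 0" "cball x0 r \<subseteq> cimage c" and m: "m > 0"
    and lower: "\<And>x v. x \<in> cball x0 r \<Longrightarrow> m * norm v \<le> gnorm c x v"
    and g: "piecewise_C1_path A \<gamma>" "\<gamma> 0 = param c x0"
    and L: "curve_length A G \<gamma> = ennreal L" "L \<ge> 0" "L < m * r"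
  shows "\<gamma> 1 \<in> param c ` ball x0 r" and "m * norm (coord c (\<gamma> 1) - x0) \<le> L"
proof -
  have br: "ball x0 r \<subseteq> cimage c" using r(2) ball_subset_cball by blast
  let ?N = "param c ` ball x0 r"
  have N: "open ?N" by (rule open_param_image[OF c open_ball br])
  have p: "continuous_on {0..1} \<gamma>" using piecewise_C1_path_imp_path[OF g(1)] by (simp add: path_def)
  have le: "m * norm (coord c (\<gamma> \<tau>) - x0) \<le> L"
    if "\<tau> \<in> {0..1}" "\<And>t. t \<in> {0..\<tau>} \<Longrightarrow> \<gamma> t \<in> ?N" for \<tau>
    by (rule coord_displacement_le_length[OF c r(2) m lower g L(1,2) that])
  have all: "\<gamma> t \<in> ?N" if "t \<in> {0..1}" for t
  proof (rule ccontr)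
    assume "\<gamma> t \<notin> ?N"
    define Z where "Z = {0..1} \<inter> \<gamma> -` (- ?N)"
    have "closed Z" unfolding Z_def
      by (rule continuous_closed_preimage[OF p]) (use N in auto)
    then have cZ: "compact Z" using compact_Int_closed[of "{0..1}" Z] by (simp add: Z_def Int_absorb1)
    have neZ: "Z \<noteq> {}" using \<open>\<gamma> t \<notin> ?N\<close> that by (auto simp: Z_def)
    from compact_attains_inf[OF cZ neZ]
    obtain T where T: "T \<in> Z" "\<And>s. s \<in> Z \<Longrightarrow> T \<le> s" by blast
    have T01: "T \<in> {0..1}" "\<gamma> T \<notin> ?N" using T(1) by (auto simp: Z_def)
    have before: "\<gamma> s \<in> ?N" if "0 \<le> s" "s < T" for s
      using T(2)[of s] that T01 by (auto simp: Z_def)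
    have "\<gamma> 0 \<in> ?N" using g(2) r(1) by simp
    then have "T > 0" using T01 by (cases "T = 0") auto
    let ?C = "param c ` cball x0 (L / m)"
    have Lr: "L / m < r" using L(3) m by (simp add: field_simps)
    have sub: "cball x0 (L / m) \<subseteq> ball x0 r" using Lr by (auto simp: dist_commute)
    then have cs: "cball x0 (L / m) \<subseteq> cimage c" using br by blast
    have "compact ?C"
      by (rule compact_continuous_image[OF continuous_on_subset[OF continuous_on_param[OF c] cs] compact_cball])
    then have "closed ({0..T} \<inter> \<gamma> -` ?C)"
      by (intro continuous_closed_preimage continuous_on_subset[OF p] compact_imp_closed) (use T01 in auto)
    moreover have "{0<..<T} \<subseteq> {0..T} \<inter> \<gamma> -` ?C"
    proof
      fix s assume s: "s \<in> {0<..<T}"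
      have "m * norm (coord c (\<gamma> s) - x0) \<le> L" by (rule le) (use s T01 before in auto)
      then have "coord c (\<gamma> s) \<in> cball x0 (L / m)"
        using m by (simp add: dist_norm norm_minus_commute field_simps)
      moreover have "\<gamma> s \<in> cdom c" using before[of s] s br c by auto
      ultimately have "\<gamma> s \<in> ?C" using c by (metis image_eqI param_coord)
      then show "s \<in> {0..T} \<inter> \<gamma> -` ?C" using s by auto
    qed
    ultimately have "closure {0<..<T} \<subseteq> {0..T} \<inter> \<gamma> -` ?C" by (rule closure_minimal[rotated])
    moreover have "T \<in> closure {0<..<T}" using \<open>T > 0\<close> by simp
    ultimately have "\<gamma> T \<in> ?C" by blast
    then show False using T01(2) sub by auto
  qed
  show "\<gamma> 1 \<in> ?N" using all by simp
  show "m * norm (coord c (\<gamma> 1) - x0) \<le> L" by (rule le) (use all in auto)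
qed

lemma chart_ball_bounds:
  assumes c: "c \<in> A" and U: "open U" "x0 \<in> U" "U \<subseteq> cimage c"
  obtains r m M where "r > 0" "m > 0" "M > 0" "cball x0 r \<subseteq> U"
    "\<And>x v. x \<in> cball x0 r \<Longrightarrow> m * norm v \<le> gnorm c x v"
    "\<And>x v. x \<in> cball x0 r \<Longrightarrow> gnorm c x v \<le> M * norm v"
proof -
  obtain r where r: "r > 0" "cball x0 r \<subseteq> U" using U open_contains_cball by blast
  let ?K = "cball x0 r \<times> sphere (0::real^'n) 1"
  have comp: "compact ?K" by (intro compact_Times) auto
  have "\<exists>b::real^'n. norm b = 1" using norm_axis_1 by blast
  then have ne: "?K \<noteq> {}" using r(1) by (auto simp: sphere_def)
  have cont: "continuous_on ?K (\<lambda>z. gnorm c (fst z) (snd z))"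
    by (rule continuous_on_gnorm[OF c]) (use r U in \<open>auto intro!: continuous_intros\<close>)
  obtain z1 where z1: "z1 \<in> ?K" "\<And>z. z \<in> ?K \<Longrightarrow> gnorm c (fst z1) (snd z1) \<le> gnorm c (fst z) (snd z)"
    using continuous_attains_inf[OF comp ne cont] by blast
  obtain z2 where z2: "z2 \<in> ?K" "\<And>z. z \<in> ?K \<Longrightarrow> gnorm c (fst z) (snd z) \<le> gnorm c (fst z2) (snd z2)"
    using continuous_attains_sup[OF comp ne cont] by blast
  let ?m = "gnorm c (fst z1) (snd z1)" and ?M = "gnorm c (fst z2) (snd z2)"
  have pos: "gnorm c (fst z) (snd z) > 0" if "z \<in> ?K" for z
  proof (rule gnorm_pos[OF c])
    show "fst z \<in> cimage c" using that r(2) U(3) by auto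
    show "snd z \<noteq> 0" using that by auto
  qed
  have unit: "gnorm c x v = norm v * gnorm c x (v /\<^sub>R norm v)" if "v \<noteq> 0" for x v
    using gnorm_scale[of c x "norm v" "v /\<^sub>R norm v"] that by simp
  have 0: "gnorm c x 0 = 0" for x by (simp add: gnorm_def)
  show thesis
  proof (rule that[of r ?m ?M])
    fix x v assume x: "x \<in> cball x0 r"
    show "?m * norm v \<le> gnorm c x v"
    proof (cases "v = 0")
      case False
      then have "(x, v /\<^sub>R norm v) \<in> ?K" using x by simp
      from z1(2)[OF this] show ?thesis using unit[OF False, of x] by (simp add: mult.commute mult_left_mono)
    qed (simp add: 0)
    show "gnorm c x v \<le> ?M * norm v"
    proof (cases "v = 0")
      case False
      then have "(x, v /\<^sub>R norm v) \<in> ?K" using x by simp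
      from z2(2)[OF this] show ?thesis using unit[OF False, of x] by (simp add: mult.commute mult_left_mono)
    qed (simp add: 0)
  qed (use r pos[OF z1(1)] pos[OF z2(1)] in auto)
qed

section \<open>The Riemannian distance and the Hopf--Rinow theorem\<close>


definition joins :: "'m \<Rightarrow> 'm \<Rightarrow> (real \<Rightarrow> 'm) \<Rightarrow> bool" where
  "joins a b \<gamma> \<longleftrightarrow> piecewise_C1_path A \<gamma> \<and> pathstart \<gamma> = a \<and> pathfinish \<gamma> = b"

lemma joins_segment:
  assumes c: "c \<in> A" and seg: "closed_segment x y \<subseteq> cimage c"
    and B: "\<And>z. z \<in> closed_segment x y \<Longrightarrow> gnorm c z (y - x) \<le> B"
  obtains \<gamma> where "joins (param c x) (param c y) \<gamma>" "curve_length A G \<gamma> \<le> ennreal B"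
  using segment_length[OF c seg B]
  by (intro that[of "param c \<circ> linepath x y"])
    (auto simp: joins_def pathstart_def pathfinish_def linepath_def)

lemma joins_sym:
  assumes "joins a b \<gamma>" obtains \<gamma>' where "joins b a \<gamma>'" "curve_length A G \<gamma>' = curve_length A G \<gamma>"
proof (rule that[of "subcurve 1 0 \<gamma>"])
  have g: "piecewise_C1_path A \<gamma>" using assms by (simp add: joins_def)
  show "joins b a (subcurve 1 0 \<gamma>)"
    using subcurve_length(1)[OF g, of 1 0] assms
    by (simp add: joins_def pathstart_def pathfinish_def subcurve_def)
  show "curve_length A G (subcurve 1 0 \<gamma>) = curve_length A G \<gamma>"
    using subcurve_length(2)[OF g, of 1 0] by (simp add: curve_length_def)
qed

lemma joins_trans:
  assumes "joins a b \<gamma>1" "joins b c \<gamma>2"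
  obtains \<gamma> where "joins a c \<gamma>" "curve_length A G \<gamma> = curve_length A G \<gamma>1 + curve_length A G \<gamma>2"
  using assms join_length[of \<gamma>1 \<gamma>2] by (intro that[of "\<gamma>1 +++ \<gamma>2"]) (auto simp: joins_def)

lemma ex_finite_curve: "\<exists>\<gamma>. joins a b \<gamma> \<and> curve_length A G \<gamma> < top"
proof -
  define R where "R = {b. \<exists>\<gamma>. joins a b \<gamma> \<and> curve_length A G \<gamma> < top}"
  have nbhd: "\<exists>N. open N \<and> q \<in> N \<and> (\<forall>b\<in>N. \<exists>\<gamma>. joins q b \<gamma> \<and> curve_length A G \<gamma> < top)" for q
  proof -
    let ?c = "chart_at A q" let ?x = "coord (chart_at A q) q"
    have c: "?c \<in> A" and q: "q \<in> cdom ?c" by (rule chart_at)+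
    have x: "?x \<in> cimage ?c" using c q by simp
    obtain r m M where r: "r > 0" "m > 0" "M > 0" "cball ?x r \<subseteq> cimage ?c"
      "\<And>x v. x \<in> cball ?x r \<Longrightarrow> m * norm v \<le> gnorm ?c x v"
      "\<And>x v. x \<in> cball ?x r \<Longrightarrow> gnorm ?c x v \<le> M * norm v"
      by (rule chart_ball_bounds[OF c open_cimage[OF c] x order_refl]) (rule that)
    have "\<exists>\<gamma>. joins q b \<gamma> \<and> curve_length A G \<gamma> < top" if b: "b \<in> param ?c ` ball ?x r" for b
    proof -
      obtain y where y: "y \<in> ball ?x r" "b = param ?c y" using b by blast
      have seg: "closed_segment ?x y \<subseteq> cball ?x r"
        using y r(1) by (intro closed_segment_subset) auto
      obtain \<gamma> where "joins (param ?c ?x) (param ?c y) \<gamma>" "curve_length A G \<gamma> \<le> ennreal (M * norm (y - ?x))"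
        using joins_segment[OF c, of ?x y "M * norm (y - ?x)"] seg r(4,6) by blast
      then show ?thesis using c q y le_less_trans ennreal_less_top by (metis param_coord)
    qed
    moreover have "open (param ?c ` ball ?x r)"
      by (rule open_param_image[OF c open_ball]) (use r(4) ball_subset_cball in blast)
    moreover have "q \<in> param ?c ` ball ?x r"
      using r(1) c q by (intro image_eqI[of _ _ ?x]) auto
    ultimately show ?thesis by blast
  qed
  have step1: "y \<in> R" if h: "x \<in> R" "joins x y \<gamma>" "curve_length A G \<gamma> < top" for x y \<gamma>
  proof -
    obtain \<gamma>0 where 0: "joins a x \<gamma>0" "curve_length A G \<gamma>0 < top" using h(1) by (auto simp: R_def)
    obtain \<gamma>' where "joins a y \<gamma>'" "curve_length A G \<gamma>' = curve_length A G \<gamma>0 + curve_length A G \<gamma>"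
      by (rule joins_trans[OF 0(1) h(2)])
    then show ?thesis unfolding R_def using 0(2) h(3) by auto
  qed
  have step: "x \<in> R \<longleftrightarrow> y \<in> R" if g: "joins x y \<gamma>" "curve_length A G \<gamma> < top" for x y \<gamma>
  proof -
    obtain \<gamma>' where "joins y x \<gamma>'" "curve_length A G \<gamma>' = curve_length A G \<gamma>"
      by (rule joins_sym[OF g(1)])
    then show ?thesis using step1 g by metis
  qed
  have same: "\<exists>N. open N \<and> q \<in> N \<and> (\<forall>b\<in>N. b \<in> R \<longleftrightarrow> q \<in> R)" for q
  proof -
    obtain N where N: "open N" "q \<in> N" "\<forall>b\<in>N. \<exists>\<gamma>. joins q b \<gamma> \<and> curve_length A G \<gamma> < top"
      using nbhd[of q] by blast
    have "b \<in> R \<longleftrightarrow> q \<in> R" if "b \<in> N" for b using N(3) that step by blast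
    then show ?thesis using N(1,2) by blast
  qed
  have "open R"
  proof (subst open_subopen, intro ballI)
    fix q assume "q \<in> R"
    then show "\<exists>T. open T \<and> q \<in> T \<and> T \<subseteq> R" using same[of q] by blast
  qed
  moreover have "open (- R)"
  proof (subst open_subopen, intro ballI)
    fix q assume "q \<in> - R"
    then show "\<exists>T. open T \<and> q \<in> T \<and> T \<subseteq> - R" using same[of q] by blast
  qed
  moreover have "a \<in> R"
  proof -
    obtain N where "a \<in> N" "\<forall>b\<in>N. \<exists>\<gamma>. joins a b \<gamma> \<and> curve_length A G \<gamma> < top" using nbhd by blast
    then show ?thesis by (auto simp: R_def)
  qed
  ultimately have "- R = {}" using connectedD[OF connected_UNIV, of R "- R"] by auto
  then show ?thesis unfolding R_def by auto
qed

abbreviation d :: "'m \<Rightarrow> 'm \<Rightarrow> real" where "d \<equiv> riem_dist A G"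

lemma riem_dist_less_iff: "d a b < e \<longleftrightarrow> (\<exists>\<gamma>. joins a b \<gamma> \<and> curve_length A G \<gamma> < ennreal e)"
proof -
  let ?I = "INF \<gamma>\<in>{\<gamma>. joins a b \<gamma>}. curve_length A G \<gamma>"
  have I: "?I < top" using ex_finite_curve[of a b] by (auto simp: INF_less_iff)
  then obtain i where i: "?I = ennreal i" "i \<ge> 0" by (cases ?I) auto
  have "d a b = enn2real ?I" unfolding riem_dist_def joins_def by simp
  then have "d a b < e \<longleftrightarrow> ?I < ennreal e" using i by (simp add: ennreal_less_iff)
  then show ?thesis by (auto simp: INF_less_iff)
qed

lemma riem_dist_le:
  assumes "joins a b \<gamma>" "curve_length A G \<gamma> \<le> ennreal B" "B \<ge> 0"
  shows "d a b \<le> B"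
proof (rule field_le_epsilon)
  fix e :: real assume "e > 0"
  then have "ennreal B < ennreal (B + e)" using assms(3) by (simp add: ennreal_less_iff)
  then have "d a b < B + e" unfolding riem_dist_less_iff using assms(1,2) le_less_trans by blast
  then show "d a b \<le> B + e" by simp
qed

lemma riem_dist_nonneg: "0 \<le> d a b"
  by (simp add: riem_dist_def)

lemma dist_segment_le:
  assumes c: "c \<in> A" and seg: "closed_segment x y \<subseteq> cimage c"
    and B: "\<And>z. z \<in> closed_segment x y \<Longrightarrow> gnorm c z (y - x) \<le> B"
  shows "d (param c x) (param c y) \<le> B"
proof -
  have "x \<in> cimage c" using seg by auto
  then have "B \<ge> 0" using gnorm_nonneg[OF c, of x "y - x"] B[of x] by simp
  then show ?thesis using joins_segment[OF c seg B] riem_dist_le by metis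
qed

lemma riem_dist_commute: "d a b = d b a"
proof -
  have "d a b < e \<Longrightarrow> d b a < e" for a b e
    unfolding riem_dist_less_iff by (metis joins_sym)
  then show ?thesis by (metis linorder_neqE_linordered_idom order_less_irrefl)
qed

lemma riem_dist_triangle: "d a c \<le> d a b + d b c"
proof (rule field_le_epsilon)
  fix e :: real assume "e > 0"
  then have "d a b < d a b + e/2" "d b c < d b c + e/2" by auto
  then obtain \<gamma>1 \<gamma>2 where g: "joins a b \<gamma>1" "curve_length A G \<gamma>1 < ennreal (d a b + e/2)"
    "joins b c \<gamma>2" "curve_length A G \<gamma>2 < ennreal (d b c + e/2)"
    unfolding riem_dist_less_iff by blast
  obtain \<gamma> where \<gamma>: "joins a c \<gamma>" "curve_length A G \<gamma> = curve_length A G \<gamma>1 + curve_length A G \<gamma>2"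
    by (rule joins_trans[OF g(1,3)])
  have "curve_length A G \<gamma> \<le> ennreal (d a b + e/2) + ennreal (d b c + e/2)"
    unfolding \<gamma>(2) using g by (intro add_mono) auto
  also have "\<dots> = ennreal (d a b + d b c + e)"
    using \<open>e > 0\<close> riem_dist_nonneg by (subst ennreal_plus[symmetric]) (auto simp: add_nonneg_nonneg intro!: arg_cong[where f = ennreal])
  finally show "d a c \<le> d a b + d b c + e"
    using \<gamma>(1) riem_dist_nonneg[of a b] riem_dist_nonneg[of b c] \<open>e > 0\<close> by (intro riem_dist_le[of a c \<gamma>]) auto
qed

lemma riem_dist_self: "d a a = 0"
proof -
  let ?c = "chart_at A a" let ?x = "coord ?c a"
  have c: "?c \<in> A" "a \<in> cdom ?c" by (rule chart_at)+
  have "d (param ?c ?x) (param ?c ?x) \<le> 0"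
    by (rule dist_segment_le[OF c(1)]) (use c in \<open>auto simp: gnorm_def\<close>)
  then show ?thesis using c riem_dist_nonneg[of a a] by simp
qed

lemma chart_dist_bounds:
  assumes c: "c \<in> A" and a: "a \<in> cdom c" and U: "open U" "a \<in> U"
  obtains r m M where "r > 0" "m > 0" "M > 0" "cball (coord c a) r \<subseteq> cimage c"
    "param c ` cball (coord c a) r \<subseteq> U"
    "\<And>y. y \<in> ball (coord c a) r \<Longrightarrow> d a (param c y) \<le> M * norm (y - coord c a)"
    "\<And>b. d a b < m * r \<Longrightarrow> b \<in> param c ` ball (coord c a) r \<and> m * norm (coord c b - coord c a) \<le> d a b"
proof -
  let ?x = "coord c a"
  have "open (cimage c \<inter> param c -` U)"
    using continuous_open_preimage[OF continuous_on_param[OF c] open_cimage[OF c] U(1)] .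
  moreover have "?x \<in> cimage c \<inter> param c -` U" using c a U by simp
  moreover have "cimage c \<inter> param c -` U \<subseteq> cimage c" by blast
  ultimately obtain r m M where r: "r > 0" "m > 0" "M > 0" "cball ?x r \<subseteq> cimage c \<inter> param c -` U"
    and lower: "\<And>x v. x \<in> cball ?x r \<Longrightarrow> m * norm v \<le> gnorm c x v"
    and upper: "\<And>x v. x \<in> cball ?x r \<Longrightarrow> gnorm c x v \<le> M * norm v"
    using chart_ball_bounds[OF c] by metis
  have im: "cball ?x r \<subseteq> cimage c" using r by blast
  show thesis
  proof (rule that[OF r(1-3) im])
    show "param c ` cball ?x r \<subseteq> U" using r by blast
    show "d a (param c y) \<le> M * norm (y - ?x)" if y: "y \<in> ball ?x r" for y
    proof -
      have seg: "closed_segment ?x y \<subseteq> cball ?x r" using y r(1) by (intro closed_segment_subset) auto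
      have "d (param c ?x) (param c y) \<le> M * norm (y - ?x)"
        by (rule dist_segment_le[OF c]) (use seg im upper in auto)
      then show ?thesis using c a by simp
    qed
    fix b assume b: "d a b < m * r"
    have *: "b \<in> param c ` ball ?x r \<and> m * norm (coord c b - ?x) \<le> e" if e: "d a b < e" "e < m * r" for e
    proof -
      obtain \<gamma> where g: "joins a b \<gamma>" "curve_length A G \<gamma> < ennreal e"
        using e(1) unfolding riem_dist_less_iff by blast
      then obtain L where L: "curve_length A G \<gamma> = ennreal L" "L \<ge> 0"
        by (cases "curve_length A G \<gamma>") auto
      have Le: "L < e" using g(2) L by (simp add: ennreal_less_iff)
      have g': "piecewise_C1_path A \<gamma>" "\<gamma> 0 = param c ?x" "\<gamma> 1 = b"
        using g(1) c a by (auto simp: joins_def pathstart_def pathfinish_def)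
      have "\<gamma> 1 \<in> param c ` ball ?x r" "m * norm (coord c (\<gamma> 1) - ?x) \<le> L"
        using short_curve_stays[OF c r(1) im r(2) lower g'(1,2) L] Le e by auto
      then show ?thesis using Le g'(3) by auto
    qed
    have "m * norm (coord c b - ?x) \<le> d a b"
    proof (rule dense_ge)
      fix e assume "d a b < e"
      then show "m * norm (coord c b - ?x) \<le> e"
        using *[of e] *[of "(d a b + m * r) / 2"] b by (cases "e < m * r") auto
    qed
    then show "b \<in> param c ` ball ?x r \<and> m * norm (coord c b - ?x) \<le> d a b"
      using *[of "(d a b + m * r) / 2"] b by auto
  qed
qed

lemma riem_dist_eq_0_iff: "d a b = 0 \<longleftrightarrow> a = b"
proof
  assume ab: "d a b = 0"
  let ?c = "chart_at A a"
  have c: "?c \<in> A" "a \<in> cdom ?c" by (rule chart_at)+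
  obtain r m M where r: "r > 0" "m > 0" "M > 0" "cball (coord ?c a) r \<subseteq> cimage ?c"
    and rU: "param ?c ` cball (coord ?c a) r \<subseteq> UNIV"
    and upper: "\<And>y. y \<in> ball (coord ?c a) r \<Longrightarrow> d a (param ?c y) \<le> M * norm (y - coord ?c a)"
    and lower: "\<And>b. d a b < m * r \<Longrightarrow> b \<in> param ?c ` ball (coord ?c a) r \<and> m * norm (coord ?c b - coord ?c a) \<le> d a b"
    by (rule chart_dist_bounds[OF c open_UNIV UNIV_I]) (rule that)
  then have "b \<in> param ?c ` ball (coord ?c a) r" "m * norm (coord ?c b - coord ?c a) \<le> 0"
    using ab lower[of b] r by auto
  then have "coord ?c b = coord ?c a" "b \<in> cdom ?c"
    using r c by (auto simp: mult_le_0_iff subset_eq)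
  then show "a = b" using c by (metis param_coord)
qed (simp add: riem_dist_self)

sublocale Metric_space UNIV d
  by unfold_locales (auto simp: riem_dist_nonneg riem_dist_commute riem_dist_eq_0_iff riem_dist_triangle)

lemma mball_nbhd:
  assumes U: "open U" "a \<in> U" shows "\<exists>e>0. mball a e \<subseteq> U"
proof -
  let ?c = "chart_at A a"
  have c: "?c \<in> A" "a \<in> cdom ?c" by (rule chart_at)+
  obtain r m M where r: "r > 0" "m > 0" "M > 0" "cball (coord ?c a) r \<subseteq> cimage ?c"
    and rU: "param ?c ` cball (coord ?c a) r \<subseteq> U"
    and upper: "\<And>y. y \<in> ball (coord ?c a) r \<Longrightarrow> d a (param ?c y) \<le> M * norm (y - coord ?c a)"
    and lower: "\<And>b. d a b < m * r \<Longrightarrow> b \<in> param ?c ` ball (coord ?c a) r \<and> m * norm (coord ?c b - coord ?c a) \<le> d a b"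
    by (rule chart_dist_bounds[OF c U]) (rule that)
  have "mball a (m * r) \<subseteq> U"
  proof
    fix b assume "b \<in> mball a (m * r)"
    then have "b \<in> param ?c ` ball (coord ?c a) r" using lower by simp
    then show "b \<in> U" using rU ball_subset_cball by blast
  qed
  then show ?thesis using r by (intro exI[of _ "m * r"]) simp
qed

lemma nbhd_mball:
  assumes "e > 0" shows "\<exists>N. open N \<and> a \<in> N \<and> N \<subseteq> mball a e"
proof -
  let ?c = "chart_at A a" let ?x = "coord (chart_at A a) a"
  have c: "?c \<in> A" "a \<in> cdom ?c" by (rule chart_at)+
  obtain r m M where r: "r > 0" "m > 0" "M > 0" "cball (coord ?c a) r \<subseteq> cimage ?c"
    and rU: "param ?c ` cball (coord ?c a) r \<subseteq> UNIV"
    and upper: "\<And>y. y \<in> ball (coord ?c a) r \<Longrightarrow> d a (param ?c y) \<le> M * norm (y - coord ?c a)"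
    and lower: "\<And>b. d a b < m * r \<Longrightarrow> b \<in> param ?c ` ball (coord ?c a) r \<and> m * norm (coord ?c b - coord ?c a) \<le> d a b"
    by (rule chart_dist_bounds[OF c open_UNIV UNIV_I]) (rule that)
  define s where "s = min r (e / M)"
  have s: "s > 0" "ball ?x s \<subseteq> ball ?x r" "s \<le> e / M" using r assms by (auto simp: s_def)
  have "param ?c ` ball ?x s \<subseteq> mball a e"
  proof clarify
    fix y assume y: "y \<in> ball ?x s"
    then have "d a (param ?c y) \<le> M * norm (y - ?x)" using s upper by blast
    also have "\<dots> < M * s" using y r(3) by (simp add: dist_norm norm_minus_commute)
    also have "\<dots> \<le> e" using s(3) r(3) by (simp add: field_simps)
    finally show "param ?c y \<in> mball a e" by simp
  qed
  moreover have "open (param ?c ` ball ?x s)"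
    by (rule open_param_image[OF c(1) open_ball]) (use r(4) s(2) ball_subset_cball in blast)
  moreover have "a \<in> param ?c ` ball ?x s" using s(1) c by (intro image_eqI[of _ _ ?x]) auto
  ultimately show ?thesis by blast
qed

lemma mtopology_eq_euclidean: "mtopology = euclidean"
proof (subst topology_eq, rule allI)
  fix U :: "'m set"
  have "(\<forall>x. x \<in> U \<longrightarrow> (\<exists>r>0. mball x r \<subseteq> U)) \<longleftrightarrow> open U"
  proof
    assume *: "\<forall>x. x \<in> U \<longrightarrow> (\<exists>r>0. mball x r \<subseteq> U)"
    have "\<exists>T. open T \<and> x \<in> T \<and> T \<subseteq> U" if "x \<in> U" for x
      using * that nbhd_mball by (meson subset_trans)
    then show "open U" by (subst open_subopen) blast
  qed (use mball_nbhd in blast)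
  then show "openin mtopology U = openin euclidean U" by (simp add: openin_mtopology)
qed

lemma open_mball: "open (mball a e)"
  using openin_mball[of a e] by (simp add: mtopology_eq_euclidean)

lemma continuous_on_dist: "continuous_on S (d a)"
proof -
  have "open (d a -` B)" if B: "open B" for B
  proof (subst open_subopen, intro ballI)
    fix x assume "x \<in> d a -` B"
    then obtain e where e: "e > 0" "ball (d a x) e \<subseteq> B" using B by (meson open_contains_ball vimageE)
    have "mball x e \<subseteq> d a -` B"
    proof
      fix y assume "y \<in> mball x e"
      then have "\<bar>d a x - d a y\<bar> < e"
        using riem_dist_triangle[of a y x] riem_dist_triangle[of a x y] riem_dist_commute[of x y] by simp
      then show "y \<in> d a -` B" using e(2) by (auto simp: dist_real_def)
    qed
    then show "\<exists>T. open T \<and> x \<in> T \<and> T \<subseteq> d a -` B"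
      using open_mball[of x e] e(1) by (intro exI[of _ "mball x e"]) auto
  qed
  then have "continuous_on UNIV (d a)" by (simp add: continuous_on_open_vimage)
  then show ?thesis by (rule continuous_on_subset) simp
qed

lemma ex_intermediate_point:
  assumes ab: "d a b < r1 + r2" and r: "r1 > 0" "r2 > 0"
  shows "\<exists>z. d a z < r1 \<and> d z b < r2"
proof (cases "d a b < r1")
  case True
  then show ?thesis using r riem_dist_self by (intro exI[of _ b]) simp
next
  case False
  obtain \<gamma> where g: "joins a b \<gamma>" "curve_length A G \<gamma> < ennreal (r1 + r2)"
    using ab unfolding riem_dist_less_iff by blast
  then have p: "piecewise_C1_path A \<gamma>" "\<gamma> 0 = a" "\<gamma> 1 = b"
    by (auto simp: joins_def pathstart_def pathfinish_def)
  define len where "len = (\<lambda>u v. \<integral>\<^sup>+t\<in>{u..v}. ennreal (speed A G \<gamma> t) \<partial>lborel)"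
  obtain L where L: "curve_length A G \<gamma> = ennreal L" "L \<ge> 0" "L < r1 + r2"
    using g(2) by (cases "curve_length A G \<gamma>") (auto simp: ennreal_less_iff)
  define s where "s = (max 0 (L - r2) + r1) / 2"
  have s: "s < r1" "s > L - r2" "s > 0" unfolding s_def using L r by (auto simp: max_def)
  have "continuous_on {0..1} (\<lambda>t. d a (\<gamma> t))"
    using continuous_on_compose2[OF continuous_on_dist[of UNIV a], of "{0..1}" \<gamma>]
      piecewise_C1_path_imp_path[OF p(1)] by (simp add: path_def)
  then have "\<exists>t\<ge>0. t \<le> 1 \<and> d a (\<gamma> t) = s"
    using p s False riem_dist_self by (intro IVT') auto
  then obtain t where t: "0 \<le> t" "t \<le> 1" "d a (\<gamma> t) = s" by blast
  have "t \<noteq> 0" using t p s riem_dist_self by auto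
  have "t \<noteq> 1" using t p s False by auto
  have j1: "joins a (\<gamma> t) (subcurve 0 t \<gamma>)" "curve_length A G (subcurve 0 t \<gamma>) = len 0 t"
    using subcurve_length[OF p(1), of 0 t] t p \<open>t \<noteq> 0\<close>
    by (auto simp: joins_def pathstart_def pathfinish_def subcurve_def len_def)
  have j2: "joins (\<gamma> t) b (subcurve t 1 \<gamma>)" "curve_length A G (subcurve t 1 \<gamma>) = len t 1"
    using subcurve_length[OF p(1), of t 1] t p \<open>t \<noteq> 1\<close>
    by (auto simp: joins_def pathstart_def pathfinish_def subcurve_def len_def)
  have sum: "ennreal L = len 0 t + len t 1"
    using length_split[OF p(1), of t] t L(1) by (simp add: len_def)
  obtain l1 where l1: "len 0 t = ennreal l1" "l1 \<ge> 0" using sum by (cases "len 0 t") auto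
  obtain l2 where l2: "len t 1 = ennreal l2" "l2 \<ge> 0" using sum by (cases "len t 1") auto
  have "L = l1 + l2"
    using sum l1 l2 L(2) by (simp add: ennreal_plus[symmetric] del: ennreal_plus)
  moreover have "s \<le> l1" using riem_dist_le[OF j1(1), of l1] j1(2) l1 t(3) by simp
  moreover have "d (\<gamma> t) b \<le> l2" using riem_dist_le[OF j2(1), of l2] j2(2) l2 by simp
  ultimately show ?thesis using t(3) s by (intro exI[of _ "\<gamma> t"]) linarith
qed

lemma locally_totally_bounded: "\<exists>e>0. mtotally_bounded (mball a e)"
proof -
  let ?c = "chart_at A a"
  have c: "?c \<in> A" "a \<in> cdom ?c" by (rule chart_at)+
  obtain r m M where r: "r > 0" "m > 0" "M > 0" "cball (coord ?c a) r \<subseteq> cimage ?c"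
    and rU: "param ?c ` cball (coord ?c a) r \<subseteq> UNIV"
    and upper: "\<And>y. y \<in> ball (coord ?c a) r \<Longrightarrow> d a (param ?c y) \<le> M * norm (y - coord ?c a)"
    and lower: "\<And>b. d a b < m * r \<Longrightarrow> b \<in> param ?c ` ball (coord ?c a) r \<and> m * norm (coord ?c b - coord ?c a) \<le> d a b"
    by (rule chart_dist_bounds[OF c open_UNIV UNIV_I]) (rule that)
  have "compact (param ?c ` cball (coord ?c a) r)"
    by (rule compact_continuous_image[OF continuous_on_subset[OF continuous_on_param[OF c(1)] r(4)] compact_cball])
  then have "mtotally_bounded (param ?c ` cball (coord ?c a) r)"
    by (intro compactin_imp_mtotally_bounded) (simp add: mtopology_eq_euclidean)
  moreover have "mball a (m * r) \<subseteq> param ?c ` cball (coord ?c a) r"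
    using lower ball_subset_cball[of "coord ?c a" r] by fastforce
  ultimately have "mtotally_bounded (mball a (m * r))" using mtotally_bounded_subset by blast
  then show ?thesis using r by (intro exI[of _ "m * r"]) simp
qed

text \<open>The Hopf--Rinow theorem in the form of Cohn-Vossen: the supremum of the radii of totally
  bounded balls would be attained, and could then be exceeded.\<close>

lemma mtotally_bounded_mball:
  assumes complete: mcomplete
  shows "mtotally_bounded (mball p0 r)"
proof (rule ccontr)
  assume nt: "\<not> mtotally_bounded (mball p0 r)"
  define T where "T = {s. mtotally_bounded (mball p0 s)}"
  have mono: "s \<in> T" if "t \<in> T" "s \<le> t" for s t
  proof -
    have "mball p0 s \<subseteq> mball p0 t" using that(2) by auto
    then show ?thesis using that(1) mtotally_bounded_subset unfolding T_def by blast
  qed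
  have bdd: "bdd_above T" using nt mono by (auto simp: T_def bdd_above_def) (meson linear)
  obtain e0 where e0: "e0 > 0" "e0 \<in> T" using locally_totally_bounded[of p0] by (auto simp: T_def)
  define R where "R = Sup T"
  have R: "R \<ge> e0" unfolding R_def using e0 bdd by (intro cSup_upper)
  have below: "s \<in> T" if sR: "s < R" for s
  proof -
    obtain t where "t \<in> T" "s < t" using less_cSup_iff[of T s] sR e0 bdd by (auto simp: R_def)
    then show ?thesis using mono by auto
  qed
  have RT: "R \<in> T"
  proof -
    have "\<exists>K. finite K \<and> K \<subseteq> mball p0 R \<and> mball p0 R \<subseteq> (\<Union>x\<in>K. mball x e)" if e: "e > 0" for e
    proof -
      define s where "s = max (R / 2) (R - e / 2)"
      have s: "s < R" "s > 0" "R < s + e / 2 + e / 2"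
        unfolding s_def using e0 R e by auto
      obtain K where K: "finite K" "K \<subseteq> mball p0 s" "mball p0 s \<subseteq> (\<Union>x\<in>K. mball x (e / 2))"
        using below[OF s(1)] half_gt_zero[OF e] unfolding T_def mtotally_bounded_def by blast
      have "mball p0 R \<subseteq> (\<Union>x\<in>K. mball x e)"
      proof
        fix x assume "x \<in> mball p0 R"
        then have "d p0 x < s + e / 2" unfolding s_def by auto
        then obtain z where z: "d p0 z < s" "d z x < e / 2"
          using ex_intermediate_point[of p0 x s "e / 2"] s e by auto
        then obtain k where k: "k \<in> K" "d k z < e / 2" using K(3) by force
        then have "d k x < e" using riem_dist_triangle[of k x z] z by simp
        then show "x \<in> (\<Union>x\<in>K. mball x e)" using k by auto
      qed
      moreover have "mball p0 s \<subseteq> mball p0 R" using s by auto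
      ultimately show ?thesis using K by blast
    qed
    then show ?thesis unfolding T_def mtotally_bounded_def by blast
  qed
  define C where "C = mtopology closure_of (mball p0 R)"
  have C: "compact C"
    using RT complete unfolding T_def C_def
    by (simp add: mtotally_bounded_eq_compact_closure_of mtopology_eq_euclidean)
  have sub: "mball p0 R \<subseteq> C"
    unfolding C_def by (rule closure_of_subset) simp
  obtain e where e: "\<And>q. e q > 0" "\<And>q. mtotally_bounded (mball q (e q))"
    using locally_totally_bounded by metis
  have "C \<subseteq> (\<Union>q\<in>C. mball q (e q / 2))" using e by (auto intro!: bexI)
  then obtain K where K: "K \<subseteq> C" "finite K" "C \<subseteq> (\<Union>q\<in>K. mball q (e q / 2))"
    using compactE_image[OF C, of C "\<lambda>q. mball q (e q / 2)"] open_mball by metis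
  define \<delta> where "\<delta> = Min (insert 1 ((\<lambda>q. e q / 2) ` K))"
  have \<delta>: "\<delta> > 0" unfolding \<delta>_def using K(2) e(1) by auto
  have \<delta>_le: "\<delta> \<le> e q / 2" if "q \<in> K" for q
    unfolding \<delta>_def by (rule Min_le) (use K(2) that in auto)
  have "mball p0 (R + \<delta>) \<subseteq> (\<Union>q\<in>K. mball q (e q))"
  proof
    fix x assume "x \<in> mball p0 (R + \<delta>)"
    then obtain z where z: "d p0 z < R" "d z x < \<delta>"
      using ex_intermediate_point[of p0 x R \<delta>] R e0 \<delta> by auto
    then have "z \<in> C" using sub by auto
    then obtain q where q: "q \<in> K" "d q z < e q / 2" using K(3) by force
    then have "d q x < e q" using riem_dist_triangle[of q x z] z \<delta>_le[OF q(1)] by simp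
    then show "x \<in> (\<Union>q\<in>K. mball q (e q))" using q by auto
  qed
  moreover have "mtotally_bounded (\<Union>q\<in>K. mball q (e q))"
    using K(2) e(2) by (intro mtotally_bounded_Union) auto
  ultimately have "R + \<delta> \<in> T" unfolding T_def using mtotally_bounded_subset by blast
  then have "R + \<delta> \<le> R" unfolding R_def using bdd cSup_upper by blast
  then show False using \<delta> by simp
qed

lemma mball_subset_compact:
  assumes "mcomplete" obtains C where "compact C" "mball p0 r \<subseteq> C"
proof (rule that)
  show "compact (mtopology closure_of (mball p0 r))"
    using mtotally_bounded_mball[OF assms, of p0 r] assms
    by (simp add: mtotally_bounded_eq_compact_closure_of mtopology_eq_euclidean)
  show "mball p0 r \<subseteq> mtopology closure_of (mball p0 r)" by (rule closure_of_subset) simp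
qed

end

section \<open>The weighted measure in a chart\<close>

lemma Ck_fun_mono: "Ck_fun A m w \<Longrightarrow> k \<le> m \<Longrightarrow> Ck_fun A k w"
  unfolding Ck_fun_def using Ck_on_mono by blast

locale weighted_riemannian = connected_riemannian A G
  for A :: "('m::{t2_space, second_countable_topology}, 'n::finite) chart set"
    and G :: "('m, 'n) metric_components" +
  fixes f :: "'m \<Rightarrow> real" and \<mu> :: "'m measure"
  assumes potential: "Ck_fun A 2 f"
    and ex_volume: "\<exists>\<nu>. riemannian_volume A G \<nu> \<and> \<mu> = density \<nu> (\<lambda>q. ennreal (exp (- f q)))"
begin

lemma C1_fun_continuous_on:
  assumes w: "Ck_fun A 1 w" shows "continuous_on S w"
proof -
  have "isCont w q" for q
  proof -
    let ?c = "chart_at A q"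
    have c: "?c \<in> A" "q \<in> cdom ?c" by (rule chart_at)+
    have "continuous_on (cimage ?c) (w \<circ> param ?c)"
      using w c(1) C1_on_imp_continuous_on unfolding Ck_fun_def by blast
    then have "isCont (w \<circ> param ?c) (coord ?c q)"
      using open_cimage[OF c(1)] c continuous_on_eq_continuous_at coord_in_cimage by blast
    from isCont_o2[OF isCont_coord[OF c] this]
    have 1: "isCont (\<lambda>q. (w \<circ> param ?c) (coord ?c q)) q" .
    have "\<forall>\<^sub>F s in nhds q. s \<in> cdom ?c"
      using open_cdom[OF c(1)] c(2) eventually_nhds by blast
    then have "\<forall>\<^sub>F s in nhds q. w s = (w \<circ> param ?c) (coord ?c s)"
      by eventually_elim (use c in simp)
    then show ?thesis using 1 by (rule isCont_cong[THEN iffD2])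
  qed
  then show ?thesis by (intro continuous_at_imp_continuous_on) blast
qed

lemma continuous_on_potential: "continuous_on S f"
  by (rule C1_fun_continuous_on[OF Ck_fun_mono[OF potential]]) simp

lemma sets_\<mu> [measurable_cong]: "sets \<mu> = sets borel"
  using ex_volume by (auto simp: riemannian_volume_def)

lemma space_\<mu>: "space \<mu> = UNIV"
  using sets_eq_imp_space_eq[OF sets_\<mu>] by simp

definition chart_density :: "('m, 'n) chart \<Rightarrow> real^'n \<Rightarrow> real" where
  "chart_density c x = sqrt (det (G c x)) * exp (- f (param c x))"

lemma chart_density_pos: "c \<in> A \<Longrightarrow> x \<in> cimage c \<Longrightarrow> chart_density c x > 0"
  unfolding chart_density_def using det_metric_pos by simp

lemma continuous_on_sqrt_det: "c \<in> A \<Longrightarrow> continuous_on (cimage c) (\<lambda>x. sqrt (det (G c x)))"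
  by (intro continuous_on_real_sqrt C1_on_imp_continuous_on C1_on_det_matrix Ck_on_metric)

lemma continuous_on_chart_density: "c \<in> A \<Longrightarrow> continuous_on (cimage c) (chart_density c)"
  unfolding chart_density_def
  by (intro continuous_intros continuous_on_sqrt_det continuous_on_compose2[OF continuous_on_potential continuous_on_param]) auto

context
  fixes c assumes c: "c \<in> A"
begin

definition param_ext :: "real^'n \<Rightarrow> 'm" where
  "param_ext x = (if x \<in> cimage c then param c x else undefined)"

lemma measurable_param_ext [measurable]: "param_ext \<in> borel_measurable borel"
  unfolding param_ext_def
proof (rule measurable_If_restrict_space_iff[THEN iffD2])
  show "{x \<in> space borel. x \<in> cimage c} \<in> sets borel" using open_cimage[OF c] by simp
  show "param c \<in> restrict_space borel {x. x \<in> cimage c} \<rightarrow>\<^sub>M borel \<and>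
      (\<lambda>x. undefined) \<in> restrict_space borel {x. x \<notin> cimage c} \<rightarrow>\<^sub>M borel"
    using borel_measurable_continuous_on_restrict[OF continuous_on_param[OF c]] by simp
qed

lemma volume_chart:
  assumes \<nu>: "riemannian_volume A G \<nu>"
  shows "density \<nu> (\<lambda>q. ennreal (indicator (cdom c) q)) =
    distr (density lborel (\<lambda>x. ennreal (indicator (cimage c) x * sqrt (det (G c x))))) borel param_ext"
    (is "?M1 = distr (density lborel ?s) borel param_ext")
proof (rule measure_eqI)
  have s\<nu>[measurable_cong]: "sets \<nu> = sets borel" using \<nu> by (simp add: riemannian_volume_def)
  show "sets ?M1 = sets (distr (density lborel ?s) borel param_ext)" using s\<nu> by simp
  fix B assume "B \<in> sets ?M1"
  then have B[measurable]: "B \<in> sets borel" using s\<nu> by simp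
  have [measurable]: "cdom c \<in> sets borel" using open_cdom[OF c] by simp
  have "(\<lambda>x. indicator (cimage c) x *\<^sub>R sqrt (det (G c x))) \<in> borel_measurable borel"
    using open_cimage[OF c] continuous_on_sqrt_det[OF c]
    by (intro borel_measurable_continuous_on_indicator) auto
  then have s[measurable]: "?s \<in> borel_measurable borel" by simp
  have "emeasure ?M1 B = (\<integral>\<^sup>+q. ennreal (indicator (cdom c) q) * indicator B q \<partial>\<nu>)"
    by (rule emeasure_density) (use B s\<nu> in measurable)
  also have "\<dots> = (\<integral>\<^sup>+q. indicator (cdom c \<inter> B) q \<partial>\<nu>)"
    by (intro nn_integral_cong) (simp add: indicator_def)
  also have "\<dots> = emeasure \<nu> (cdom c \<inter> B)" using s\<nu> by (intro nn_integral_indicator) simp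
  also have "\<dots> = (\<integral>\<^sup>+x\<in>coord c ` (cdom c \<inter> B). ennreal (sqrt (det (G c x))) \<partial>lborel)"
    using \<nu> c B open_cdom[OF c] unfolding riemannian_volume_def by auto
  also have "\<dots> = (\<integral>\<^sup>+x. ?s x * indicator (param_ext -` B) x \<partial>lborel)"
  proof (intro nn_integral_cong)
    fix x
    have "x \<in> coord c ` (cdom c \<inter> B) \<longleftrightarrow> x \<in> cimage c \<and> param_ext x \<in> B"
    proof
      assume "x \<in> coord c ` (cdom c \<inter> B)"
      then show "x \<in> cimage c \<and> param_ext x \<in> B" using c by (auto simp: param_ext_def)
    next
      assume "x \<in> cimage c \<and> param_ext x \<in> B"
      then show "x \<in> coord c ` (cdom c \<inter> B)"
        using c by (intro image_eqI[of _ _ "param c x"]) (auto simp: param_ext_def)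
    qed
    then show "ennreal (sqrt (det (G c x))) * indicator (coord c ` (cdom c \<inter> B)) x
        = ?s x * indicator (param_ext -` B) x"
      by (auto simp: indicator_def)
  qed
  also have "\<dots> = emeasure (density lborel ?s) (param_ext -` B)"
    by (rule emeasure_density[symmetric]) (use s measurable_sets[OF measurable_param_ext B] in auto)
  also have "\<dots> = emeasure (distr (density lborel ?s) borel param_ext) B"
    by (subst emeasure_distr) auto
  finally show "emeasure ?M1 B = emeasure (distr (density lborel ?s) borel param_ext) B" .
qed

lemma measurable_chart_density:
  "(\<lambda>x. indicator (cimage c) x * chart_density c x) \<in> borel_measurable borel"
  "(\<lambda>x. indicator (cimage c) x * sqrt (det (G c x))) \<in> borel_measurable borel"
  using borel_measurable_continuous_on_indicator[OF _ continuous_on_chart_density[OF c]]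
    borel_measurable_continuous_on_indicator[OF _ continuous_on_sqrt_det[OF c]] open_cimage[OF c] by auto

lemma nn_integral_chart:
  fixes F :: "'m \<Rightarrow> ennreal"
  assumes F[measurable]: "F \<in> borel_measurable borel" and 0: "\<And>q. q \<notin> cdom c \<Longrightarrow> F q = 0"
  shows "(\<integral>\<^sup>+q. F q \<partial>\<mu>) = (\<integral>\<^sup>+x. ennreal (indicator (cimage c) x * chart_density c x) * F (param c x) \<partial>lborel)"
proof -
  obtain \<nu> where \<nu>: "riemannian_volume A G \<nu>" "\<mu> = density \<nu> (\<lambda>q. ennreal (exp (- f q)))"
    using ex_volume by blast
  have s\<nu>[measurable_cong]: "sets \<nu> = sets borel" using \<nu> by (simp add: riemannian_volume_def)
  have [measurable]: "f \<in> borel_measurable borel"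
    using continuous_on_potential by (rule borel_measurable_continuous_onI)
  have [measurable]: "cdom c \<in> sets borel" using open_cdom[OF c] by simp
  note [measurable] = measurable_chart_density
  let ?e = "\<lambda>q. ennreal (exp (- f q))"
  have "(\<integral>\<^sup>+q. F q \<partial>\<mu>) = (\<integral>\<^sup>+q. ?e q * F q \<partial>\<nu>)"
    unfolding \<nu>(2) by (rule nn_integral_density) auto
  also have "\<dots> = (\<integral>\<^sup>+q. ennreal (indicator (cdom c) q) * (?e q * F q) \<partial>\<nu>)"
    by (intro nn_integral_cong) (auto simp: indicator_def 0)
  also have "\<dots> = (\<integral>\<^sup>+q. ?e q * F q \<partial>density \<nu> (\<lambda>q. ennreal (indicator (cdom c) q)))"
    by (rule nn_integral_density[symmetric]) measurable
  also have "\<dots> = (\<integral>\<^sup>+x. ?e (param_ext x) * F (param_ext x)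
      \<partial>density lborel (\<lambda>x. ennreal (indicator (cimage c) x * sqrt (det (G c x)))))"
    unfolding volume_chart[OF \<nu>(1)] by (rule nn_integral_distr) measurable
  also have "\<dots> = (\<integral>\<^sup>+x. ennreal (indicator (cimage c) x * sqrt (det (G c x))) * (?e (param_ext x) * F (param_ext x)) \<partial>lborel)"
    by (rule nn_integral_density) measurable
  also have "\<dots> = (\<integral>\<^sup>+x. ennreal (indicator (cimage c) x * chart_density c x) * F (param c x) \<partial>lborel)"
  proof (intro nn_integral_cong)
    show "ennreal (indicator (cimage c) x * sqrt (det (G c x))) * (?e (param_ext x) * F (param_ext x))
        = ennreal (indicator (cimage c) x * chart_density c x) * F (param c x)" for x
      by (cases "x \<in> cimage c") (simp_all add: param_ext_def chart_density_def ennreal_mult'' mult.assoc)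
  qed
  finally show ?thesis .
qed

lemma integral_chart:
  fixes F :: "'m \<Rightarrow> real"
  assumes F[measurable]: "F \<in> borel_measurable borel" and 0: "\<And>q. q \<notin> cdom c \<Longrightarrow> F q = 0"
  shows "(\<integral>q. F q \<partial>\<mu>) = (\<integral>x. indicator (cimage c) x * chart_density c x * F (param c x) \<partial>lborel)"
proof -
  obtain \<nu> where \<nu>: "riemannian_volume A G \<nu>" "\<mu> = density \<nu> (\<lambda>q. ennreal (exp (- f q)))"
    using ex_volume by blast
  have s\<nu>[measurable_cong]: "sets \<nu> = sets borel" using \<nu> by (simp add: riemannian_volume_def)
  have [measurable]: "f \<in> borel_measurable borel"
    using continuous_on_potential by (rule borel_measurable_continuous_onI)
  have [measurable]: "cdom c \<in> sets borel" using open_cdom[OF c] by simp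
  note [measurable] = measurable_chart_density
  let ?e = "\<lambda>q. exp (- f q)"
  have "(\<integral>q. F q \<partial>\<mu>) = (\<integral>q. ?e q *\<^sub>R F q \<partial>\<nu>)"
    unfolding \<nu>(2) by (rule integral_density) auto
  also have "\<dots> = (\<integral>q. indicator (cdom c) q *\<^sub>R (?e q * F q) \<partial>\<nu>)"
    by (intro Bochner_Integration.integral_cong) (auto simp: indicator_def 0)
  also have "\<dots> = (\<integral>q. ?e q * F q \<partial>density \<nu> (\<lambda>q. ennreal (indicator (cdom c) q)))"
    by (rule integral_density[symmetric]) auto
  also have "\<dots> = (\<integral>x. ?e (param_ext x) * F (param_ext x)
      \<partial>density lborel (\<lambda>x. ennreal (indicator (cimage c) x * sqrt (det (G c x)))))"
    unfolding volume_chart[OF \<nu>(1)] by (rule integral_distr) measurable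
  also have "\<dots> = (\<integral>x. (indicator (cimage c) x * sqrt (det (G c x))) *\<^sub>R (?e (param_ext x) * F (param_ext x)) \<partial>lborel)"
  proof (rule integral_density)
    have "indicator (cimage c) x * sqrt (det (G c x)) \<ge> 0" for x
      using det_metric_pos[OF c, of x] by (simp add: indicator_def less_imp_le)
    then show "AE x in lborel. 0 \<le> indicator (cimage c) x * sqrt (det (G c x))" by simp
  qed measurable
  also have "\<dots> = (\<integral>x. indicator (cimage c) x * chart_density c x * F (param c x) \<partial>lborel)"
    by (intro Bochner_Integration.integral_cong) (auto simp: indicator_def param_ext_def chart_density_def)
  finally show ?thesis .
qed

end

lemma emeasure_compact_finite:
  assumes "compact C" shows "emeasure \<mu> C < top"
proof -
  have nbhd: "\<exists>N. open N \<and> q \<in> N \<and> emeasure \<mu> N < top" for q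
  proof -
    let ?c = "chart_at A q"
    have c: "?c \<in> A" "q \<in> cdom ?c" by (rule chart_at)+
    obtain r where r: "r > 0" "cball (coord ?c q) r \<subseteq> cimage ?c"
      using open_cimage[OF c(1)] coord_in_cimage[OF c] open_contains_cball by blast
    let ?b = "ball (coord ?c q) r" and ?K = "cball (coord ?c q) r"
    have bs: "?b \<subseteq> cimage ?c" using r ball_subset_cball by blast
    have oN: "open (param ?c ` ?b)" by (rule open_param_image[OF c(1) open_ball bs])
    have "compact (chart_density ?c ` ?K)"
      by (rule compact_continuous_image[OF continuous_on_subset[OF continuous_on_chart_density[OF c(1)] r(2)] compact_cball])
    then obtain B where B: "B > 0" "\<And>x. x \<in> ?K \<Longrightarrow> norm (chart_density ?c x) < B"
      using bounded_norm_lessE[OF compact_imp_bounded] by (metis imageI)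
    have "emeasure \<mu> (param ?c ` ?b) = (\<integral>\<^sup>+q. indicator (param ?c ` ?b) q \<partial>\<mu>)"
      using oN by simp
    also have "\<dots> = (\<integral>\<^sup>+x. ennreal (indicator (cimage ?c) x * chart_density ?c x) * indicator (param ?c ` ?b) (param ?c x) \<partial>lborel)"
      by (rule nn_integral_chart[OF c(1)]) (use oN bs c in \<open>auto simp: indicator_eq_0_iff\<close>)
    also have "\<dots> \<le> (\<integral>\<^sup>+x. ennreal B * indicator ?b x \<partial>lborel)"
    proof (rule nn_integral_mono)
      fix x
      show "ennreal (indicator (cimage ?c) x * chart_density ?c x) * indicator (param ?c ` ?b) (param ?c x) \<le> ennreal B * indicator ?b x"
      proof (cases "x \<in> cimage ?c \<and> param ?c x \<in> param ?c ` ?b")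
        case True
        then obtain y where "y \<in> ?b" "param ?c x = param ?c y" by blast
        then have "x \<in> ?b" using True bs c(1) by (metis coord_param subset_iff)
        then show ?thesis using True B(2)[of x] by (auto intro!: ennreal_leI)
      qed (auto simp: indicator_def)
    qed
    also have "\<dots> = ennreal B * emeasure lborel ?b" by (simp add: nn_integral_cmult_indicator)
    also have "\<dots> < top" using emeasure_lborel_ball_finite[of "coord ?c q" r] by (simp add: ennreal_mult_less_top)
    finally show ?thesis using oN c r(1) by (intro exI[of _ "param ?c ` ?b"]) (auto intro!: image_eqI[of _ _ "coord ?c q"])
  qed
  then have "\<exists>N. \<forall>q. open (N q) \<and> q \<in> N q \<and> emeasure \<mu> (N q) < top" by (intro choice allI)
  then obtain N where N: "\<And>q. open (N q)" "\<And>q. q \<in> N q" "\<And>q. emeasure \<mu> (N q) < top" by blast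
  have "C \<subseteq> (\<Union>q\<in>C. N q)" using N(2) by blast
  then obtain K where K: "finite K" "C \<subseteq> (\<Union>q\<in>K. N q)"
    by (rule compactE_image[OF assms N(1)]) (rule that)
  have "emeasure \<mu> C \<le> emeasure \<mu> (\<Union>q\<in>K. N q)"
    using K(2) N(1) by (intro emeasure_mono) (auto simp: sets_\<mu> intro!: borel_open open_UN)
  also have "\<dots> \<le> (\<Sum>q\<in>K. emeasure \<mu> (N q))"
    using K(1) N(1) by (intro emeasure_subadditive_finite) (auto simp: sets_\<mu>)
  also have "\<dots> < top" using K(1) N(3) by simp
  finally show ?thesis .
qed

lemma integrable_continuous_compact_support:
  fixes F :: "'m \<Rightarrow> real"
  assumes F: "continuous_on UNIV F" and C: "compact C" "\<And>q. q \<notin> C \<Longrightarrow> F q = 0"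
  shows "integrable \<mu> F"
proof -
  have "compact (F ` C)" by (rule compact_continuous_image[OF continuous_on_subset[OF F] C(1)]) simp
  then obtain B where B: "\<And>q. q \<in> C \<Longrightarrow> norm (F q) < B"
    using bounded_norm_lessE[OF compact_imp_bounded] by (metis imageI)
  show ?thesis
  proof (rule integrableI_bounded_set[of C _ _ B])
    show "C \<in> sets \<mu>" using C(1) by (simp add: sets_\<mu> borel_compact)
    show "F \<in> borel_measurable \<mu>" using borel_measurable_continuous_onI[OF F] by simp
    show "emeasure \<mu> C < \<infinity>" using emeasure_compact_finite[OF C(1)] by simp
  qed (use B C(2) in \<open>auto intro: less_imp_le\<close>)
qed

lemma emeasure_open_pos:
  assumes U: "open U" "q \<in> U" shows "emeasure \<mu> U > 0"
proof -
  let ?c = "chart_at A q" let ?x = "coord (chart_at A q) q"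
  have c: "?c \<in> A" "q \<in> cdom ?c" by (rule chart_at)+
  let ?V = "cimage ?c \<inter> param ?c -` U"
  have "open ?V"
    using continuous_open_preimage[OF continuous_on_param[OF c(1)] open_cimage[OF c(1)] U(1)] .
  moreover have "?x \<in> ?V" using c U by simp
  ultimately obtain r where r: "r > 0" "cball ?x r \<subseteq> ?V" using open_contains_cball by blast
  have ne: "cball ?x r \<noteq> {}" using r(1) by auto
  have "continuous_on (cball ?x r) (chart_density ?c)"
    by (rule continuous_on_subset[OF continuous_on_chart_density[OF c(1)]]) (use r in blast)
  from continuous_attains_inf[OF compact_cball ne this]
  obtain y where y: "y \<in> cball ?x r" "\<And>z. z \<in> cball ?x r \<Longrightarrow> chart_density ?c y \<le> chart_density ?c z" by blast
  have pos: "chart_density ?c y > 0" using chart_density_pos[OF c(1)] y(1) r(2) by blast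
  have "emeasure lborel (ball ?x r) = ennreal (measure lborel (ball ?x r))"
    by (rule emeasure_eq_ennreal_measure) (use emeasure_lborel_ball_finite[of ?x r] in auto)
  then have "0 < ennreal (chart_density ?c y) * emeasure lborel (ball ?x r)"
    using pos content_ball_pos[OF r(1), of ?x] by (simp add: ennreal_zero_less_mult_iff)
  also have "\<dots> = (\<integral>\<^sup>+x. ennreal (chart_density ?c y) * indicator (ball ?x r) x \<partial>lborel)"
    by (simp add: nn_integral_cmult_indicator)
  also have "\<dots> \<le> (\<integral>\<^sup>+x. ennreal (indicator (cimage ?c) x * chart_density ?c x) * indicator (U \<inter> cdom ?c) (param ?c x) \<partial>lborel)"
  proof (rule nn_integral_mono)
    fix x
    show "ennreal (chart_density ?c y) * indicator (ball ?x r) x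
        \<le> ennreal (indicator (cimage ?c) x * chart_density ?c x) * indicator (U \<inter> cdom ?c) (param ?c x)"
    proof (cases "x \<in> ball ?x r")
      case True
      then have "x \<in> cball ?x r" "x \<in> ?V" using r ball_subset_cball by blast+
      then show ?thesis using True y(2)[of x] c(1) by (auto intro!: ennreal_leI)
    qed simp
  qed
  also have "\<dots> = (\<integral>\<^sup>+q. indicator (U \<inter> cdom ?c) q \<partial>\<mu>)"
    by (rule nn_integral_chart[OF c(1), symmetric]) (use U(1) open_cdom[OF c(1)] in \<open>auto intro!: borel_measurable_indicator borel_open\<close>)
  also have "\<dots> = emeasure \<mu> (U \<inter> cdom ?c)"
    using U(1) open_cdom[OF c(1)] by (simp add: sets_\<mu>)
  also have "\<dots> \<le> emeasure \<mu> U" using U(1) by (intro emeasure_mono) (auto simp: sets_\<mu>)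
  finally show ?thesis .
qed

end

section \<open>Gradients and partitions of unity\<close>

lemma C1_on_Un:
  assumes "open S" "open T" "C1_on S F" "C1_on T F" shows "C1_on (S \<union> T) F"
  using assms by (auto simp: intro!: continuous_on_open_Un)

lemma linear_eq_sum_axis:
  fixes D :: "real^'n::finite \<Rightarrow> real"
  assumes "linear D" shows "D v = (\<Sum>k\<in>UNIV. v $ k * D (axis k 1))"
proof -
  have "D v = D (\<Sum>k\<in>UNIV. v $ k *\<^sub>R axis k 1)"
    using basis_expansion[of v] by (simp add: scalar_mult_eq_scaleR)
  also have "\<dots> = (\<Sum>k\<in>UNIV. v $ k * D (axis k 1))"
    using assms by (simp add: linear_sum linear_scale)
  finally show ?thesis .
qed

context connected_riemannian begin

abbreviation (input) dchart :: "('m, 'n) chart \<Rightarrow> ('m \<Rightarrow> real) \<Rightarrow> real^'n \<Rightarrow> real^'n \<Rightarrow> real" where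
  "dchart c a x \<equiv> frechet_derivative (a \<circ> param c) (at x)"

definition chart_pairing :: "('m, 'n) chart \<Rightarrow> ('m \<Rightarrow> real) \<Rightarrow> ('m \<Rightarrow> real) \<Rightarrow> real^'n \<Rightarrow> real" where
  "chart_pairing c a w x = dchart c a x (grad G c w x)"

definition grad_pairing :: "('m \<Rightarrow> real) \<Rightarrow> ('m \<Rightarrow> real) \<Rightarrow> 'm \<Rightarrow> real" where
  "grad_pairing a w q = chart_pairing (chart_at A q) a w (coord (chart_at A q) q)"

lemma C1_fun_has_derivative:
  assumes "Ck_fun A 1 a" "c \<in> A" "x \<in> cimage c"
  shows "((a \<circ> param c) has_derivative dchart c a x) (at x)"
  using assms C1_on_has_derivative unfolding Ck_fun_def by blast

lemma linear_dchart:
  assumes "Ck_fun A 1 a" "c \<in> A" "x \<in> cimage c" shows "linear (dchart c a x)"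
  using C1_fun_has_derivative[OF assms] has_derivative_linear by blast

lemma metric_grad:
  assumes w: "Ck_fun A 1 w" and c: "c \<in> A" and x: "x \<in> cimage c"
  shows "v \<bullet> (G c x *v grad G c w x) = dchart c w x v"
proof -
  have "G c x *v grad G c w x = (\<chi> j. partial j (w \<circ> param c) x)"
    unfolding grad_def using matrix_mult_matrix_inv[OF invertible_metric[OF c x]]
    by (simp add: matrix_vector_mul_assoc)
  then show ?thesis
    using linear_eq_sum_axis[OF linear_dchart[OF w c x], of v] by (simp add: inner_vec_def partial_def)
qed

lemma dchart_transition:
  assumes a: "Ck_fun A 1 a" and c: "c \<in> A" "c' \<in> A" and x: "x \<in> cimage c" "param c x \<in> cdom c'"
  shows "dchart c a x v = dchart c' a (transition c c' x) (frechet_derivative (transition c c') (at x) v)"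
proof -
  let ?D = "frechet_derivative (transition c c') (at x)"
  have tx: "transition c c' x \<in> cimage c'" using c x by (simp add: transition_def)
  have "((\<lambda>y. (a \<circ> param c') (transition c c' y)) has_derivative (\<lambda>v. dchart c' a (transition c c' x) (?D v))) (at x)"
    by (rule has_derivative_compose[OF transition_has_derivative[OF c x] C1_fun_has_derivative[OF a c(2) tx]])
  then have "((a \<circ> param c) has_derivative (\<lambda>v. dchart c' a (transition c c' x) (?D v))) (at x)"
    by (rule has_derivative_transform_within_open[OF _ open_overlap[OF c]])
      (use x c in \<open>auto simp: transition_def\<close>)
  from frechet_derivative_at[OF this] show ?thesis by metis
qed

lemma chart_pairing_transition:
  assumes a: "Ck_fun A 1 a" and w: "Ck_fun A 1 w" and c: "c \<in> A" "c' \<in> A"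
    and x: "x \<in> cimage c" "param c x \<in> cdom c'"
  shows "chart_pairing c a w x = chart_pairing c' a w (coord c' (param c x))"
proof -
  define J where "J = frechet_derivative (transition c c') (at x)"
  define y where "y = transition c c' x"
  have y: "y \<in> cimage c'" "y = coord c' (param c x)" using c x by (auto simp: transition_def y_def)
  have lin: "linear J" unfolding J_def using transition_has_derivative[OF c x] has_derivative_linear by blast
  have G: "v \<bullet> (G c x *v z) = J v \<bullet> (G c' y *v J z)" for v z
    unfolding J_def y_def by (rule metric_transform[OF c x])
  have "inj J"
  proof (subst linear_injective_0[OF lin], intro allI impI)
    fix v assume "J v = 0"
    then have "v \<bullet> (G c x *v v) = 0" using G by simp
    then show "v = 0" using metric_pos[OF c(1) x(1), of v] by force
  qed
  then have surj: "surj J" using linear_injective_imp_surjective[OF lin] by simp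
  let ?g = "grad G c w x" and ?g' = "grad G c' w y"
  have "z \<bullet> (G c' y *v (J ?g - ?g')) = 0" for z
  proof -
    obtain v where v: "z = J v" using surj by (metis surjD)
    have "z \<bullet> (G c' y *v J ?g) = dchart c w x v"
      using G[of v ?g] metric_grad[OF w c(1) x(1)] v by simp
    also have "\<dots> = z \<bullet> (G c' y *v ?g')"
      using dchart_transition[OF w c x, of v] metric_grad[OF w c(2) y(1), of z] v
      by (simp add: J_def y_def)
    finally show ?thesis by (simp add: matrix_vector_mult_diff_distrib inner_diff_right)
  qed
  then have "J ?g = ?g'" using metric_pos[OF c(2) y(1), of "J ?g - ?g'"] by force
  then show ?thesis
    unfolding chart_pairing_def using dchart_transition[OF a c x, of ?g] y by (simp add: J_def y_def)
qed

lemma grad_pairing_chart: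
  assumes "Ck_fun A 1 a" "Ck_fun A 1 w" "c \<in> A" "q \<in> cdom c"
  shows "grad_pairing a w q = chart_pairing c a w (coord c q)"
  unfolding grad_pairing_def
  using chart_pairing_transition[OF assms(1,2,3) chart_at(1)[of q], of "coord c q"] assms(3,4) chart_at(2)
  by simp

lemma sum_grad_pairing_eq_0:
  assumes I: "finite I" and a: "\<And>i. i \<in> I \<Longrightarrow> Ck_fun A 1 (a i)" and V: "open V" "q \<in> V"
    and const: "\<And>y. y \<in> V \<Longrightarrow> (\<Sum>i\<in>I. a i y) = C"
  shows "(\<Sum>i\<in>I. grad_pairing (a i) w q) = 0"
proof -
  let ?c = "chart_at A q" let ?x = "coord (chart_at A q) q"
  have c: "?c \<in> A" "q \<in> cdom ?c" by (rule chart_at)+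
  have x: "?x \<in> cimage ?c" using c by simp
  have "((\<lambda>y. \<Sum>i\<in>I. (a i \<circ> param ?c) y) has_derivative (\<lambda>v. \<Sum>i\<in>I. dchart ?c (a i) ?x v)) (at ?x)"
    by (rule has_derivative_sum) (use C1_fun_has_derivative[OF a c(1) x] in \<open>auto simp: o_def\<close>)
  moreover have "open (cimage ?c \<inter> param ?c -` V)"
    using continuous_open_preimage[OF continuous_on_param[OF c(1)] open_cimage[OF c(1)] V(1)] .
  ultimately have "((\<lambda>y. C) has_derivative (\<lambda>v. \<Sum>i\<in>I. dchart ?c (a i) ?x v)) (at ?x)"
    by (rule has_derivative_transform_within_open) (use x V c const in auto)
  then have "(\<lambda>v. \<Sum>i\<in>I. dchart ?c (a i) ?x v) = (\<lambda>v. 0)"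
    using has_derivative_unique has_derivative_const by blast
  then show ?thesis unfolding grad_pairing_def chart_pairing_def by metis
qed

lemma grad_pairing_eq_0:
  assumes "Ck_fun A 1 a" "open V" "q \<in> V" "\<And>y. y \<in> V \<Longrightarrow> a y = C"
  shows "grad_pairing a w q = 0"
  using sum_grad_pairing_eq_0[of "{()}" "\<lambda>_. a" V q C w] assms by simp

lemma C1_on_grad:
  assumes w: "Ck_fun A 2 w" and c: "c \<in> A"
  shows "C1_on (cimage c) (\<lambda>x. grad G c w x $ k)"
  unfolding grad_def
proof (rule C1_on_matrix_inv_mult_vec[OF open_cimage[OF c] Ck_on_metric[OF c] _ invertible_metric[OF c]])
  have "Ck_on (Suc 1) (cimage c) (w \<circ> param c)" using w c unfolding Ck_fun_def by (simp add: numeral_2_eq_2)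
  then have "C1_on (cimage c) (\<lambda>x. frechet_derivative (w \<circ> param c) (at x) v)" for v by (metis Ck_on.simps(2))
  then show "C1_on (cimage c) (\<lambda>x. (\<chi> j. partial j (w \<circ> param c) x) $ i)" for i
    unfolding vec_lambda_beta partial_def .
qed

lemma continuous_on_grad_pairing:
  assumes a: "Ck_fun A 1 a" and w: "Ck_fun A 2 w"
  shows "continuous_on S (grad_pairing a w)"
proof -
  have w1: "Ck_fun A 1 w" using w by (rule Ck_fun_mono) simp
  have "isCont (grad_pairing a w) q" for q
  proof -
    let ?c = "chart_at A q"
    have c: "?c \<in> A" "q \<in> cdom ?c" by (rule chart_at)+
    have "continuous_on (cimage ?c) (\<lambda>x. \<Sum>k\<in>UNIV. grad G ?c w x $ k * dchart ?c a x (axis k 1))"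
      by (intro continuous_intros C1_on_imp_continuous_on C1_on_grad w c C1_on_continuous_derivative)
        (use a c in \<open>simp add: Ck_fun_def\<close>)
    moreover have "chart_pairing ?c a w x = (\<Sum>k\<in>UNIV. grad G ?c w x $ k * dchart ?c a x (axis k 1))"
      if "x \<in> cimage ?c" for x
      unfolding chart_pairing_def by (rule linear_eq_sum_axis[OF linear_dchart[OF a c(1) that]])
    ultimately have "continuous_on (cimage ?c) (chart_pairing ?c a w)" by (simp cong: continuous_on_cong)
    then have "continuous_on (cdom ?c) (\<lambda>q. chart_pairing ?c a w (coord ?c q))"
      by (rule continuous_on_compose2[OF _ continuous_on_coord[OF c(1)]]) (use c in auto)
    then have "continuous_on (cdom ?c) (grad_pairing a w)"
      by (rule continuous_on_eq) (use grad_pairing_chart[OF a w1 c(1)] in simp)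
    then show ?thesis using open_cdom[OF c(1)] c(2) continuous_on_eq_continuous_at by blast
  qed
  then show ?thesis by (intro continuous_at_imp_continuous_on) blast
qed

lemma C1_bump_ex:
  obtains b c C where "Ck_fun A 1 b" "\<And>m. b m \<ge> 0" "b q > 0" "c \<in> A" "compact C" "C \<subseteq> cdom c"
    "\<And>m. m \<notin> C \<Longrightarrow> b m = 0"
proof -
  let ?c = "chart_at A q" let ?x = "coord (chart_at A q) q"
  have c: "?c \<in> A" "q \<in> cdom ?c" by (rule chart_at)+
  obtain r where r: "r > 0" "cball ?x r \<subseteq> cimage ?c"
    using open_cimage[OF c(1)] coord_in_cimage[OF c] open_contains_cball by blast
  define B where "B = (\<lambda>y. (max 0 (r\<^sup>2 - (\<Sum>k\<in>UNIV. (y $ k - ?x $ k) * (y $ k - ?x $ k))))\<^sup>2)"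
  have B_eq: "B y = (max 0 (r\<^sup>2 - (norm (y - ?x))\<^sup>2))\<^sup>2" for y
    by (simp add: B_def power2_norm_eq_inner inner_vec_def)
  define b where "b = (\<lambda>m. if m \<in> cdom ?c then B (coord ?c m) else 0)"
  let ?C = "param ?c ` cball ?x r"
  have C: "compact ?C"
    by (rule compact_continuous_image[OF continuous_on_subset[OF continuous_on_param[OF c(1)] r(2)] compact_cball])
  have Csub: "?C \<subseteq> cdom ?c" using r(2) param_in_cdom[OF c(1)] by blast
  have b0: "b m = 0" if m: "m \<notin> ?C" for m
  proof (cases "m \<in> cdom ?c")
    case True
    then have "coord ?c m \<notin> cball ?x r" using m c(1) by (metis image_eqI param_coord)
    then have "r \<le> norm (coord ?c m - ?x)" by (simp add: dist_norm norm_minus_commute)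
    then have "r\<^sup>2 \<le> (norm (coord ?c m - ?x))\<^sup>2" using r(1) by (intro power_mono) auto
    then show ?thesis using True by (simp add: b_def B_eq)
  qed (simp add: b_def)
  have "C1_on (cimage c') (b \<circ> param c')" if c': "c' \<in> A" for c'
  proof -
    let ?O1 = "cimage c' \<inter> param c' -` cdom ?c" and ?O2 = "cimage c' \<inter> param c' -` (- ?C)"
    let ?T = "transition c' ?c"
    have o1: "open ?O1" by (rule open_overlap[OF c' c(1)])
    have o2: "open ?O2"
      using continuous_open_preimage[OF continuous_on_param[OF c'] open_cimage[OF c']]
        compact_imp_closed[OF C] by blast
    have T: "Ck_on 1 ?O1 ?T"
      using transition_C1[OF c' c(1)] by (auto simp: differentiable_def)
    have Tk: "C1_on ?O1 (\<lambda>x. ?T x $ k - ?x $ k)" for k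
      using C1_on_add[OF C1_on_bounded_linear[OF bounded_linear_vec_nth T] C1_on_const[of _ "- ?x $ k"]] by simp
    have "C1_on ?O1 (\<lambda>x. r\<^sup>2 + (- 1) * (\<Sum>k\<in>UNIV. (?T x $ k - ?x $ k) * (?T x $ k - ?x $ k)))"
      by (intro C1_on_add C1_on_mult C1_on_const C1_on_sum Tk) auto
    then have "C1_on ?O1 (\<lambda>x. (max 0 (r\<^sup>2 + (- 1) * (\<Sum>k\<in>UNIV. (?T x $ k - ?x $ k) * (?T x $ k - ?x $ k))))\<^sup>2)"
      by (rule C1_on_compose_real[OF _ has_real_derivative_max_0_square]) (auto intro!: continuous_intros)
    then have "C1_on ?O1 (b \<circ> param c')"
      by (rule C1_on_cong[OF o1]) (auto simp: b_def B_def transition_def)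
    moreover have "C1_on ?O2 (b \<circ> param c')"
      by (rule C1_on_cong[OF o2 C1_on_const[of _ 0]]) (use b0 in auto)
    ultimately have "C1_on (?O1 \<union> ?O2) (b \<circ> param c')" by (rule C1_on_Un[OF o1 o2])
    moreover have "?O1 \<union> ?O2 = cimage c'" using Csub by blast
    ultimately show ?thesis by simp
  qed
  then have "Ck_fun A 1 b" unfolding Ck_fun_def by blast
  moreover have "b m \<ge> 0" for m by (simp add: b_def B_def)
  moreover have "b q > 0" using c r(1) by (simp add: b_def B_eq)
  ultimately show thesis using that c(1) C Csub b0 by blast
qed

end


context weighted_riemannian begin

text \<open>With \<open>\<beta>\<close> the sum of finitely many bumps, \<open>\<beta> + (max 0 (\<epsilon> - \<beta>))\<^sup>2\<close> is a positive \<open>C\<^sup>1\<close>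
  function that agrees with \<open>\<beta>\<close> where \<open>\<beta> \<ge> \<epsilon>\<close>.\<close>

lemma C1_partition_of_unity:
  assumes K: "compact K"
  obtains I :: "'m set" and \<eta> :: "'m \<Rightarrow> 'm \<Rightarrow> real" and c C V where
    "finite I" "\<And>i. Ck_fun A 1 (\<eta> i)" "\<And>i q. \<eta> i q \<ge> 0" "\<And>i. c i \<in> A" "\<And>i. compact (C i)"
    "\<And>i. C i \<subseteq> cdom (c i)" "\<And>i q. q \<notin> C i \<Longrightarrow> \<eta> i q = 0"
    "open V" "K \<subseteq> V" "\<And>q. q \<in> V \<Longrightarrow> (\<Sum>i\<in>I. \<eta> i q) = 1"
proof -
  have "\<exists>b c C. Ck_fun A 1 b \<and> (\<forall>m. b m \<ge> 0) \<and> b q > 0 \<and> c \<in> A \<and> compact C \<and> C \<subseteq> cdom c \<and>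
      (\<forall>m. m \<notin> C \<longrightarrow> b m = 0)" for q
    by (rule C1_bump_ex[of q]) blast
  then obtain b c C where b: "\<And>q. Ck_fun A 1 (b q)" "\<And>q m. b q m \<ge> 0" "\<And>q. b q q > 0"
    and c: "\<And>q. c q \<in> A" and C: "\<And>q. compact (C q)" "\<And>q. C q \<subseteq> cdom (c q)"
      "\<And>q m. m \<notin> C q \<Longrightarrow> b q m = 0"
    by metis
  have o: "open {m. b q m > 0}" for q
    using open_Collect_less[OF continuous_on_const C1_fun_continuous_on[OF b(1)]] .
  have "K \<subseteq> (\<Union>q\<in>K. {m. b q m > 0})" using b(3) by blast
  then obtain I where I: "finite I" "K \<subseteq> (\<Union>q\<in>I. {m. b q m > 0})"
    by (rule compactE_image[OF K o]) (rule that)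
  define \<beta> where "\<beta> = (\<lambda>m. \<Sum>i\<in>I. b i m)"
  have \<beta>0: "\<beta> m \<ge> 0" for m unfolding \<beta>_def using b(2) by (intro sum_nonneg) auto
  have c\<beta>: "continuous_on S \<beta>" for S unfolding \<beta>_def
    by (intro continuous_intros C1_fun_continuous_on b)
  have \<beta>pos: "\<beta> m > 0" if m: "m \<in> K" for m
  proof -
    obtain i where i: "i \<in> I" "b i m > 0" using I(2) m by blast
    then show ?thesis unfolding \<beta>_def using I(1) b(2) by (intro sum_pos2[of I i]) auto
  qed
  obtain \<epsilon> where \<epsilon>: "\<epsilon> > 0" "\<And>m. m \<in> K \<Longrightarrow> \<epsilon> < \<beta> m"
  proof (cases "K = {}")
    case False
    from continuous_attains_inf[OF K False c\<beta>]
    obtain m0 where m0: "m0 \<in> K" "\<And>m. m \<in> K \<Longrightarrow> \<beta> m0 \<le> \<beta> m" by blast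
    show thesis
    proof (rule that[of "\<beta> m0 / 2"])
      show "\<beta> m0 / 2 < \<beta> m" if "m \<in> K" for m using m0(2)[OF that] \<beta>pos[OF m0(1)] by simp
    qed (use \<beta>pos[OF m0(1)] in simp)
  qed (use that[of 1] in simp)
  define g where "g = (\<lambda>s. s + (max 0 (\<epsilon> - s))\<^sup>2)"
  have gpos: "g s > 0" if "s \<ge> 0" for s
    using that \<epsilon>(1) by (cases "s > 0") (auto simp: g_def intro: add_pos_nonneg)
  define \<eta> where "\<eta> = (\<lambda>i m. b i m / g (\<beta> m))"
  show thesis
  proof (rule that[of I \<eta> c C "{m. \<epsilon> < \<beta> m}"])
    show "Ck_fun A 1 (\<eta> i)" for i
      unfolding Ck_fun_def
    proof
      fix c assume c: "c \<in> A"
      have bc: "C1_on (cimage c) (\<lambda>x. b j (param c x))" for j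
        using b(1)[of j] c unfolding Ck_fun_def o_def by blast
      have \<beta>c: "C1_on (cimage c) (\<lambda>x. \<beta> (param c x))"
        unfolding \<beta>_def by (intro C1_on_sum bc I)
      have "C1_on (cimage c) (\<lambda>x. \<epsilon> + (- 1) * \<beta> (param c x))"
        by (intro C1_on_add C1_on_mult C1_on_const \<beta>c)
      then have "C1_on (cimage c) (\<lambda>x. (max 0 (\<epsilon> + (- 1) * \<beta> (param c x)))\<^sup>2)"
        by (rule C1_on_compose_real[OF _ has_real_derivative_max_0_square]) (auto intro!: continuous_intros)
      then have "C1_on (cimage c) (\<lambda>x. (max 0 (\<epsilon> - \<beta> (param c x)))\<^sup>2)" by simp
      then have "C1_on (cimage c) (\<lambda>x. b i (param c x) / g (\<beta> (param c x)))"
        unfolding g_def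
        by (rule C1_on_divide[OF bc C1_on_add[OF \<beta>c]]) (use gpos[OF \<beta>0] in \<open>simp add: g_def less_imp_neq[symmetric]\<close>)
      then show "C1_on (cimage c) (\<eta> i \<circ> param c)" by (simp only: \<eta>_def o_def)
    qed
    show "\<eta> i q \<ge> 0" for i q unfolding \<eta>_def using b(2) gpos[OF \<beta>0] by (simp add: less_imp_le)
    show "\<eta> i q = 0" if "q \<notin> C i" for i q using C(3)[OF that] by (simp add: \<eta>_def)
    show "open {m. \<epsilon> < \<beta> m}" by (rule open_Collect_less[OF continuous_on_const c\<beta>])
    show "(\<Sum>i\<in>I. \<eta> i q) = 1" if "q \<in> {m. \<epsilon> < \<beta> m}" for q
    proof -
      have "(\<Sum>i\<in>I. \<eta> i q) = \<beta> q / g (\<beta> q)" by (simp add: \<eta>_def \<beta>_def sum_divide_distrib)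
      also have "g (\<beta> q) = \<beta> q" using that by (simp add: g_def)
      finally show ?thesis using that \<epsilon>(1) by simp
    qed
  qed (use I(1) c C \<epsilon>(2) in auto)
qed

end

section \<open>The test function inequality\<close>

lemma abs_power_diff_le:
  fixes a b M :: real
  assumes "0 \<le> a" "a \<le> M" "0 \<le> b" "b \<le> M"
  shows "\<bar>a ^ n - b ^ n\<bar> \<le> n * M ^ (n - 1) * \<bar>a - b\<bar>"
proof (induction n)
  case (Suc n)
  have M: "0 \<le> M" using assms by simp
  have "a ^ Suc n - b ^ Suc n = a * (a ^ n - b ^ n) + (a - b) * b ^ n" by (simp add: algebra_simps)
  then have "\<bar>a ^ Suc n - b ^ Suc n\<bar> \<le> a * \<bar>a ^ n - b ^ n\<bar> + \<bar>a - b\<bar> * b ^ n"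
    using assms abs_triangle_ineq[of "a * (a ^ n - b ^ n)" "(a - b) * b ^ n"] by (simp add: abs_mult)
  also have "\<dots> \<le> M * (n * M ^ (n - 1) * \<bar>a - b\<bar>) + \<bar>a - b\<bar> * M ^ n"
    using assms M by (intro add_mono mult_mono Suc.IH power_mono mult_left_mono) auto
  also have "\<dots> = Suc n * M ^ (Suc n - 1) * \<bar>a - b\<bar>"
    by (cases n) (simp_all add: algebra_simps)
  finally show ?case .
qed simp

lemma dist_prod_le: "dist (a, b) (a', b') \<le> dist a a' + dist b b'"
  by (simp add: dist_Pair_Pair sqrt_sum_squares_le_sum)

lemma sum_Basis_vec:
  fixes F :: "real^'n::finite \<Rightarrow> real"
  shows "(\<Sum>i\<in>Basis. F i) = (\<Sum>k\<in>UNIV. F (axis k 1))"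
proof -
  have "inj (\<lambda>k. axis k 1 :: real^'n)" by (auto simp: inj_def axis_eq_axis)
  moreover have "(Basis :: (real^'n) set) = (\<lambda>k. axis k 1) ` UNIV" by (auto simp: Basis_vec_def)
  ultimately show ?thesis by (metis sum.reindex_cong)
qed

context connected_riemannian begin

lemma power_difference_along_segment:
  fixes \<phi> :: "'m \<Rightarrow> real" and Y :: "real^'n \<Rightarrow> real^'n"
  assumes c: "c \<in> A" and K: "compact K" "K \<subseteq> cimage c" and Y: "continuous_on K Y"
    and \<phi>: "continuous_on UNIV \<phi>" "\<And>q. \<phi> q \<ge> 0" and \<kappa>: "\<kappa> \<ge> 0" "\<And>a b. \<bar>\<phi> a - \<phi> b\<bar> \<le> \<kappa> * d a b"
    and e: "e > 0"
  shows "\<exists>\<delta>>0. \<forall>x\<in>K. \<forall>y\<in>ball x \<delta>. \<forall>t\<in>{0<..<\<delta>}.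
    \<bar>\<phi> (param c (y + t *\<^sub>R Y x)) ^ n - \<phi> (param c y) ^ n\<bar>
      \<le> t * (n * \<phi> (param c x) ^ (n - 1) * \<kappa> * gnorm c x (Y x) + e)"
proof -
  obtain d0 K' where d0: "d0 > 0" and K': "compact K'" and K'im: "K' \<subseteq> cimage c"
    and K'I: "\<And>x y. x \<in> K \<Longrightarrow> dist x y \<le> d0 \<Longrightarrow> y \<in> K'"
    by (rule compact_neighbourhood[OF K(1) open_cimage[OF c] K(2)]) (rule that)
  let ?f = "\<lambda>y. \<phi> (param c y)"
  define H where "H = (\<lambda>(x, a, b, z). n * max (?f a) (?f b) ^ (n - 1) * \<kappa> * gnorm c z (Y x))"
  have cf: "continuous_on K' ?f"
    by (rule continuous_on_compose2[OF \<phi>(1) continuous_on_subset[OF continuous_on_param[OF c] K'im]]) auto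
  let ?P = "K \<times> K' \<times> K' \<times> K'"
  have "continuous_on ?P H"
    unfolding H_def split_beta
    by (intro continuous_intros continuous_on_gnorm[OF c] continuous_on_compose2[OF cf] continuous_on_compose2[OF Y])
      (use K'im in auto)
  then have "uniformly_continuous_on ?P H"
    by (rule compact_uniformly_continuous) (intro compact_Times K K')
  then obtain \<delta>1 where \<delta>1: "\<delta>1 > 0" "\<And>p q. p \<in> ?P \<Longrightarrow> q \<in> ?P \<Longrightarrow> dist q p < \<delta>1 \<Longrightarrow> dist (H q) (H p) < e"
    unfolding uniformly_continuous_on_def using e by metis
  obtain M where M: "M > 0" "\<And>x. x \<in> K \<Longrightarrow> norm (Y x) < M"
    using bounded_norm_lessE[OF compact_imp_bounded[OF compact_continuous_image[OF Y K(1)]]] by (metis imageI)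
  define \<delta> where "\<delta> = min (\<delta>1 / 3) d0 / (1 + M)"
  have \<delta>: "\<delta> > 0" using \<delta>1 d0 M by (simp add: \<delta>_def)
  have \<delta>M: "\<delta> * (1 + M) \<le> \<delta>1 / 3" "\<delta> * (1 + M) \<le> d0" using M by (auto simp: \<delta>_def)
  have main: "\<bar>?f (y + t *\<^sub>R Y x) ^ n - ?f y ^ n\<bar> \<le> t * (n * ?f x ^ (n - 1) * \<kappa> * gnorm c x (Y x) + e)"
    if x: "x \<in> K" and y: "y \<in> ball x \<delta>" and t: "t \<in> {0<..<\<delta>}" for x y t
  proof -
    let ?y = "y + t *\<^sub>R Y x"
    have near: "dist x z < \<delta> * (1 + M)" if z: "z \<in> closed_segment y ?y" for z
    proof -
      obtain u where u: "0 \<le> u" "u \<le> 1" "z = y + (u * t) *\<^sub>R Y x"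
        using z by (auto simp: closed_segment_def algebra_simps)
      have "u * t * norm (Y x) \<le> 1 * t * M"
        using u t M(2)[OF x] by (intro mult_mono) auto
      then have "norm ((u * t) *\<^sub>R Y x) \<le> t * M" using u t by (simp add: abs_mult)
      also have "\<dots> \<le> \<delta> * M" using t M by (intro mult_right_mono) auto
      finally have "norm ((u * t) *\<^sub>R Y x) \<le> \<delta> * M" .
      moreover have "dist x z \<le> dist x y + norm ((u * t) *\<^sub>R Y x)"
        unfolding u(3) using dist_triangle[of x "y + (u * t) *\<^sub>R Y x" y] by (simp add: dist_norm)
      ultimately show ?thesis using y by (simp add: algebra_simps)
    qed
    have seg: "closed_segment y ?y \<subseteq> K'"
      using near K'I[OF x] \<delta>M(2) by fastforce
    have yK: "y \<in> K'" "?y \<in> K'" "x \<in> K'" using seg K'I[OF x, of x] d0 by auto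
    define Q where "Q = n * max (?f y) (?f ?y) ^ (n - 1) * \<kappa>"
    define b where "b = n * ?f x ^ (n - 1) * \<kappa> * gnorm c x (Y x) + e"
    have Q0: "Q \<ge> 0" unfolding Q_def using \<phi>(2) \<kappa>(1) by (auto simp: max_def)
    have b0: "b \<ge> 0"
    proof -
      have "gnorm c x (Y x) \<ge> 0" using gnorm_nonneg[OF c] yK(3) K'im by blast
      then show ?thesis unfolding b_def using \<phi>(2) \<kappa>(1) e by (intro add_nonneg_nonneg mult_nonneg_nonneg) auto
    qed
    have Hb: "Q * gnorm c z (Y x) \<le> b" if z: "z \<in> closed_segment y ?y" for z
    proof -
      let ?p = "(x, x, x, x)" and ?q = "(x, y, ?y, z)"
      have d3: "dist ?q ?p \<le> dist y x + (dist ?y x + dist z x)"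
      proof -
        have "dist ?q ?p \<le> dist x x + dist (y, ?y, z) (x, x, x)" by (rule dist_prod_le)
        also have "\<dots> \<le> dist x x + (dist y x + dist (?y, z) (x, x))" by (intro add_left_mono dist_prod_le)
        also have "\<dots> \<le> dist x x + (dist y x + (dist ?y x + dist z x))" by (intro add_left_mono dist_prod_le)
        finally show ?thesis by simp
      qed
      have "dist ?q ?p < \<delta>1"
        using d3 near[OF z] near[of y] near[of ?y] \<delta>M(1) by (simp add: dist_commute)
      then have "dist (H ?q) (H ?p) < e"
        using \<delta>1(2)[of ?p ?q] x yK seg z by auto
      then show ?thesis unfolding H_def Q_def b_def by (simp add: dist_real_def max_def)
    qed
    have step: "\<bar>?f ?y ^ n - ?f y ^ n\<bar> \<le> Q * d (param c y) (param c ?y)"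
    proof -
      have "\<bar>?f ?y ^ n - ?f y ^ n\<bar> \<le> n * max (?f y) (?f ?y) ^ (n - 1) * \<bar>?f ?y - ?f y\<bar>"
        by (rule abs_power_diff_le) (use \<phi>(2) in auto)
      also have "\<dots> \<le> n * max (?f y) (?f ?y) ^ (n - 1) * (\<kappa> * d (param c ?y) (param c y))"
        using \<kappa>(2) \<phi>(2) by (intro mult_left_mono) (auto simp: max_def)
      finally show ?thesis by (simp add: Q_def riem_dist_commute[of "param c y"])
    qed
    show ?thesis
    proof (cases "Q = 0")
      case True
      then show ?thesis using step b0 t by (simp add: b_def)
    next
      case False
      have "d (param c y) (param c ?y) \<le> t * b / Q"
      proof (rule dist_segment_le[OF c])
        show "closed_segment y ?y \<subseteq> cimage c" using seg K'im by blast
        show "gnorm c z (?y - y) \<le> t * b / Q" if "z \<in> closed_segment y ?y" for z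
        proof -
          have "t * (Q * gnorm c z (Y x)) \<le> t * b" using Hb[OF that] t by (intro mult_left_mono) auto
          then show ?thesis using False Q0 t by (simp add: gnorm_scale field_simps)
        qed
      qed
      then have "Q * d (param c y) (param c ?y) \<le> Q * (t * b / Q)" using Q0 by (rule mult_left_mono)
      then show ?thesis using step False by (simp add: b_def)
    qed
  qed
  then show ?thesis using \<delta> by blast
qed

end


context weighted_riemannian begin

lemma C1_on_sqrt_det:
  assumes c: "c \<in> A" shows "C1_on (cimage c) (\<lambda>y. sqrt (det (G c y)))"
proof (rule C1_on_compose_real[OF C1_on_det_matrix[OF Ck_on_metric[OF c]]])
  show "(sqrt has_real_derivative inverse (sqrt t) / 2) (at t)" if "t \<in> (\<lambda>y. det (G c y)) ` cimage c" for t
    by (rule DERIV_real_sqrt) (use that det_metric_pos[OF c] in auto)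
  show "continuous_on ((\<lambda>y. det (G c y)) ` cimage c) (\<lambda>t. inverse (sqrt t) / 2)"
    by (intro continuous_intros) (auto dest: det_metric_pos[OF c])
qed

lemma divergence_weighted_grad:
  assumes c: "c \<in> A" and x: "x \<in> cimage c" and \<eta>: "Ck_fun A 1 \<eta>" and u: "Ck_fun A 2 u"
    and h: "(h has_real_derivative h') (at (u (param c x)))"
  defines "w \<equiv> \<lambda>y. exp (- f (param c y)) * (\<eta> (param c y) * h (u (param c y)))"
  shows "(\<Sum>k\<in>UNIV. frechet_derivative (\<lambda>y. w y * (sqrt (det (G c y)) * grad G c u y $ k)) (at x) (axis k 1))
    = chart_density c x * (\<eta> (param c x) * h (u (param c x)) * weighted_laplacian G f c u (param c x)
        + h (u (param c x)) * chart_pairing c \<eta> u x + \<eta> (param c x) * h' * chart_pairing c u u x)"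
proof -
  let ?q = "param c x" and ?U = "grad G c u x"
  have u1: "Ck_fun A 1 u" using u by (rule Ck_fun_mono) simp
  have f1: "Ck_fun A 1 f" using potential by (rule Ck_fun_mono) simp
  define s where "s = (\<lambda>y. sqrt (det (G c y)))"
  have sC1: "C1_on (cimage c) s" unfolding s_def by (rule C1_on_sqrt_det[OF c])
  have spos: "s x > 0" using det_metric_pos[OF c x] by (simp add: s_def)
  note Df = C1_fun_has_derivative[OF f1 c x, unfolded o_def]
    and D\<eta> = C1_fun_has_derivative[OF \<eta> c x, unfolded o_def]
    and Du = C1_fun_has_derivative[OF u1 c x, unfolded o_def]
  have Dh: "((\<lambda>y. h (u (param c y))) has_derivative (\<lambda>v. h' * dchart c u x v)) (at x)"
    using has_derivative_compose[OF Du, of h "(*) h'"] h by (simp add: has_field_derivative_def o_def)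
  have De: "((\<lambda>y. exp (- f (param c y))) has_derivative (\<lambda>v. - exp (- f ?q) * dchart c f x v)) (at x)"
    by (rule has_derivative_eq_rhs[OF has_derivative_compose[OF has_derivative_minus[OF Df]
          has_field_derivative_imp_has_derivative[OF DERIV_exp]]]) (simp add: o_def)
  define w' where "w' = (\<lambda>v. exp (- f ?q) * (\<eta> ?q * (h' * dchart c u x v) + dchart c \<eta> x v * h (u ?q))
      + - exp (- f ?q) * dchart c f x v * (\<eta> ?q * h (u ?q)))"
  have Dw: "(w has_derivative w') (at x)"
    unfolding w_def w'_def
    using has_derivative_mult[OF De has_derivative_mult[OF D\<eta> Dh]] by (simp add: o_def)
  have lin: "linear w'" using Dw has_derivative_linear by blast
  define g where "g = (\<lambda>k y. s y * grad G c u y $ k)"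
  have gC1: "C1_on (cimage c) (g k)" for k
    unfolding g_def by (intro C1_on_mult sC1 C1_on_grad u c)
  have Dg: "(g k has_derivative frechet_derivative (g k) (at x)) (at x)" for k
    by (rule C1_on_has_derivative[OF gC1 x])
  have "frechet_derivative (\<lambda>y. w y * g k y) (at x) = (\<lambda>v. w x * frechet_derivative (g k) (at x) v + w' v * g k x)" for k
    using frechet_derivative_at[OF has_derivative_mult[OF Dw Dg]] by simp
  then have "(\<Sum>k\<in>UNIV. frechet_derivative (\<lambda>y. w y * g k y) (at x) (axis k 1))
      = w x * (\<Sum>k\<in>UNIV. frechet_derivative (g k) (at x) (axis k 1)) + (\<Sum>k\<in>UNIV. w' (axis k 1) * g k x)"
    by (simp add: sum.distrib sum_distrib_left)
  also have "(\<Sum>k\<in>UNIV. w' (axis k 1) * g k x) = s x * w' ?U"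
    using linear_eq_sum_axis[OF lin, of ?U] by (simp add: g_def sum_distrib_left mult_ac)
  also have "(\<Sum>k\<in>UNIV. frechet_derivative (g k) (at x) (axis k 1)) = s x * laplacian G c u x"
    using spos by (simp add: laplacian_def divergence_def partial_def g_def s_def)
  also have "laplacian G c u x = weighted_laplacian G f c u ?q + dchart c f x ?U"
    using metric_symmetric[OF c x, of "grad G c f x" ?U] metric_grad[OF f1 c x, of ?U] x c
    by (simp add: weighted_laplacian_def Let_def)
  finally show ?thesis
    unfolding g_def s_def w'_def
    by (simp add: w_def chart_density_def chart_pairing_def algebra_simps)
qed

lemma gnorm_grad_square:
  assumes "c \<in> A" "x \<in> cimage c" "Ck_fun A 1 u"
  shows "(gnorm c x (grad G c u x))\<^sup>2 = chart_pairing c u u x"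
proof -
  have "grad G c u x \<bullet> (G c x *v grad G c u x) \<ge> 0"
    using metric_pos[OF assms(1,2), of "grad G c u x"] by (cases "grad G c u x = 0") (auto simp: less_imp_le)
  then show ?thesis using metric_grad[OF assms(3,1,2)] by (simp add: gnorm_def chart_pairing_def)
qed

lemma local_inequality:
  fixes \<eta> u \<phi> :: "'m \<Rightarrow> real" and h h' :: "real \<Rightarrow> real"
  assumes c: "c \<in> A" and \<eta>: "Ck_fun A 1 \<eta>" "\<And>q. \<eta> q \<ge> 0"
    and C: "compact C" "C \<subseteq> cdom c" "\<And>q. q \<notin> C \<Longrightarrow> \<eta> q = 0"
    and u: "Ck_fun A 2 u" "\<And>q. u q \<ge> 0" and p: "p > 1" and sol: "solves_lane_emden A G f p u"
    and h: "\<And>s. s \<ge> 0 \<Longrightarrow> (h has_real_derivative h' s) (at s)" "continuous_on {0..} h'"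
      "\<And>s. s \<ge> 0 \<Longrightarrow> h s > 0" "\<And>s. s \<ge> 0 \<Longrightarrow> h' s < 0"
    and \<phi>: "continuous_on UNIV \<phi>" "\<And>q. \<phi> q \<ge> 0" and \<kappa>: "\<kappa> \<ge> 0" "\<And>a b. \<bar>\<phi> a - \<phi> b\<bar> \<le> \<kappa> * d a b"
    and n: "n \<ge> 2"
  defines "Z \<equiv> \<lambda>q. (n * \<kappa> / 2)\<^sup>2 * (h (u q))\<^sup>2 / (- h' (u q)) * \<phi> q ^ (n - 2) - \<phi> q ^ n * h (u q) * u q powr p"
  defines "W \<equiv> \<lambda>q. \<eta> q * Z q + \<phi> q ^ n * h (u q) * grad_pairing \<eta> u q"
  shows "integrable \<mu> W" "(\<integral>q. W q \<partial>\<mu>) \<ge> 0" "continuous_on UNIV Z"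
proof -
  have u1: "Ck_fun A 1 u" using u(1) by (rule Ck_fun_mono) simp
  have cu: "continuous_on UNIV u" by (rule C1_fun_continuous_on[OF u1])
  have ch: "continuous_on {0..} h"
    using h(1) by (auto intro!: continuous_at_imp_continuous_on DERIV_isCont)
  have chu: "continuous_on UNIV (\<lambda>q. h (u q))" "continuous_on UNIV (\<lambda>q. h' (u q))"
    using u(2) by (auto intro!: continuous_on_compose2[OF ch cu] continuous_on_compose2[OF h(2) cu])
  have h'nz: "h' (u q) \<noteq> 0" for q using h(4)[OF u(2), of q] by simp
  show cZ: "continuous_on UNIV Z"
    unfolding Z_def using h'nz u(2) p
    by (intro continuous_intros chu \<phi>(1) continuous_on_powr' cu) auto
  have cW: "continuous_on UNIV W"
    unfolding W_def by (intro continuous_intros cZ chu \<phi>(1) continuous_on_grad_pairing \<eta>(1) u(1) C1_fun_continuous_on)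
  have W0: "W q = 0" if "q \<notin> C" for q
  proof -
    have "grad_pairing \<eta> u q = 0"
      by (rule grad_pairing_eq_0[OF \<eta>(1), of "- C"]) (use that C in \<open>auto intro: compact_imp_closed\<close>)
    then show ?thesis using C(3)[OF that] by (simp add: W_def)
  qed
  show "integrable \<mu> W" by (rule integrable_continuous_compact_support[OF cW C(1) W0])

  define K where "K = coord c ` C"
  have K: "compact K" unfolding K_def
    by (rule compact_continuous_image[OF continuous_on_subset[OF continuous_on_coord[OF c] C(2)] C(1)])
  have Kim: "K \<subseteq> cimage c" unfolding K_def using C(2) c by auto
  have notK: "param c x \<notin> C" if "x \<in> cimage c" "x \<notin> K" for x
    using that c unfolding K_def by (metis coord_param image_eqI)
  have oK: "open (- K)" using K compact_imp_closed by blast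
  define w where "w = (\<lambda>y. exp (- f (param c y)) * (\<eta> (param c y) * h (u (param c y))))"
  define Y where "Y = (\<lambda>x. if x \<in> cimage c then (w x * sqrt (det (G c x))) *\<^sub>R grad G c u x else 0)"
  have w0: "w x = 0" if "x \<in> cimage c" "x \<notin> K" for x
    using C(3)[OF notK[OF that]] by (simp add: w_def)
  have Y0: "Y x = 0" if "x \<notin> K" for x using w0[of x] that by (simp add: Y_def)
  have f1: "Ck_fun A 1 f" using potential by (rule Ck_fun_mono) simp
  have comp: "C1_on (cimage c) (\<lambda>x. a (param c x))" if "Ck_fun A 1 a" for a
    using that c unfolding Ck_fun_def o_def by blast
  have wC1: "C1_on (cimage c) w" unfolding w_def
  proof (intro C1_on_mult)
    show "C1_on (cimage c) (\<lambda>x. \<eta> (param c x))" by (rule comp[OF \<eta>(1)])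
    have "C1_on (cimage c) (\<lambda>x. (- 1) * f (param c x))" by (intro C1_on_mult C1_on_const comp f1)
    then have "C1_on (cimage c) (\<lambda>x. exp ((- 1) * f (param c x)))"
      by (rule C1_on_compose_real[OF _ DERIV_exp]) (intro continuous_intros)
    then show "C1_on (cimage c) (\<lambda>x. exp (- f (param c x)))" by simp
    show "C1_on (cimage c) (\<lambda>x. h (u (param c x)))"
    proof (rule C1_on_compose_real[OF comp[OF u1]])
      show "continuous_on ((\<lambda>x. u (param c x)) ` cimage c) h'"
        by (rule continuous_on_subset[OF h(2)]) (use u(2) in auto)
    qed (use u(2) h(1) in auto)
  qed
  have sC1: "C1_on (cimage c) (\<lambda>y. sqrt (det (G c y)))" by (rule C1_on_sqrt_det[OF c])
  have YC1: "C1_on UNIV (\<lambda>x. Y x $ k)" for k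
  proof -
    have "C1_on (cimage c) (\<lambda>x. w x * (sqrt (det (G c x)) * grad G c u x $ k))"
      by (intro C1_on_mult wC1 sC1 C1_on_grad u c)
    then have "C1_on (cimage c) (\<lambda>x. Y x $ k)"
      by (rule C1_on_cong[OF open_cimage[OF c]]) (simp add: Y_def)
    moreover have "C1_on (- K) (\<lambda>x. Y x $ k)"
      by (rule C1_on_cong[OF oK C1_on_const[of _ 0]]) (simp add: Y0)
    ultimately have "C1_on (cimage c \<union> - K) (\<lambda>x. Y x $ k)" by (rule C1_on_Un[OF open_cimage[OF c] oK])
    moreover have "cimage c \<union> - K = UNIV" using Kim by auto
    ultimately show ?thesis by simp
  qed
  define F where "F = (\<lambda>i x. frechet_derivative (\<lambda>y. Y y \<bullet> i) (at x) i)"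
  have YC1': "C1_on UNIV (\<lambda>x. Y x \<bullet> i)" if i: "i \<in> Basis" for i
  proof -
    obtain k where "i = axis k 1" using i by (auto simp: Basis_vec_def)
    then show ?thesis using YC1[of k] by (simp add: inner_axis)
  qed
  have cY: "continuous_on S Y" for S
  proof -
    have "continuous_on UNIV Y"
      using YC1' C1_on_imp_continuous_on by (subst continuous_on_componentwise) blast
    then show ?thesis by (rule continuous_on_subset) simp
  qed
  let ?f = "\<lambda>x. \<phi> (param c x)"
  define b where "b = (\<lambda>x. n * ?f x ^ (n - 1) * \<kappa> * gnorm c x (Y x))"
  have cf: "continuous_on (cimage c) ?f"
    by (rule continuous_on_compose2[OF \<phi>(1) continuous_on_param[OF c]]) auto
  have cb: "continuous_on K b"
    unfolding b_def by (intro continuous_intros continuous_on_gnorm[OF c] cY continuous_on_subset[OF cf]) (use Kim in auto)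
  have wd: "\<bar>\<integral>x. indicator K x * (?f x ^ n * (\<Sum>i\<in>Basis. F i x)) \<partial>lborel\<bar> \<le> (\<integral>x. indicator K x * b x \<partial>lborel)"
  proof (rule abs_integral_mult_divergence_le[OF K open_cimage[OF c] Kim])
    show "continuous_on (cimage c) (\<lambda>x. ?f x ^ n)" by (intro continuous_intros cf)
    show "((\<lambda>t. Y (x + t *\<^sub>R i) \<bullet> i) has_real_derivative F i x) (at 0)" if i: "i \<in> Basis" for i x
    proof -
      let ?D = "frechet_derivative (\<lambda>y. Y y \<bullet> i) (at x)"
      have D: "((\<lambda>y. Y y \<bullet> i) has_derivative ?D) (at x)"
        by (rule C1_on_has_derivative[OF YC1'[OF i]]) simp
      have "((\<lambda>t. x + t *\<^sub>R i) has_derivative (\<lambda>t. t *\<^sub>R i)) (at 0)"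
        by (auto intro!: derivative_eq_intros)
      from has_derivative_compose[OF this, of "\<lambda>y. Y y \<bullet> i" ?D] D
      have "((\<lambda>t. Y (x + t *\<^sub>R i) \<bullet> i) has_derivative (\<lambda>t. ?D (t *\<^sub>R i))) (at 0)" by simp
      then show ?thesis
        unfolding has_field_derivative_def F_def
        by (rule has_derivative_eq_rhs) (auto simp: linear_scale[OF has_derivative_linear[OF D]] mult.commute)
    qed
    show "continuous_on UNIV (F i)" if "i \<in> Basis" for i
      unfolding F_def by (rule C1_on_continuous_derivative[OF YC1'[OF that]])
    show "\<exists>\<delta>>0. \<forall>x\<in>K. \<forall>y\<in>ball x \<delta>. \<forall>t\<in>{0<..<\<delta>}. \<bar>?f (y + t *\<^sub>R Y x) ^ n - ?f y ^ n\<bar> \<le> t * (b x + e)"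
      if "e > 0" for e
      unfolding b_def by (rule power_difference_along_segment[OF c K Kim cY \<phi> \<kappa> that])
  qed (use cY Y0 cb in auto)
  define S where "S = (\<lambda>x. \<Sum>i\<in>Basis. F i x)"
  have S_eq: "S x = chart_density c x * (- (\<eta> (param c x) * h (u (param c x)) * u (param c x) powr p)
      + h (u (param c x)) * chart_pairing c \<eta> u x + \<eta> (param c x) * h' (u (param c x)) * chart_pairing c u u x)"
    if x: "x \<in> cimage c" for x
  proof -
    have "frechet_derivative (\<lambda>y. Y y \<bullet> axis k 1) (at x)
        = frechet_derivative (\<lambda>y. w y * (sqrt (det (G c y)) * grad G c u y $ k)) (at x)" for k
    proof -
      have "C1_on (cimage c) (\<lambda>y. w y * (sqrt (det (G c y)) * grad G c u y $ k))"
        by (intro C1_on_mult wC1 sC1 C1_on_grad u c)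
      from has_derivative_transform_within_open[OF C1_on_has_derivative[OF this x] open_cimage[OF c] x]
      have "((\<lambda>y. Y y \<bullet> axis k 1) has_derivative
          frechet_derivative (\<lambda>y. w y * (sqrt (det (G c y)) * grad G c u y $ k)) (at x)) (at x)"
        by (simp add: Y_def inner_axis)
      then show ?thesis by (rule frechet_derivative_at[symmetric])
    qed
    then have "S x = (\<Sum>k\<in>UNIV. frechet_derivative (\<lambda>y. w y * (sqrt (det (G c y)) * grad G c u y $ k)) (at x) (axis k 1))"
      unfolding S_def F_def sum_Basis_vec by simp
    also have "\<dots> = chart_density c x * (\<eta> (param c x) * h (u (param c x)) * weighted_laplacian G f c u (param c x)
        + h (u (param c x)) * chart_pairing c \<eta> u x + \<eta> (param c x) * h' (u (param c x)) * chart_pairing c u u x)"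
      unfolding w_def by (rule divergence_weighted_grad[OF c x \<eta>(1) u(1) h(1)[OF u(2)]])
    also have "weighted_laplacian G f c u (param c x) = - (u (param c x) powr p)"
      using sol c x unfolding solves_lane_emden_def by (metis param_in_cdom minus_equation_iff)
    finally show ?thesis by simp
  qed
  have young: "b x + ?f x ^ n * S x \<le> chart_density c x * W (param c x)" if x: "x \<in> cimage c" for x
  proof -
    let ?q = "param c x" and ?N = "gnorm c x (grad G c u x)"
    define a where "a = - h' (u ?q)"
    have a: "a > 0" unfolding a_def using h(4)[OF u(2)] by simp
    have \<rho>: "chart_density c x > 0" by (rule chart_density_pos[OF c x])
    have q: "?q \<in> cdom c" using c x by simp
    have hp: "h (u ?q) > 0" by (rule h(3)[OF u(2)])
    have "Y x = (chart_density c x * (\<eta> ?q * h (u ?q))) *\<^sub>R grad G c u x"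
      using x by (simp add: Y_def w_def chart_density_def mult_ac)
    then have "gnorm c x (Y x) = chart_density c x * (\<eta> ?q * h (u ?q)) * ?N"
      using \<rho> hp \<eta>(2)[of ?q] by (simp add: gnorm_scale abs_mult)
    then have b_eq: "b x = chart_density c x * (\<eta> ?q * (n * \<kappa> * ?f x ^ (n - 1) * h (u ?q) * ?N))"
      by (simp add: b_def mult_ac)
    have sq: "chart_pairing c u u x = ?N\<^sup>2" using gnorm_grad_square[OF c x u1] by simp
    have pr: "chart_pairing c \<eta> u x = grad_pairing \<eta> u ?q"
      using grad_pairing_chart[OF \<eta>(1) u1 c q] x c by simp
    have pow: "?f x ^ n = ?f x ^ (n - 2) * (?f x)\<^sup>2" "?f x ^ (n - 1) = ?f x ^ (n - 2) * ?f x"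
      using n by (simp_all add: power_add[symmetric] power_Suc2[symmetric] Suc_diff_Suc numeral_2_eq_2 del: power_Suc)
    have core: "n * \<kappa> * ?f x ^ (n - 1) * h (u ?q) * ?N - ?f x ^ n * a * ?N\<^sup>2
        \<le> (n * \<kappa> / 2)\<^sup>2 * (h (u ?q))\<^sup>2 / a * ?f x ^ (n - 2)"
    proof -
      have "0 \<le> (n * \<kappa> / 2 * h (u ?q) - a * ?f x * ?N)\<^sup>2 / a" using a by simp
      also have "\<dots> = (n * \<kappa> / 2)\<^sup>2 * (h (u ?q))\<^sup>2 / a - n * \<kappa> * h (u ?q) * ?f x * ?N + a * (?f x)\<^sup>2 * ?N\<^sup>2"
        using a by (simp add: power2_eq_square field_simps)
      finally have "n * \<kappa> * h (u ?q) * ?f x * ?N - a * (?f x)\<^sup>2 * ?N\<^sup>2 \<le> (n * \<kappa> / 2)\<^sup>2 * (h (u ?q))\<^sup>2 / a" by simp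
      then have "?f x ^ (n - 2) * (n * \<kappa> * h (u ?q) * ?f x * ?N - a * (?f x)\<^sup>2 * ?N\<^sup>2)
          \<le> ?f x ^ (n - 2) * ((n * \<kappa> / 2)\<^sup>2 * (h (u ?q))\<^sup>2 / a)"
        using \<phi>(2) by (intro mult_left_mono) auto
      then show ?thesis unfolding pow by (simp add: algebra_simps)
    qed
    have "b x + ?f x ^ n * S x = chart_density c x *
       (\<eta> ?q * (n * \<kappa> * ?f x ^ (n - 1) * h (u ?q) * ?N - ?f x ^ n * a * ?N\<^sup>2)
        - \<eta> ?q * (?f x ^ n * h (u ?q) * u ?q powr p) + ?f x ^ n * h (u ?q) * grad_pairing \<eta> u ?q)"
      unfolding b_eq S_eq[OF x] sq pr a_def by (simp add: algebra_simps)
    also have "\<dots> \<le> chart_density c x *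
       (\<eta> ?q * ((n * \<kappa> / 2)\<^sup>2 * (h (u ?q))\<^sup>2 / a * ?f x ^ (n - 2))
        - \<eta> ?q * (?f x ^ n * h (u ?q) * u ?q powr p) + ?f x ^ n * h (u ?q) * grad_pairing \<eta> u ?q)"
      using \<rho> \<eta>(2)[of ?q] core by (intro mult_left_mono add_right_mono diff_right_mono) auto
    also have "\<dots> = chart_density c x * W ?q"
      unfolding W_def Z_def a_def by (simp add: algebra_simps)
    finally show ?thesis .
  qed
  have cS: "continuous_on K S"
  proof -
    have "continuous_on UNIV (F i)" if "i \<in> Basis" for i
      unfolding F_def by (rule C1_on_continuous_derivative[OF YC1'[OF that]])
    then have "continuous_on UNIV S" unfolding S_def by (intro continuous_on_sum)
    then show ?thesis by (rule continuous_on_subset) simp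
  qed
  have i1: "integrable lborel (\<lambda>x. indicator K x * b x)"
    by (rule integrable_indicator_mult_continuous[OF K cb])
  have i2: "integrable lborel (\<lambda>x. indicator K x * (?f x ^ n * S x))"
    by (intro integrable_indicator_mult_continuous[OF K] continuous_intros cS continuous_on_subset[OF cf Kim])
  have i3: "integrable lborel (\<lambda>x. indicator K x * (chart_density c x * W (param c x)))"
  proof (intro integrable_indicator_mult_continuous[OF K] continuous_intros)
    show "continuous_on K (chart_density c)"
      by (rule continuous_on_subset[OF continuous_on_chart_density[OF c] Kim])
    show "continuous_on K (\<lambda>x. W (param c x))"
      by (rule continuous_on_compose2[OF cW continuous_on_subset[OF continuous_on_param[OF c] Kim]]) simp
  qed
  have "0 \<le> (\<integral>x. indicator K x * b x \<partial>lborel) + (\<integral>x. indicator K x * (?f x ^ n * S x) \<partial>lborel)"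
    using wd unfolding S_def by linarith
  also have "\<dots> = (\<integral>x. indicator K x * b x + indicator K x * (?f x ^ n * S x) \<partial>lborel)"
    by (rule Bochner_Integration.integral_add[symmetric, OF i1 i2])
  also have "\<dots> \<le> (\<integral>x. indicator K x * (chart_density c x * W (param c x)) \<partial>lborel)"
  proof (rule integral_mono[OF Bochner_Integration.integrable_add[OF i1 i2] i3])
    show "indicator K x * b x + indicator K x * (?f x ^ n * S x) \<le> indicator K x * (chart_density c x * W (param c x))" for x
      using young[of x] Kim by (cases "x \<in> K") auto
  qed
  also have "\<dots> = (\<integral>x. indicator (cimage c) x * chart_density c x * W (param c x) \<partial>lborel)"
  proof (rule Bochner_Integration.integral_cong[OF refl])
    show "indicator K x * (chart_density c x * W (param c x)) = indicator (cimage c) x * chart_density c x * W (param c x)" for x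
      using Kim W0[OF notK[of x]] by (cases "x \<in> K"; cases "x \<in> cimage c") auto
  qed
  also have "\<dots> = (\<integral>q. W q \<partial>\<mu>)"
    by (rule integral_chart[OF c, symmetric])
      (use W0 C(2) in \<open>auto intro!: borel_measurable_continuous_onI[OF cW]\<close>)
  finally show "(\<integral>q. W q \<partial>\<mu>) \<ge> 0" .
qed

end

section \<open>Energy estimate and conclusion\<close>

lemma powr_le_absorb:
  fixes p q \<delta> :: real
  assumes "0 < q" "q < p" "\<delta> > 0"
  obtains C where "C \<ge> 0" "\<And>y. y \<ge> 0 \<Longrightarrow> (1 + y) powr q \<le> \<delta> * y powr p + C"
proof -
  define B where "B = 2 powr q / \<delta>"
  define M where "M = max 1 (B powr (1 / (p - q)))"
  have B: "B > 0" using assms by (simp add: B_def)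
  have M: "M \<ge> 1" "M \<ge> B powr (1 / (p - q))" by (auto simp: M_def)
  show thesis
  proof (rule that[of "(1 + M) powr q"])
    fix y :: real assume y: "y \<ge> 0"
    show "(1 + y) powr q \<le> \<delta> * y powr p + (1 + M) powr q"
    proof (cases "y \<le> M")
      case True
      then have "(1 + y) powr q \<le> (1 + M) powr q" using y assms by (intro powr_mono2) auto
      moreover have "\<delta> * y powr p \<ge> 0" using assms by simp
      ultimately show ?thesis by simp
    next
      case False
      then have y1: "y \<ge> 1" using M by simp
      have "B = (B powr (1 / (p - q))) powr (p - q)" using B assms by (simp add: powr_powr)
      also have "\<dots> \<le> y powr (p - q)" using False M assms by (intro powr_mono2) auto
      finally have "2 powr q \<le> \<delta> * y powr (p - q)" using assms by (simp add: B_def field_simps)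
      then have "2 powr q * y powr q \<le> \<delta> * y powr (p - q) * y powr q" by (intro mult_right_mono) auto
      also have "\<dots> = \<delta> * y powr p" by (simp add: powr_add[symmetric])
      finally have "2 powr q * y powr q \<le> \<delta> * y powr p" .
      moreover have "(1 + y) powr q \<le> (2 * y) powr q" using y1 assms by (intro powr_mono2) auto
      moreover have "(2 * y) powr q = 2 powr q * y powr q" using y by (simp add: powr_mult)
      ultimately show ?thesis using powr_ge_zero[of "1 + M" q] by linarith
    qed
  qed simp
qed

lemma powr_le_absorb_cutoff:
  fixes p q \<delta> C t v :: real
  assumes pq: "0 < q" "q < p" and n: "n > 2" "real n \<ge> 2 * p / (p - q)" and "\<delta> > 0" "C \<ge> 0"
    and absorb: "\<And>y. y \<ge> 0 \<Longrightarrow> (1 + y) powr q \<le> \<delta> * y powr p + C"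
    and t: "0 \<le> t" "t \<le> 1" and v: "v \<ge> 0"
  shows "t ^ (n - 2) * (1 + v) powr q \<le> \<delta> * (v powr p * t ^ n) + C"
proof (cases "t = 0")
  case True
  then show ?thesis using n assms by (simp add: power_0_left)
next
  case False
  then have t0: "t > 0" using t by simp
  define \<alpha> where "\<alpha> = t powr (real (n - 2) / q)"
  define \<beta> where "\<beta> = t powr (n / p)"
  have "2 * p \<le> n * (p - q)" using n(2) pq by (simp add: field_simps)
  then have "n / p \<le> real (n - 2) / q" using n(1) pq by (simp add: field_simps of_nat_diff)
  then have "\<alpha> \<le> \<beta>" unfolding \<alpha>_def \<beta>_def using t by (intro powr_mono') auto
  moreover have "\<alpha> \<le> 1" unfolding \<alpha>_def using t pq by (intro powr_le1) auto
  ultimately have le: "\<alpha> * (1 + v) \<le> 1 + \<beta> * v" using v by (simp add: distrib_left add_mono mult_right_mono)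
  have "t ^ (n - 2) = \<alpha> powr q" unfolding \<alpha>_def using t0 pq by (simp add: powr_powr powr_realpow)
  then have "t ^ (n - 2) * (1 + v) powr q = (\<alpha> * (1 + v)) powr q"
    using v by (simp add: powr_mult \<alpha>_def)
  also have "\<dots> \<le> (1 + \<beta> * v) powr q" using le v pq by (intro powr_mono2) (auto simp: \<alpha>_def)
  also have "\<dots> \<le> \<delta> * (\<beta> * v) powr p + C" using v by (intro absorb) (simp add: \<beta>_def)
  also have "(\<beta> * v) powr p = v powr p * t ^ n"
  proof -
    have "\<beta> powr p = t ^ n" unfolding \<beta>_def using t0 pq by (simp add: powr_powr powr_realpow)
    then show ?thesis using v by (simp add: powr_mult \<beta>_def)
  qed
  finally show ?thesis .
qed

context weighted_riemannian begin

lemma global_inequality: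
  fixes u \<phi> :: "'m \<Rightarrow> real" and h h' :: "real \<Rightarrow> real"
  assumes u: "Ck_fun A 2 u" "\<And>q. u q \<ge> 0" and p: "p > 1" and sol: "solves_lane_emden A G f p u"
    and h: "\<And>s. s \<ge> 0 \<Longrightarrow> (h has_real_derivative h' s) (at s)" "continuous_on {0..} h'"
      "\<And>s. s \<ge> 0 \<Longrightarrow> h s > 0" "\<And>s. s \<ge> 0 \<Longrightarrow> h' s < 0"
    and \<phi>: "continuous_on UNIV \<phi>" "\<And>q. \<phi> q \<ge> 0" and \<kappa>: "\<kappa> \<ge> 0" "\<And>a b. \<bar>\<phi> a - \<phi> b\<bar> \<le> \<kappa> * d a b"
    and n: "n > 2" and K: "compact K" "\<And>q. q \<notin> K \<Longrightarrow> \<phi> q = 0"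
  defines "Z \<equiv> \<lambda>q. (n * \<kappa> / 2)\<^sup>2 * (h (u q))\<^sup>2 / (- h' (u q)) * \<phi> q ^ (n - 2) - \<phi> q ^ n * h (u q) * u q powr p"
  shows "integrable \<mu> Z" "(\<integral>q. Z q \<partial>\<mu>) \<ge> 0"
proof -
  have n2: "n \<ge> 2" using n by simp
  obtain I :: "'m set" and \<eta> :: "'m \<Rightarrow> 'm \<Rightarrow> real" and c C V where pu:
    "finite I" "\<And>i. Ck_fun A 1 (\<eta> i)" "\<And>i q. \<eta> i q \<ge> 0" "\<And>i. c i \<in> A" "\<And>i. compact (C i)"
    "\<And>i. C i \<subseteq> cdom (c i)" "\<And>i q. q \<notin> C i \<Longrightarrow> \<eta> i q = 0"
    "open V" "K \<subseteq> V" "\<And>q. q \<in> V \<Longrightarrow> (\<Sum>i\<in>I. \<eta> i q) = 1"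
    by (rule C1_partition_of_unity[OF K(1)]) (rule that)
  define W where "W = (\<lambda>i q. \<eta> i q * Z q + \<phi> q ^ n * h (u q) * grad_pairing (\<eta> i) u q)"
  note li = local_inequality[OF pu(4) pu(2) pu(3) pu(5) pu(6) pu(7) u p sol h \<phi> \<kappa> n2]
  have W: "integrable \<mu> (W i)" for i unfolding W_def Z_def by (rule li(1))
  have W_nonneg: "(\<integral>q. W i q \<partial>\<mu>) \<ge> 0" for i unfolding W_def Z_def by (rule li(2))
  have cZ: "continuous_on UNIV Z"
    unfolding Z_def by (rule li(3))
  have Z0: "Z q = 0" if "q \<notin> K" for q using K(2)[OF that] n by (simp add: Z_def power_0_left)
  show "integrable \<mu> Z" by (rule integrable_continuous_compact_support[OF cZ K(1) Z0])
  have "Z q = (\<Sum>i\<in>I. W i q)" for q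
  proof (cases "q \<in> K")
    case True
    then have q: "q \<in> V" using pu(9) by blast
    have "(\<Sum>i\<in>I. W i q) = (\<Sum>i\<in>I. \<eta> i q) * Z q + \<phi> q ^ n * h (u q) * (\<Sum>i\<in>I. grad_pairing (\<eta> i) u q)"
      by (simp add: W_def sum.distrib sum_distrib_left sum_distrib_right)
    also have "(\<Sum>i\<in>I. grad_pairing (\<eta> i) u q) = 0"
      by (rule sum_grad_pairing_eq_0[OF pu(1) pu(2) pu(8) q pu(10)])
    finally show ?thesis using pu(10)[OF q] by simp
  qed (use K(2) Z0 n in \<open>simp add: W_def power_0_left\<close>)
  then have "(\<integral>q. Z q \<partial>\<mu>) = (\<integral>q. (\<Sum>i\<in>I. W i q) \<partial>\<mu>)" by presburger
  also have "\<dots> = (\<Sum>i\<in>I. \<integral>q. W i q \<partial>\<mu>)" using W by (rule Bochner_Integration.integral_sum)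
  also have "\<dots> \<ge> 0" using W_nonneg by (rule sum_nonneg)
  finally show "(\<integral>q. Z q \<partial>\<mu>) \<ge> 0" .
qed

lemma energy_estimate:
  assumes complete: mcomplete and u: "Ck_fun A 2 u" "\<And>q. u q \<ge> 0" and p: "p > 1"
    and sol: "solves_lane_emden A G f p u"
  obtains C where "C \<ge> 0"
    "\<And>R V \<epsilon>. R > 0 \<Longrightarrow> V \<in> sets borel \<Longrightarrow> V \<subseteq> mball a R \<Longrightarrow> \<epsilon> \<ge> 0 \<Longrightarrow> (\<And>q. q \<in> V \<Longrightarrow> \<epsilon> \<le> u q) \<Longrightarrow>
      \<epsilon> powr p * measure \<mu> V \<le> C * R powr (- (2 * p / (p - 1))) * measure \<mu> (mball a (2 * R))"
proof -
  define \<tau> where "\<tau> = (p - 1) / 2"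
  define q where "q = 1 + \<tau>"
  have \<tau>: "\<tau> > 0" and q: "0 < q" "q < p" using p by (auto simp: \<tau>_def q_def field_simps)
  define n where "n = nat \<lceil>2 * p / (p - q)\<rceil> + 3"
  have "real n \<ge> 2 * p / (p - q)" unfolding n_def by linarith
  then have n: "n > 2" "real n \<ge> 2 * p / (p - q)" by (auto simp: n_def)
  define \<delta> where "\<delta> = \<tau> / (2 * n\<^sup>2)"
  have \<delta>: "\<delta> > 0" using \<tau> n by (simp add: \<delta>_def)
  obtain C where C: "C \<ge> 0" "\<And>y. y \<ge> 0 \<Longrightarrow> (1 + y) powr q \<le> \<delta> * y powr p + C"
    using powr_le_absorb[OF q \<delta>] by blast
  show thesis
  proof (rule that[of "2 * n\<^sup>2 * C / \<tau>"])
    show "2 * n\<^sup>2 * C / \<tau> \<ge> 0" using C \<tau> by simp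
    fix R V \<epsilon>
    assume R: "R > (0::real)" and V: "V \<in> sets borel" "V \<subseteq> mball a R" "\<epsilon> \<ge> 0" "\<And>q. q \<in> V \<Longrightarrow> \<epsilon> \<le> u q"
    define \<phi> where "\<phi> = (\<lambda>q. max 0 (min 1 (2 - d a q / R)))"
    have \<phi>: "continuous_on UNIV \<phi>" "\<And>q. \<phi> q \<ge> 0" "\<And>q. \<phi> q \<le> 1"
      unfolding \<phi>_def using R by (auto intro!: continuous_intros continuous_on_dist)
    have lip: "\<bar>\<phi> x - \<phi> y\<bar> \<le> 1 / R * d x y" for x y
    proof -
      have "\<bar>\<phi> x - \<phi> y\<bar> \<le> \<bar>d a x / R - d a y / R\<bar>" unfolding \<phi>_def by linarith
      also have "\<dots> = \<bar>d a x - d a y\<bar> / R" using R by (simp add: diff_divide_distrib[symmetric] abs_divide)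
      also have "\<bar>d a x - d a y\<bar> \<le> d x y"
        using riem_dist_triangle[of a y x] riem_dist_triangle[of a x y] riem_dist_commute[of x y] by simp
      finally show ?thesis using R by (simp add: divide_right_mono)
    qed
    have \<phi>0: "\<phi> x = 0" if "x \<notin> mball a (2 * R)" for x
      using that R by (simp add: \<phi>_def field_simps)
    have \<phi>1: "\<phi> x = 1" if "x \<in> mball a R" for x
      using that R by (simp add: \<phi>_def field_simps)
    obtain K where K: "compact K" "mball a (2 * R) \<subseteq> K" by (rule mball_subset_compact[OF complete])
    define \<sigma> where "\<sigma> = R powr (- (2 / (p - 1)))"
    have \<sigma>: "\<sigma> > 0" using R by (simp add: \<sigma>_def)
    have \<sigma>R: "\<sigma> / R\<^sup>2 = R powr (- (2 * p / (p - 1)))"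
    proof -
      have "\<sigma> / R\<^sup>2 = R powr (- (2 / (p - 1)) - 2)"
        using R by (simp add: \<sigma>_def powr_diff)
      also have "- (2 / (p - 1)) - 2 = - (2 * p / (p - 1))" using p by (simp add: field_simps)
      finally show ?thesis .
    qed
    have \<sigma>p: "\<sigma> powr p = \<sigma> / R\<^sup>2"
      unfolding \<sigma>R unfolding \<sigma>_def by (simp add: powr_powr mult.commute)
    define h where "h = (\<lambda>s. 1 + (1 + s / \<sigma>) powr (- \<tau>))"
    define h' where "h' = (\<lambda>s. - (\<tau> / \<sigma>) * (1 + s / \<sigma>) powr (- \<tau> - 1))"
    have pos: "1 + s / \<sigma> > 0" if "s \<ge> 0" for s using that \<sigma> by (simp add: add_pos_nonneg)
    have hd: "(h has_real_derivative h' s) (at s)" if "s \<ge> 0" for s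
      unfolding h_def h'_def using pos[OF that] \<sigma> by (auto intro!: derivative_eq_intros)
    have ch': "continuous_on {0..} h'"
      unfolding h'_def using \<sigma> pos by (intro continuous_intros) (auto simp: less_imp_neq[symmetric])
    have h1: "1 \<le> h s" "h s \<le> 2" if "s \<ge> 0" for s
    proof -
      show "1 \<le> h s" by (simp add: h_def)
      have "(1 + s / \<sigma>) powr (- \<tau>) \<le> (1 + s / \<sigma>) powr 0"
        using that \<sigma> \<tau> by (intro powr_mono) auto
      then show "h s \<le> 2" using pos[OF that] by (simp add: h_def)
    qed
    have hpos: "h s > 0" if "s \<ge> 0" for s using h1(1)[OF that] by simp
    have h'neg: "h' s < 0" if "s \<ge> 0" for s unfolding h'_def using pos[OF that] \<tau> \<sigma> by simp
    have quot: "(h s)\<^sup>2 / (- h' s) \<le> 4 * \<sigma> / \<tau> * (1 + s / \<sigma>) powr q" if "s \<ge> 0" for s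
    proof -
      have "- \<tau> - 1 = - q" by (simp add: q_def)
      then have h'_eq: "h' s = - (\<tau> / \<sigma>) * inverse ((1 + s / \<sigma>) powr q)"
        by (simp only: h'_def powr_minus)
      have "(h s)\<^sup>2 \<le> 2\<^sup>2" using h1[OF that] by (intro power_mono) auto
      then have "(h s)\<^sup>2 / (- h' s) \<le> 4 / (- h' s)" using h'neg[OF that] by (intro divide_right_mono) auto
      also have "4 / (- h' s) = 4 * \<sigma> / \<tau> * (1 + s / \<sigma>) powr q"
        using \<tau> \<sigma> pos[OF that] by (simp add: h'_eq divide_inverse)
      finally show ?thesis .
    qed
    define Z where "Z = (\<lambda>x. (n * (1 / R) / 2)\<^sup>2 * (h (u x))\<^sup>2 / (- h' (u x)) * \<phi> x ^ (n - 2) - \<phi> x ^ n * h (u x) * u x powr p)"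
    have \<phi>K: "\<phi> x = 0" if "x \<notin> K" for x using \<phi>0 K(2) that by blast
    have R0: "0 \<le> 1 / R" using R by simp
    note Z = global_inequality[OF u p sol hd ch' hpos h'neg \<phi>(1,2) R0 lip n(1) K(1) \<phi>K, folded Z_def]
    define B where "B = mball a (2 * R)"
    have [measurable]: "B \<in> sets \<mu>" using open_mball by (simp add: B_def sets_\<mu>)
    have Vm[measurable]: "V \<in> sets \<mu>" using V(1) by (simp add: sets_\<mu>)
    have fin: "emeasure \<mu> S < \<infinity>" if "S \<subseteq> K" for S
    proof -
      have "emeasure \<mu> S \<le> emeasure \<mu> K" using that K(1) by (intro emeasure_mono) (auto simp: sets_\<mu> borel_compact)
      then show ?thesis using emeasure_compact_finite[OF K(1)] by (simp add: le_less_trans)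
    qed
    have "B \<subseteq> K" using K(2) by (simp add: B_def)
    moreover have "V \<subseteq> K" using V(2) K(2) R by fastforce
    ultimately have finB: "emeasure \<mu> B < \<infinity>" and finV: "emeasure \<mu> V < \<infinity>" using fin by auto
    define c where "c = n\<^sup>2 * C / \<tau> * (\<sigma> / R\<^sup>2)"
    have pw: "Z x \<le> c * indicator B x - 1/2 * \<epsilon> powr p * indicator V x" for x
    proof (cases "x \<in> B")
      case True
      define v where "v = u x / \<sigma>"
      have v: "v \<ge> 0" using u(2) \<sigma> by (simp add: v_def)
      have uv: "\<sigma> / R\<^sup>2 * v powr p = u x powr p"
        using u(2)[of x] \<sigma> by (simp add: v_def powr_divide flip: \<sigma>p)
      have "(n * (1 / R) / 2)\<^sup>2 * (h (u x))\<^sup>2 / (- h' (u x)) * \<phi> x ^ (n - 2)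
          = (n * (1 / R) / 2)\<^sup>2 * ((h (u x))\<^sup>2 / (- h' (u x))) * \<phi> x ^ (n - 2)" by simp
      also have "\<dots> \<le> (n * (1 / R) / 2)\<^sup>2 * (4 * \<sigma> / \<tau> * (1 + v) powr q) * \<phi> x ^ (n - 2)"
        unfolding v_def using quot[OF u(2)] \<phi>(2) by (intro mult_right_mono mult_left_mono) auto
      also have "\<dots> = n\<^sup>2 / \<tau> * (\<sigma> / R\<^sup>2) * (\<phi> x ^ (n - 2) * (1 + v) powr q)"
        by (simp add: power_divide power_mult_distrib mult_ac)
      also have "\<dots> \<le> n\<^sup>2 / \<tau> * (\<sigma> / R\<^sup>2) * (\<delta> * (v powr p * \<phi> x ^ n) + C)"
        using \<tau> \<sigma> by (intro mult_left_mono powr_le_absorb_cutoff[OF q n \<delta> C \<phi>(2,3) v]) auto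
      also have "\<dots> = n\<^sup>2 / \<tau> * \<delta> * (\<sigma> / R\<^sup>2 * v powr p) * \<phi> x ^ n + c"
        by (simp add: c_def algebra_simps add_divide_distrib)
      also have "n\<^sup>2 / \<tau> * \<delta> = 1/2" using \<tau> n by (simp add: \<delta>_def)
      finally have "(n * (1 / R) / 2)\<^sup>2 * (h (u x))\<^sup>2 / (- h' (u x)) * \<phi> x ^ (n - 2) \<le> 1/2 * u x powr p * \<phi> x ^ n + c"
        unfolding uv .
      moreover have "1 * (\<phi> x ^ n * u x powr p) \<le> h (u x) * (\<phi> x ^ n * u x powr p)"
        using h1(1)[OF u(2)] \<phi>(2) by (intro mult_right_mono) auto
      ultimately have "Z x \<le> c - 1/2 * (\<phi> x ^ n * u x powr p)"
        unfolding Z_def by (simp add: mult_ac)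
      moreover have "\<epsilon> powr p * indicator V x \<le> \<phi> x ^ n * u x powr p"
      proof (cases "x \<in> V")
        case True
        then have "\<phi> x = 1" using \<phi>1 V(2) by blast
        then show ?thesis using True V(3,4) p by (auto intro!: powr_mono2)
      qed (use \<phi>(2) in simp)
      ultimately show ?thesis using True by simp
    next
      case False
      moreover have "x \<notin> V" using False V(2) R unfolding B_def by fastforce
      ultimately show ?thesis using \<phi>0[of x] n(1) by (simp add: Z_def B_def power_0_left)
    qed
    have iB: "integrable \<mu> (\<lambda>x. c * indicator B x)" and iV: "integrable \<mu> (\<lambda>x. 1/2 * \<epsilon> powr p * indicator V x)"
      using finB finV by (auto intro!: integrable_mult_right integrable_real_indicator)
    have "0 \<le> (\<integral>x. Z x \<partial>\<mu>)" by (rule Z(2))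
    also have "\<dots> \<le> (\<integral>x. c * indicator B x - 1/2 * \<epsilon> powr p * indicator V x \<partial>\<mu>)"
      by (rule integral_mono[OF Z(1) Bochner_Integration.integrable_diff[OF iB iV] pw])
    also have "\<dots> = c * measure \<mu> B - 1/2 * \<epsilon> powr p * measure \<mu> V"
      by (subst Bochner_Integration.integral_diff[OF iB iV]) (simp add: space_\<mu>)
    finally have "\<epsilon> powr p * measure \<mu> V \<le> 2 * c * measure \<mu> B" by simp
    then show "\<epsilon> powr p * measure \<mu> V \<le> 2 * n\<^sup>2 * C / \<tau> * R powr (- (2 * p / (p - 1))) * measure \<mu> (mball a (2 * R))"
      unfolding c_def \<sigma>R B_def by (simp add: mult_ac)
  qed
qed

lemma lane_emden_liouville:
  assumes complete: mcomplete and u: "Ck_fun A 2 u" "\<And>q. u q \<ge> 0" and p: "p > 1"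
    and sol: "solves_lane_emden A G f p u"
    and growth: "(\<lambda>R. measure \<mu> (mball a R)) \<in> o[at_top](\<lambda>R. R powr (2 * p / (p - 1)))"
  shows "u q = 0"
proof (rule ccontr)
  assume "u q \<noteq> 0"
  then have uq: "u q > 0" using u(2)[of q] by simp
  let ?N = "2 * p / (p - 1)"
  obtain C where C: "C \<ge> 0" and est: "\<And>R V \<epsilon>. R > 0 \<Longrightarrow> V \<in> sets borel \<Longrightarrow> V \<subseteq> mball a R \<Longrightarrow> \<epsilon> \<ge> 0 \<Longrightarrow>
      (\<And>q. q \<in> V \<Longrightarrow> \<epsilon> \<le> u q) \<Longrightarrow> \<epsilon> powr p * measure \<mu> V \<le> C * R powr (- ?N) * measure \<mu> (mball a (2 * R))"
    using energy_estimate[OF complete u p sol] by metis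
  define \<epsilon> where "\<epsilon> = u q / 2"
  define R0 where "R0 = d a q + 1"
  define V where "V = {x. \<epsilon> < u x} \<inter> mball a R0"
  have cu: "continuous_on UNIV u" by (rule C1_fun_continuous_on[OF Ck_fun_mono[OF u(1)]]) simp
  have V: "open V" unfolding V_def
    by (intro open_Int open_mball open_Collect_less[OF continuous_on_const cu])
  have qV: "q \<in> V" using uq by (simp add: V_def \<epsilon>_def R0_def)
  obtain K where K: "compact K" "mball a R0 \<subseteq> K" by (rule mball_subset_compact[OF complete])
  have "emeasure \<mu> V \<le> emeasure \<mu> K"
    using K by (intro emeasure_mono) (auto simp: V_def sets_\<mu> borel_compact)
  then have "emeasure \<mu> V < \<infinity>" using emeasure_compact_finite[OF K(1)] by (simp add: le_less_trans)
  then have mV: "measure \<mu> V > 0"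
    using emeasure_open_pos[OF V qV] by (simp add: measure_def enn2real_positive_iff)
  define m where "m = \<epsilon> powr p * measure \<mu> V"
  have m: "m > 0" using mV uq by (simp add: m_def \<epsilon>_def)
  define D where "D = C * 2 powr ?N + 1"
  define e where "e = m / (2 * D)"
  have D: "D > 0" using C by (simp add: D_def add_nonneg_pos)
  have e: "e > 0" using m D by (simp add: e_def)
  have "eventually (\<lambda>R. norm (measure \<mu> (mball a R)) \<le> e * norm (R powr ?N)) at_top"
    by (rule landau_o.smallD[OF growth e])
  then obtain R1 where R1: "\<And>R. R \<ge> R1 \<Longrightarrow> measure \<mu> (mball a R) \<le> e * R powr ?N"
    unfolding eventually_at_top_linorder by auto
  define R where "R = max R0 (max R1 1)"
  have R: "R > 0" "R \<ge> R0" "2 * R \<ge> R1" by (auto simp: R_def)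
  have "m \<le> C * R powr (- ?N) * measure \<mu> (mball a (2 * R))"
    unfolding m_def
  proof (rule est[OF R(1)])
    show "V \<in> sets borel" using V by simp
    show "V \<subseteq> mball a R" using R(2) by (auto simp: V_def)
    show "\<epsilon> \<ge> 0" using uq by (simp add: \<epsilon>_def)
  qed (simp add: V_def)
  also have "\<dots> \<le> C * R powr (- ?N) * (e * (2 * R) powr ?N)"
    using C R1[OF R(3)] by (intro mult_left_mono) auto
  also have "\<dots> = e * (C * 2 powr ?N)"
    using R(1) by (simp add: powr_mult powr_minus)
  also have "\<dots> \<le> e * D" using e by (simp add: D_def)
  also have "\<dots> = m / 2" using D by (simp add: e_def)
  finally show False using m by simp
qed

end

theorem theorem2p6:
  fixes A :: "('m::{t2_space, second_countable_topology}, 'n::finite) chart set"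
    and G :: "('m, 'n) metric_components"
    and f u :: "'m \<Rightarrow> real"
    and \<mu> :: "'m measure"
    and p :: real
  assumes "weighted_riemannian_manifold A G f \<mu>"
    and "CARD('n) \<ge> 2"
    and "riem_complete A G"
    and "connected (UNIV :: 'm set)"
    and "\<not> compact (UNIV :: 'm set)"
    and "Ck_fun A 3 u"
    and "\<forall>q. u q \<ge> 0"
    and "p > 1"
    and "solves_lane_emden A G f p u"
    and "\<exists>a. (\<lambda>R. measure \<mu> (geodesic_ball A G a R)) \<in> o[at_top](\<lambda>R. R powr (2 * p / (p - 1)))"
  shows "\<forall>q. u q = 0"
proof -
  interpret weighted_riemannian A G f \<mu>
    using assms(1,4) unfolding weighted_riemannian_manifold_def by unfold_locales auto
  have "geodesic_ball A G a R = mball a R" for a R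
    by (auto simp: geodesic_ball_def)
  then obtain a where "(\<lambda>R. measure \<mu> (mball a R)) \<in> o[at_top](\<lambda>R. R powr (2 * p / (p - 1)))"
    using assms(10) by auto
  moreover have "mcomplete" using assms(3) by (simp add: riem_complete_def)
  moreover have "Ck_fun A 2 u" using assms(6) by (rule Ck_fun_mono) simp
  ultimately show ?thesis using lane_emden_liouville assms(7,8,9) by blast
qed

end
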